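(* For any map $f:A\to X$ in $\mathcal{U}$ the following are equivalent: (1) $f$ is an embedding; (2) $f$ is a canonical idempotent for the join operation on maps, in the sense that the map $\mathsf{inl}:A\to A\ast_X A$ is an equivalence.
   Context: Setting: Martin-Löf type theory with function extensionality and a univalent universe $\mathcal{U}$ containing the usual types ($\emptyset$, unit, $\mathbb{N}$, $\times,\Pi,+,\Sigma$, identity types) and closed under homotopy pushouts and sequential colimits (via graph quotients, i.e. homotopy coequalizers). No propositional truncation is assumed. A map is an embedding if its homotopy fibers are mere propositions. For maps $f:A\to X$ and $g:B\to X$, the type $A\ast_X B$ is the pushout of the span $A\xleftarrow{\pi_1}A\times_X B\xrightarrow{\pi_2}B$, where $A\times_X B=\sum_{a:A}\sum_{b:B}f(a)=g(b)$ is the pullback, with point constructors $\mathsf{inl}:A\to A\ast_X B$ and $\mathsf{inr}:B\to A\ast_X B$. In (2) this is applied with $g=f$. *)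

theory Defs
  imports Main
begin

text \<open>
  The informal theorem is a theorem of a formal system, so it is stated here as the derivability of
  a judgement. This theory defines that system: Martin-Loef type theory with one universe
  \<open>\<U>\<close>, which is univalent, contains the usual types and is closed under homotopy coequalizers;
  function extensionality holds for all types. There is no propositional truncation.
  Pushouts, and likewise sequential colimits, are particular homotopy coequalizers.
  A graph quotient with edge types \<open>E u v\<close> is the coequalizer of the source and target
  maps of \<open>\<Sum>u v. E u v\<close>.

  Terms use de Bruijn indices; contexts are lists whose head is the most recently declared type.
  The rules follow the style of Appendix A.2 of the HoTT book (typed judgemental equality,
  universe a la Russell), except that path induction is based and that there is just one universe.
  In place of further universes there is the judgement that \<open>A\<close> is a type, written
  \<open>\<Gamma> \<turnstile> A \<Colon> Type\<close>. The symbol \<open>Type\<close> is not a type itself: in derivable judgements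
  it occurs only immediately to the right of \<open>\<Colon>\<close>.
\<close>

section \<open>Raw syntax\<close>

datatype level = Small | Large

text \<open>
  The comments name the variables bound in the arguments. Where an argument binds two variables,
  index 0 is the last one named.
\<close>

datatype tm =
    Var nat
  | Univ level
  | Pi tm tm                \<comment> \<open>\<open>Pi A (x. B)\<close>\<close>
  | Lam tm tm               \<comment> \<open>\<open>Lam A (x. b)\<close>\<close>
  | App tm tm
  | Sig tm tm               \<comment> \<open>\<open>Sig A (x. B)\<close>\<close>
  | Pr tm tm
  | SigInd tm tm tm         \<comment> \<open>\<open>SigInd (z. C) (x y. g) p\<close>\<close>
  | Sum tm tm
  | InL tm
  | InR tm
  | SumInd tm tm tm tm      \<comment> \<open>\<open>SumInd (z. C) (x. c) (y. d) p\<close>\<close>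
  | Empty
  | EmptyInd tm tm          \<comment> \<open>\<open>EmptyInd (z. C) p\<close>\<close>
  | Unit
  | Star
  | UnitInd tm tm tm        \<comment> \<open>\<open>UnitInd (z. C) c p\<close>\<close>
  | Nat
  | Zero
  | Succ tm
  | NatInd tm tm tm tm      \<comment> \<open>\<open>NatInd (z. C) c (x y. d) n\<close>\<close>
  | Eq tm tm tm             \<comment> \<open>identity type \<open>Eq A a b\<close>\<close>
  | Refl tm
  | EqInd tm tm tm tm tm    \<comment> \<open>based path induction \<open>EqInd a (y p. C) c b q\<close>\<close>
  | Coeq tm tm tm tm        \<comment> \<open>coequalizer \<open>Coeq E V s t\<close> of \<open>s, t : E \<rightarrow> V\<close>\<close>
  | Pt tm
  | Glue tm
  | CoeqInd tm tm tm tm     \<comment> \<open>\<open>CoeqInd (z. C) (v. c) (e. d) q\<close>\<close>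
  | CoeqGlue tm tm tm tm    \<comment> \<open>path computation for \<open>CoeqInd\<close>: \<open>CoeqGlue (z. C) (v. c) (e. d) e\<close>\<close>
  | FunExt tm tm tm tm      \<comment> \<open>\<open>FunExt A (x. B) f g\<close>\<close>
  | Ua tm tm

abbreviation UU :: tm ("\<U>") where "\<U> \<equiv> Univ Small"
abbreviation Type :: tm where "Type \<equiv> Univ Large"

definition upr :: "(nat \<Rightarrow> nat) \<Rightarrow> nat \<Rightarrow> nat" where
  "upr \<rho> = case_nat 0 (\<lambda>i. Suc (\<rho> i))"

primrec ren :: "(nat \<Rightarrow> nat) \<Rightarrow> tm \<Rightarrow> tm" where
  "ren \<rho> (Var i) = Var (\<rho> i)"
| "ren \<rho> (Univ l) = Univ l"
| "ren \<rho> (Pi A B) = Pi (ren \<rho> A) (ren (upr \<rho>) B)"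
| "ren \<rho> (Lam A b) = Lam (ren \<rho> A) (ren (upr \<rho>) b)"
| "ren \<rho> (App f a) = App (ren \<rho> f) (ren \<rho> a)"
| "ren \<rho> (Sig A B) = Sig (ren \<rho> A) (ren (upr \<rho>) B)"
| "ren \<rho> (Pr a b) = Pr (ren \<rho> a) (ren \<rho> b)"
| "ren \<rho> (SigInd C g p) = SigInd (ren (upr \<rho>) C) (ren (upr (upr \<rho>)) g) (ren \<rho> p)"
| "ren \<rho> (Sum A B) = Sum (ren \<rho> A) (ren \<rho> B)"
| "ren \<rho> (InL a) = InL (ren \<rho> a)"
| "ren \<rho> (InR a) = InR (ren \<rho> a)"
| "ren \<rho> (SumInd C c d p) =
     SumInd (ren (upr \<rho>) C) (ren (upr \<rho>) c) (ren (upr \<rho>) d) (ren \<rho> p)"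
| "ren \<rho> Empty = Empty"
| "ren \<rho> (EmptyInd C p) = EmptyInd (ren (upr \<rho>) C) (ren \<rho> p)"
| "ren \<rho> Unit = Unit"
| "ren \<rho> Star = Star"
| "ren \<rho> (UnitInd C c p) = UnitInd (ren (upr \<rho>) C) (ren \<rho> c) (ren \<rho> p)"
| "ren \<rho> Nat = Nat"
| "ren \<rho> Zero = Zero"
| "ren \<rho> (Succ n) = Succ (ren \<rho> n)"
| "ren \<rho> (NatInd C c d n) =
     NatInd (ren (upr \<rho>) C) (ren \<rho> c) (ren (upr (upr \<rho>)) d) (ren \<rho> n)"
| "ren \<rho> (Eq A a b) = Eq (ren \<rho> A) (ren \<rho> a) (ren \<rho> b)"
| "ren \<rho> (Refl a) = Refl (ren \<rho> a)"
| "ren \<rho> (EqInd a C c b q) =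
     EqInd (ren \<rho> a) (ren (upr (upr \<rho>)) C) (ren \<rho> c) (ren \<rho> b) (ren \<rho> q)"
| "ren \<rho> (Coeq E V s t) = Coeq (ren \<rho> E) (ren \<rho> V) (ren \<rho> s) (ren \<rho> t)"
| "ren \<rho> (Pt v) = Pt (ren \<rho> v)"
| "ren \<rho> (Glue e) = Glue (ren \<rho> e)"
| "ren \<rho> (CoeqInd C c d q) =
     CoeqInd (ren (upr \<rho>) C) (ren (upr \<rho>) c) (ren (upr \<rho>) d) (ren \<rho> q)"
| "ren \<rho> (CoeqGlue C c d e) =
     CoeqGlue (ren (upr \<rho>) C) (ren (upr \<rho>) c) (ren (upr \<rho>) d) (ren \<rho> e)"
| "ren \<rho> (FunExt A B f g) = FunExt (ren \<rho> A) (ren (upr \<rho>) B) (ren \<rho> f) (ren \<rho> g)"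
| "ren \<rho> (Ua A B) = Ua (ren \<rho> A) (ren \<rho> B)"

definition ups :: "(nat \<Rightarrow> tm) \<Rightarrow> nat \<Rightarrow> tm" where
  "ups \<sigma> = case_nat (Var 0) (\<lambda>i. ren Suc (\<sigma> i))"

primrec sub :: "(nat \<Rightarrow> tm) \<Rightarrow> tm \<Rightarrow> tm" where
  "sub \<sigma> (Var i) = \<sigma> i"
| "sub \<sigma> (Univ l) = Univ l"
| "sub \<sigma> (Pi A B) = Pi (sub \<sigma> A) (sub (ups \<sigma>) B)"
| "sub \<sigma> (Lam A b) = Lam (sub \<sigma> A) (sub (ups \<sigma>) b)"
| "sub \<sigma> (App f a) = App (sub \<sigma> f) (sub \<sigma> a)"
| "sub \<sigma> (Sig A B) = Sig (sub \<sigma> A) (sub (ups \<sigma>) B)"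
| "sub \<sigma> (Pr a b) = Pr (sub \<sigma> a) (sub \<sigma> b)"
| "sub \<sigma> (SigInd C g p) = SigInd (sub (ups \<sigma>) C) (sub (ups (ups \<sigma>)) g) (sub \<sigma> p)"
| "sub \<sigma> (Sum A B) = Sum (sub \<sigma> A) (sub \<sigma> B)"
| "sub \<sigma> (InL a) = InL (sub \<sigma> a)"
| "sub \<sigma> (InR a) = InR (sub \<sigma> a)"
| "sub \<sigma> (SumInd C c d p) =
     SumInd (sub (ups \<sigma>) C) (sub (ups \<sigma>) c) (sub (ups \<sigma>) d) (sub \<sigma> p)"
| "sub \<sigma> Empty = Empty"
| "sub \<sigma> (EmptyInd C p) = EmptyInd (sub (ups \<sigma>) C) (sub \<sigma> p)"
| "sub \<sigma> Unit = Unit"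
| "sub \<sigma> Star = Star"
| "sub \<sigma> (UnitInd C c p) = UnitInd (sub (ups \<sigma>) C) (sub \<sigma> c) (sub \<sigma> p)"
| "sub \<sigma> Nat = Nat"
| "sub \<sigma> Zero = Zero"
| "sub \<sigma> (Succ n) = Succ (sub \<sigma> n)"
| "sub \<sigma> (NatInd C c d n) =
     NatInd (sub (ups \<sigma>) C) (sub \<sigma> c) (sub (ups (ups \<sigma>)) d) (sub \<sigma> n)"
| "sub \<sigma> (Eq A a b) = Eq (sub \<sigma> A) (sub \<sigma> a) (sub \<sigma> b)"
| "sub \<sigma> (Refl a) = Refl (sub \<sigma> a)"
| "sub \<sigma> (EqInd a C c b q) =
     EqInd (sub \<sigma> a) (sub (ups (ups \<sigma>)) C) (sub \<sigma> c) (sub \<sigma> b) (sub \<sigma> q)"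
| "sub \<sigma> (Coeq E V s t) = Coeq (sub \<sigma> E) (sub \<sigma> V) (sub \<sigma> s) (sub \<sigma> t)"
| "sub \<sigma> (Pt v) = Pt (sub \<sigma> v)"
| "sub \<sigma> (Glue e) = Glue (sub \<sigma> e)"
| "sub \<sigma> (CoeqInd C c d q) =
     CoeqInd (sub (ups \<sigma>) C) (sub (ups \<sigma>) c) (sub (ups \<sigma>) d) (sub \<sigma> q)"
| "sub \<sigma> (CoeqGlue C c d e) =
     CoeqGlue (sub (ups \<sigma>) C) (sub (ups \<sigma>) c) (sub (ups \<sigma>) d) (sub \<sigma> e)"
| "sub \<sigma> (FunExt A B f g) = FunExt (sub \<sigma> A) (sub (ups \<sigma>) B) (sub \<sigma> f) (sub \<sigma> g)"
| "sub \<sigma> (Ua A B) = Ua (sub \<sigma> A) (sub \<sigma> B)"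

text \<open>
  \<open>wk n\<close> weakens by \<open>n\<close> variables, \<open>wkb n\<close> does so underneath one bound variable.
  For \<open>C\<close> in context \<open>A # \<Gamma>\<close>, \<open>subn n C a\<close> is \<open>C[a]\<close> for a term \<open>a\<close> in a context that extends
  \<open>\<Gamma>\<close> by \<open>n\<close> variables. For \<open>C\<close> in context \<open>B # A # \<Gamma>\<close>, \<open>sub2 C a b\<close> is \<open>C[a, b]\<close>.
\<close>

definition wk :: "nat \<Rightarrow> tm \<Rightarrow> tm" where "wk n = ren (\<lambda>i. i + n)"
definition wkb :: "nat \<Rightarrow> tm \<Rightarrow> tm" where "wkb n = ren (upr (\<lambda>i. i + n))"
definition subn :: "nat \<Rightarrow> tm \<Rightarrow> tm \<Rightarrow> tm" where
  "subn n C a = sub (case_nat a (\<lambda>i. Var (i + n))) C"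
definition sub1 :: "tm \<Rightarrow> tm \<Rightarrow> tm" where "sub1 C a = sub (case_nat a Var) C"
definition sub2 :: "tm \<Rightarrow> tm \<Rightarrow> tm \<Rightarrow> tm" where
  "sub2 C a b = sub (case_nat b (case_nat a Var)) C"


section \<open>Types defined in the theory\<close>

definition arr :: "tm \<Rightarrow> tm \<Rightarrow> tm" where "arr A B = Pi A (wk 1 B)"
definition prd :: "tm \<Rightarrow> tm \<Rightarrow> tm" where "prd A B = Sig A (wk 1 B)"
definition iff :: "tm \<Rightarrow> tm \<Rightarrow> tm" where "iff P Q = prd (arr P Q) (arr Q P)"

definition is_prop :: "tm \<Rightarrow> tm" where
  "is_prop P = Pi P (Pi (wk 1 P) (Eq (wk 2 P) (Var 1) (Var 0)))"

definition is_contr :: "tm \<Rightarrow> tm" where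
  "is_contr P = Sig P (Pi (wk 1 P) (Eq (wk 2 P) (Var 1) (Var 0)))"

text \<open>The homotopy fiber \<open>\<Sum>a:A. f a = y\<close> of \<open>f : A \<rightarrow> B\<close>.\<close>

definition fib :: "tm \<Rightarrow> tm \<Rightarrow> tm \<Rightarrow> tm \<Rightarrow> tm" where
  "fib A B f y = Sig A (Eq (wk 1 B) (App (wk 1 f) (Var 0)) (wk 1 y))"

definition is_emb :: "tm \<Rightarrow> tm \<Rightarrow> tm \<Rightarrow> tm" where
  "is_emb A B f = Pi B (is_prop (fib (wk 1 A) (wk 1 B) (wk 1 f) (Var 0)))"

text \<open>Equivalences are maps with contractible homotopy fibers (Voevodsky's definition).\<close>

definition is_equiv :: "tm \<Rightarrow> tm \<Rightarrow> tm \<Rightarrow> tm" where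
  "is_equiv A B f = Pi B (is_contr (fib (wk 1 A) (wk 1 B) (wk 1 f) (Var 0)))"

definition equiv :: "tm \<Rightarrow> tm \<Rightarrow> tm" where
  "equiv A B = Sig (arr A B) (is_equiv (wk 1 A) (wk 1 B) (Var 0))"

text \<open>
  \<open>transp C a b q u : C[b]\<close> is the transport of \<open>u : C[a]\<close> along \<open>q : a = b\<close>, for a family \<open>x. C\<close>,
  and \<open>apd C F a b q : transp C a b q F[a] = F[b]\<close> is the action of the section \<open>x. F\<close> of \<open>C\<close>.
\<close>

definition transp :: "tm \<Rightarrow> tm \<Rightarrow> tm \<Rightarrow> tm \<Rightarrow> tm \<Rightarrow> tm" where
  "transp C a b q u = EqInd a (wk 1 C) u b q"

definition apd :: "tm \<Rightarrow> tm \<Rightarrow> tm \<Rightarrow> tm \<Rightarrow> tm \<Rightarrow> tm" where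
  "apd C F a b q =
     EqInd a
       (Eq (wk 1 C) (transp (wkb 2 C) (wk 2 a) (Var 1) (Var 0) (wk 2 (sub1 F a))) (wk 1 F))
       (Refl (sub1 F a)) b q"

text \<open>
  The type \<open>transp C (Pt (s e)) (Pt (t e)) (Glue e) c[s e] = c[t e]\<close> of the data over a path constructor
  \<open>Glue e : Pt (s e) = Pt (t e)\<close> in the induction principle of \<open>Coeq E V s t\<close>.
\<close>

definition coeq_path :: "tm \<Rightarrow> tm \<Rightarrow> tm \<Rightarrow> tm \<Rightarrow> tm \<Rightarrow> tm" where
  "coeq_path C c s t e =
     Eq (sub1 C (Pt (App t e)))
       (transp C (Pt (App s e)) (Pt (App t e)) (Glue e) (sub1 c (App s e)))
       (sub1 c (App t e))"

text \<open>The map \<open>(f = g) \<rightarrow> (\<Prod>x:A. f x = g x)\<close>; \<open>homot A B f g\<close> is its codomain.\<close>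

definition homot :: "tm \<Rightarrow> tm \<Rightarrow> tm \<Rightarrow> tm \<Rightarrow> tm" where
  "homot A B f g = Pi A (Eq B (App (wk 1 f) (Var 0)) (App (wk 1 g) (Var 0)))"

definition happly :: "tm \<Rightarrow> tm \<Rightarrow> tm \<Rightarrow> tm \<Rightarrow> tm" where
  "happly A B f g =
     Lam (Eq (Pi A B) f g)
       (EqInd (wk 1 f) (homot (wk 3 A) (wkb 3 B) (wk 3 f) (Var 1))
         (Lam (wk 1 A) (Refl (App (wk 2 f) (Var 0)))) (wk 1 g) (Var 0))"

text \<open>
  The map \<open>(A = B) \<rightarrow> (A \<simeq> B)\<close>, which sends \<open>refl\<close> to the identity equivalence. The term
  \<open>idfun_equiv A\<close> proves that the identity is an equivalence: its fiber at \<open>y\<close> has center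
  \<open>(y, refl)\<close>, and \<open>(y, refl) = (a, q)\<close> holds by path induction on \<open>q : id a = y\<close>.
\<close>

definition idfun :: "tm \<Rightarrow> tm" where "idfun A = Lam A (Var 0)"

definition idfun_equiv :: "tm \<Rightarrow> tm" where
  "idfun_equiv A =
     Lam A (Pr (Pr (Var 0) (Refl (Var 0)))
       (Lam (fib (wk 1 A) (wk 1 A) (idfun (wk 1 A)) (Var 0))
         (SigInd
           (Eq (fib (wk 3 A) (wk 3 A) (idfun (wk 3 A)) (Var 2))
             (Pr (Var 2) (Refl (Var 2))) (Var 0))
           (EqInd (App (idfun (wk 4 A)) (Var 1))
             (Eq (fib (wk 6 A) (wk 6 A) (idfun (wk 6 A)) (Var 1))
               (Pr (Var 1) (Refl (Var 1))) (Pr (Var 3) (Var 0)))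
             (Refl (Pr (Var 1) (Refl (Var 1))))
             (Var 3) (Var 0))
           (Var 0))))"

definition idtoequiv :: "tm \<Rightarrow> tm \<Rightarrow> tm" where
  "idtoequiv A B =
     Lam (Eq \<U> A B)
       (EqInd (wk 1 A) (equiv (wk 3 A) (Var 1))
         (Pr (idfun (wk 1 A)) (idfun_equiv (wk 1 A))) (wk 1 B) (Var 0))"

text \<open>
  The pushout of \<open>A \<leftarrow> S \<rightarrow> B\<close> is the coequalizer of \<open>inl \<circ> h, inr \<circ> k : S \<rightarrow> A + B\<close>;
  \<open>pushout_inl A\<close> and \<open>pushout_inr B\<close> are its point constructors, as maps.
\<close>

definition pushout :: "tm \<Rightarrow> tm \<Rightarrow> tm \<Rightarrow> tm \<Rightarrow> tm \<Rightarrow> tm" where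
  "pushout S A B h k =
     Coeq S (Sum A B) (Lam S (InL (App (wk 1 h) (Var 0)))) (Lam S (InR (App (wk 1 k) (Var 0))))"

definition pushout_inl :: "tm \<Rightarrow> tm" where "pushout_inl A = Lam A (Pt (InL (Var 0)))"
definition pushout_inr :: "tm \<Rightarrow> tm" where "pushout_inr B = Lam B (Pt (InR (Var 0)))"

definition pullback :: "tm \<Rightarrow> tm \<Rightarrow> tm \<Rightarrow> tm \<Rightarrow> tm \<Rightarrow> tm" where
  "pullback A B X f g =
     Sig A (Sig (wk 1 B) (Eq (wk 2 X) (App (wk 2 f) (Var 1)) (App (wk 2 g) (Var 0))))"

definition pullback_fst :: "tm \<Rightarrow> tm \<Rightarrow> tm \<Rightarrow> tm \<Rightarrow> tm \<Rightarrow> tm" where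
  "pullback_fst A B X f g =
     Lam (pullback A B X f g) (SigInd (wk 2 A) (Var 1) (Var 0))"

definition pullback_snd :: "tm \<Rightarrow> tm \<Rightarrow> tm \<Rightarrow> tm \<Rightarrow> tm \<Rightarrow> tm" where
  "pullback_snd A B X f g =
     Lam (pullback A B X f g)
       (SigInd (wk 2 B) (SigInd (wk 4 B) (Var 1) (Var 0)) (Var 0))"

text \<open>The type \<open>A *\<^sub>X B\<close> for \<open>f : A \<rightarrow> X\<close> and \<open>g : B \<rightarrow> X\<close>.\<close>

definition join :: "tm \<Rightarrow> tm \<Rightarrow> tm \<Rightarrow> tm \<Rightarrow> tm \<Rightarrow> tm" where
  "join A B X f g =
     pushout (pullback A B X f g) A B (pullback_fst A B X f g) (pullback_snd A B X f g)"


section \<open>Judgements\<close>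

text \<open>
  Weakening, substitution, and the presuppositions of the judgements are not rules.
  A formation rule for a level \<open>l\<close> is two rules: one for types, one for elements of \<open>\<U>\<close>.
\<close>

inductive
  wf :: "tm list \<Rightarrow> bool" ("\<turnstile> _" [50] 50) and
  typing :: "tm list \<Rightarrow> tm \<Rightarrow> tm \<Rightarrow> bool" ("_ \<turnstile> _ \<Colon> _" [51, 51, 51] 50) and
  equality :: "tm list \<Rightarrow> tm \<Rightarrow> tm \<Rightarrow> tm \<Rightarrow> bool" ("_ \<turnstile> _ \<doteq> _ \<Colon> _" [51, 51, 51, 51] 50)
where
  \<comment> \<open>contexts and structural rules\<close>
  wf_Nil: "\<turnstile> []"
| wf_Cons: "\<Gamma> \<turnstile> A \<Colon> Type \<Longrightarrow> \<turnstile> A # \<Gamma>"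
| Var: "\<turnstile> \<Gamma> \<Longrightarrow> i < length \<Gamma> \<Longrightarrow> \<Gamma> \<turnstile> Var i \<Colon> wk (Suc i) (\<Gamma> ! i)"
| conv: "\<Gamma> \<turnstile> a \<Colon> A \<Longrightarrow> \<Gamma> \<turnstile> A \<doteq> B \<Colon> Type \<Longrightarrow> \<Gamma> \<turnstile> a \<Colon> B"
| refl: "\<Gamma> \<turnstile> a \<Colon> A \<Longrightarrow> \<Gamma> \<turnstile> a \<doteq> a \<Colon> A"
| sym: "\<Gamma> \<turnstile> a \<doteq> b \<Colon> A \<Longrightarrow> \<Gamma> \<turnstile> b \<doteq> a \<Colon> A"
| trans: "\<Gamma> \<turnstile> a \<doteq> b \<Colon> A \<Longrightarrow> \<Gamma> \<turnstile> b \<doteq> c \<Colon> A \<Longrightarrow> \<Gamma> \<turnstile> a \<doteq> c \<Colon> A"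
| eq_conv: "\<Gamma> \<turnstile> a \<doteq> b \<Colon> A \<Longrightarrow> \<Gamma> \<turnstile> A \<doteq> B \<Colon> Type \<Longrightarrow> \<Gamma> \<turnstile> a \<doteq> b \<Colon> B"

  \<comment> \<open>the universe\<close>
| Univ: "\<turnstile> \<Gamma> \<Longrightarrow> \<Gamma> \<turnstile> \<U> \<Colon> Type"
| cumul: "\<Gamma> \<turnstile> A \<Colon> \<U> \<Longrightarrow> \<Gamma> \<turnstile> A \<Colon> Type"
| eq_cumul: "\<Gamma> \<turnstile> A \<doteq> B \<Colon> \<U> \<Longrightarrow> \<Gamma> \<turnstile> A \<doteq> B \<Colon> Type"

  \<comment> \<open>dependent function types\<close>
| Pi: "\<Gamma> \<turnstile> A \<Colon> Univ l \<Longrightarrow> A # \<Gamma> \<turnstile> B \<Colon> Univ l \<Longrightarrow> \<Gamma> \<turnstile> Pi A B \<Colon> Univ l"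
| Lam: "\<Gamma> \<turnstile> A \<Colon> Type \<Longrightarrow> A # \<Gamma> \<turnstile> b \<Colon> B \<Longrightarrow> \<Gamma> \<turnstile> Lam A b \<Colon> Pi A B"
| App: "\<Gamma> \<turnstile> f \<Colon> Pi A B \<Longrightarrow> \<Gamma> \<turnstile> a \<Colon> A \<Longrightarrow> \<Gamma> \<turnstile> App f a \<Colon> sub1 B a"
| Pi_beta: "A # \<Gamma> \<turnstile> b \<Colon> B \<Longrightarrow> \<Gamma> \<turnstile> a \<Colon> A \<Longrightarrow> \<Gamma> \<turnstile> App (Lam A b) a \<doteq> sub1 b a \<Colon> sub1 B a"
| Pi_eta: "\<Gamma> \<turnstile> f \<Colon> Pi A B \<Longrightarrow> \<Gamma> \<turnstile> f \<doteq> Lam A (App (wk 1 f) (Var 0)) \<Colon> Pi A B"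
| Pi_cong: "\<Gamma> \<turnstile> A \<doteq> A' \<Colon> Univ l \<Longrightarrow> A # \<Gamma> \<turnstile> B \<doteq> B' \<Colon> Univ l \<Longrightarrow>
    \<Gamma> \<turnstile> Pi A B \<doteq> Pi A' B' \<Colon> Univ l"
| Lam_cong: "\<Gamma> \<turnstile> A \<doteq> A' \<Colon> Type \<Longrightarrow> A # \<Gamma> \<turnstile> b \<doteq> b' \<Colon> B \<Longrightarrow>
    \<Gamma> \<turnstile> Lam A b \<doteq> Lam A' b' \<Colon> Pi A B"
| App_cong: "\<Gamma> \<turnstile> f \<doteq> f' \<Colon> Pi A B \<Longrightarrow> \<Gamma> \<turnstile> a \<doteq> a' \<Colon> A \<Longrightarrow>
    \<Gamma> \<turnstile> App f a \<doteq> App f' a' \<Colon> sub1 B a"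

  \<comment> \<open>dependent pair types\<close>
| Sig: "\<Gamma> \<turnstile> A \<Colon> Univ l \<Longrightarrow> A # \<Gamma> \<turnstile> B \<Colon> Univ l \<Longrightarrow> \<Gamma> \<turnstile> Sig A B \<Colon> Univ l"
| Pr: "A # \<Gamma> \<turnstile> B \<Colon> Type \<Longrightarrow> \<Gamma> \<turnstile> a \<Colon> A \<Longrightarrow> \<Gamma> \<turnstile> b \<Colon> sub1 B a \<Longrightarrow> \<Gamma> \<turnstile> Pr a b \<Colon> Sig A B"
| SigInd: "Sig A B # \<Gamma> \<turnstile> C \<Colon> Type \<Longrightarrow> B # A # \<Gamma> \<turnstile> g \<Colon> subn 2 C (Pr (Var 1) (Var 0)) \<Longrightarrow>
    \<Gamma> \<turnstile> p \<Colon> Sig A B \<Longrightarrow> \<Gamma> \<turnstile> SigInd C g p \<Colon> sub1 C p"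
| Sig_beta: "Sig A B # \<Gamma> \<turnstile> C \<Colon> Type \<Longrightarrow> B # A # \<Gamma> \<turnstile> g \<Colon> subn 2 C (Pr (Var 1) (Var 0)) \<Longrightarrow>
    \<Gamma> \<turnstile> a \<Colon> A \<Longrightarrow> \<Gamma> \<turnstile> b \<Colon> sub1 B a \<Longrightarrow>
    \<Gamma> \<turnstile> SigInd C g (Pr a b) \<doteq> sub2 g a b \<Colon> sub1 C (Pr a b)"
| Sig_cong: "\<Gamma> \<turnstile> A \<doteq> A' \<Colon> Univ l \<Longrightarrow> A # \<Gamma> \<turnstile> B \<doteq> B' \<Colon> Univ l \<Longrightarrow>
    \<Gamma> \<turnstile> Sig A B \<doteq> Sig A' B' \<Colon> Univ l"
| Pr_cong: "A # \<Gamma> \<turnstile> B \<Colon> Type \<Longrightarrow> \<Gamma> \<turnstile> a \<doteq> a' \<Colon> A \<Longrightarrow> \<Gamma> \<turnstile> b \<doteq> b' \<Colon> sub1 B a \<Longrightarrow>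
    \<Gamma> \<turnstile> Pr a b \<doteq> Pr a' b' \<Colon> Sig A B"
| SigInd_cong: "Sig A B # \<Gamma> \<turnstile> C \<doteq> C' \<Colon> Type \<Longrightarrow>
    B # A # \<Gamma> \<turnstile> g \<doteq> g' \<Colon> subn 2 C (Pr (Var 1) (Var 0)) \<Longrightarrow> \<Gamma> \<turnstile> p \<doteq> p' \<Colon> Sig A B \<Longrightarrow>
    \<Gamma> \<turnstile> SigInd C g p \<doteq> SigInd C' g' p' \<Colon> sub1 C p"

  \<comment> \<open>coproducts\<close>
| Sum: "\<Gamma> \<turnstile> A \<Colon> Univ l \<Longrightarrow> \<Gamma> \<turnstile> B \<Colon> Univ l \<Longrightarrow> \<Gamma> \<turnstile> Sum A B \<Colon> Univ l"
| InL: "\<Gamma> \<turnstile> Sum A B \<Colon> Type \<Longrightarrow> \<Gamma> \<turnstile> a \<Colon> A \<Longrightarrow> \<Gamma> \<turnstile> InL a \<Colon> Sum A B"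
| InR: "\<Gamma> \<turnstile> Sum A B \<Colon> Type \<Longrightarrow> \<Gamma> \<turnstile> b \<Colon> B \<Longrightarrow> \<Gamma> \<turnstile> InR b \<Colon> Sum A B"
| SumInd: "Sum A B # \<Gamma> \<turnstile> C \<Colon> Type \<Longrightarrow> A # \<Gamma> \<turnstile> c \<Colon> subn 1 C (InL (Var 0)) \<Longrightarrow>
    B # \<Gamma> \<turnstile> d \<Colon> subn 1 C (InR (Var 0)) \<Longrightarrow> \<Gamma> \<turnstile> p \<Colon> Sum A B \<Longrightarrow>
    \<Gamma> \<turnstile> SumInd C c d p \<Colon> sub1 C p"
| Sum_beta_l: "Sum A B # \<Gamma> \<turnstile> C \<Colon> Type \<Longrightarrow> A # \<Gamma> \<turnstile> c \<Colon> subn 1 C (InL (Var 0)) \<Longrightarrow>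
    B # \<Gamma> \<turnstile> d \<Colon> subn 1 C (InR (Var 0)) \<Longrightarrow> \<Gamma> \<turnstile> a \<Colon> A \<Longrightarrow>
    \<Gamma> \<turnstile> SumInd C c d (InL a) \<doteq> sub1 c a \<Colon> sub1 C (InL a)"
| Sum_beta_r: "Sum A B # \<Gamma> \<turnstile> C \<Colon> Type \<Longrightarrow> A # \<Gamma> \<turnstile> c \<Colon> subn 1 C (InL (Var 0)) \<Longrightarrow>
    B # \<Gamma> \<turnstile> d \<Colon> subn 1 C (InR (Var 0)) \<Longrightarrow> \<Gamma> \<turnstile> b \<Colon> B \<Longrightarrow>
    \<Gamma> \<turnstile> SumInd C c d (InR b) \<doteq> sub1 d b \<Colon> sub1 C (InR b)"
| Sum_cong: "\<Gamma> \<turnstile> A \<doteq> A' \<Colon> Univ l \<Longrightarrow> \<Gamma> \<turnstile> B \<doteq> B' \<Colon> Univ l \<Longrightarrow>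
    \<Gamma> \<turnstile> Sum A B \<doteq> Sum A' B' \<Colon> Univ l"
| InL_cong: "\<Gamma> \<turnstile> Sum A B \<Colon> Type \<Longrightarrow> \<Gamma> \<turnstile> a \<doteq> a' \<Colon> A \<Longrightarrow> \<Gamma> \<turnstile> InL a \<doteq> InL a' \<Colon> Sum A B"
| InR_cong: "\<Gamma> \<turnstile> Sum A B \<Colon> Type \<Longrightarrow> \<Gamma> \<turnstile> b \<doteq> b' \<Colon> B \<Longrightarrow> \<Gamma> \<turnstile> InR b \<doteq> InR b' \<Colon> Sum A B"
| SumInd_cong: "Sum A B # \<Gamma> \<turnstile> C \<doteq> C' \<Colon> Type \<Longrightarrow> A # \<Gamma> \<turnstile> c \<doteq> c' \<Colon> subn 1 C (InL (Var 0)) \<Longrightarrow>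
    B # \<Gamma> \<turnstile> d \<doteq> d' \<Colon> subn 1 C (InR (Var 0)) \<Longrightarrow> \<Gamma> \<turnstile> p \<doteq> p' \<Colon> Sum A B \<Longrightarrow>
    \<Gamma> \<turnstile> SumInd C c d p \<doteq> SumInd C' c' d' p' \<Colon> sub1 C p"

  \<comment> \<open>the empty type\<close>
| Empty: "\<turnstile> \<Gamma> \<Longrightarrow> \<Gamma> \<turnstile> Empty \<Colon> \<U>"
| EmptyInd: "Empty # \<Gamma> \<turnstile> C \<Colon> Type \<Longrightarrow> \<Gamma> \<turnstile> p \<Colon> Empty \<Longrightarrow> \<Gamma> \<turnstile> EmptyInd C p \<Colon> sub1 C p"
| EmptyInd_cong: "Empty # \<Gamma> \<turnstile> C \<doteq> C' \<Colon> Type \<Longrightarrow> \<Gamma> \<turnstile> p \<doteq> p' \<Colon> Empty \<Longrightarrow>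
    \<Gamma> \<turnstile> EmptyInd C p \<doteq> EmptyInd C' p' \<Colon> sub1 C p"

  \<comment> \<open>the unit type\<close>
| Unit: "\<turnstile> \<Gamma> \<Longrightarrow> \<Gamma> \<turnstile> Unit \<Colon> \<U>"
| Star: "\<turnstile> \<Gamma> \<Longrightarrow> \<Gamma> \<turnstile> Star \<Colon> Unit"
| UnitInd: "Unit # \<Gamma> \<turnstile> C \<Colon> Type \<Longrightarrow> \<Gamma> \<turnstile> c \<Colon> sub1 C Star \<Longrightarrow> \<Gamma> \<turnstile> p \<Colon> Unit \<Longrightarrow>
    \<Gamma> \<turnstile> UnitInd C c p \<Colon> sub1 C p"
| Unit_beta: "Unit # \<Gamma> \<turnstile> C \<Colon> Type \<Longrightarrow> \<Gamma> \<turnstile> c \<Colon> sub1 C Star \<Longrightarrow>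
    \<Gamma> \<turnstile> UnitInd C c Star \<doteq> c \<Colon> sub1 C Star"
| UnitInd_cong: "Unit # \<Gamma> \<turnstile> C \<doteq> C' \<Colon> Type \<Longrightarrow> \<Gamma> \<turnstile> c \<doteq> c' \<Colon> sub1 C Star \<Longrightarrow>
    \<Gamma> \<turnstile> p \<doteq> p' \<Colon> Unit \<Longrightarrow> \<Gamma> \<turnstile> UnitInd C c p \<doteq> UnitInd C' c' p' \<Colon> sub1 C p"

  \<comment> \<open>natural numbers\<close>
| Nat: "\<turnstile> \<Gamma> \<Longrightarrow> \<Gamma> \<turnstile> Nat \<Colon> \<U>"
| Zero: "\<turnstile> \<Gamma> \<Longrightarrow> \<Gamma> \<turnstile> Zero \<Colon> Nat"
| Succ: "\<Gamma> \<turnstile> n \<Colon> Nat \<Longrightarrow> \<Gamma> \<turnstile> Succ n \<Colon> Nat"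
| NatInd: "Nat # \<Gamma> \<turnstile> C \<Colon> Type \<Longrightarrow> \<Gamma> \<turnstile> c \<Colon> sub1 C Zero \<Longrightarrow>
    C # Nat # \<Gamma> \<turnstile> d \<Colon> subn 2 C (Succ (Var 1)) \<Longrightarrow> \<Gamma> \<turnstile> n \<Colon> Nat \<Longrightarrow>
    \<Gamma> \<turnstile> NatInd C c d n \<Colon> sub1 C n"
| Nat_beta_0: "Nat # \<Gamma> \<turnstile> C \<Colon> Type \<Longrightarrow> \<Gamma> \<turnstile> c \<Colon> sub1 C Zero \<Longrightarrow>
    C # Nat # \<Gamma> \<turnstile> d \<Colon> subn 2 C (Succ (Var 1)) \<Longrightarrow>
    \<Gamma> \<turnstile> NatInd C c d Zero \<doteq> c \<Colon> sub1 C Zero"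
| Nat_beta_Suc: "Nat # \<Gamma> \<turnstile> C \<Colon> Type \<Longrightarrow> \<Gamma> \<turnstile> c \<Colon> sub1 C Zero \<Longrightarrow>
    C # Nat # \<Gamma> \<turnstile> d \<Colon> subn 2 C (Succ (Var 1)) \<Longrightarrow> \<Gamma> \<turnstile> n \<Colon> Nat \<Longrightarrow>
    \<Gamma> \<turnstile> NatInd C c d (Succ n) \<doteq> sub2 d n (NatInd C c d n) \<Colon> sub1 C (Succ n)"
| Succ_cong: "\<Gamma> \<turnstile> n \<doteq> n' \<Colon> Nat \<Longrightarrow> \<Gamma> \<turnstile> Succ n \<doteq> Succ n' \<Colon> Nat"
| NatInd_cong: "Nat # \<Gamma> \<turnstile> C \<doteq> C' \<Colon> Type \<Longrightarrow> \<Gamma> \<turnstile> c \<doteq> c' \<Colon> sub1 C Zero \<Longrightarrow>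
    C # Nat # \<Gamma> \<turnstile> d \<doteq> d' \<Colon> subn 2 C (Succ (Var 1)) \<Longrightarrow> \<Gamma> \<turnstile> n \<doteq> n' \<Colon> Nat \<Longrightarrow>
    \<Gamma> \<turnstile> NatInd C c d n \<doteq> NatInd C' c' d' n' \<Colon> sub1 C n"

  \<comment> \<open>identity types\<close>
| Eq: "\<Gamma> \<turnstile> A \<Colon> Univ l \<Longrightarrow> \<Gamma> \<turnstile> a \<Colon> A \<Longrightarrow> \<Gamma> \<turnstile> b \<Colon> A \<Longrightarrow> \<Gamma> \<turnstile> Eq A a b \<Colon> Univ l"
| Refl: "\<Gamma> \<turnstile> a \<Colon> A \<Longrightarrow> \<Gamma> \<turnstile> Refl a \<Colon> Eq A a a"
| EqInd: "Eq (wk 1 A) (wk 1 a) (Var 0) # A # \<Gamma> \<turnstile> C \<Colon> Type \<Longrightarrow> \<Gamma> \<turnstile> a \<Colon> A \<Longrightarrow>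
    \<Gamma> \<turnstile> c \<Colon> sub2 C a (Refl a) \<Longrightarrow> \<Gamma> \<turnstile> b \<Colon> A \<Longrightarrow> \<Gamma> \<turnstile> q \<Colon> Eq A a b \<Longrightarrow>
    \<Gamma> \<turnstile> EqInd a C c b q \<Colon> sub2 C b q"
| Eq_beta: "Eq (wk 1 A) (wk 1 a) (Var 0) # A # \<Gamma> \<turnstile> C \<Colon> Type \<Longrightarrow> \<Gamma> \<turnstile> a \<Colon> A \<Longrightarrow>
    \<Gamma> \<turnstile> c \<Colon> sub2 C a (Refl a) \<Longrightarrow> \<Gamma> \<turnstile> EqInd a C c a (Refl a) \<doteq> c \<Colon> sub2 C a (Refl a)"
| Eq_cong: "\<Gamma> \<turnstile> A \<doteq> A' \<Colon> Univ l \<Longrightarrow> \<Gamma> \<turnstile> a \<doteq> a' \<Colon> A \<Longrightarrow> \<Gamma> \<turnstile> b \<doteq> b' \<Colon> A \<Longrightarrow>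
    \<Gamma> \<turnstile> Eq A a b \<doteq> Eq A' a' b' \<Colon> Univ l"
| Refl_cong: "\<Gamma> \<turnstile> a \<doteq> a' \<Colon> A \<Longrightarrow> \<Gamma> \<turnstile> Refl a \<doteq> Refl a' \<Colon> Eq A a a"
| EqInd_cong: "Eq (wk 1 A) (wk 1 a) (Var 0) # A # \<Gamma> \<turnstile> C \<doteq> C' \<Colon> Type \<Longrightarrow> \<Gamma> \<turnstile> a \<doteq> a' \<Colon> A \<Longrightarrow>
    \<Gamma> \<turnstile> c \<doteq> c' \<Colon> sub2 C a (Refl a) \<Longrightarrow> \<Gamma> \<turnstile> b \<doteq> b' \<Colon> A \<Longrightarrow> \<Gamma> \<turnstile> q \<doteq> q' \<Colon> Eq A a b \<Longrightarrow>
    \<Gamma> \<turnstile> EqInd a C c b q \<doteq> EqInd a' C' c' b' q' \<Colon> sub2 C b q"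

  \<comment> \<open>homotopy coequalizers\<close>
| Coeq: "\<Gamma> \<turnstile> E \<Colon> \<U> \<Longrightarrow> \<Gamma> \<turnstile> V \<Colon> \<U> \<Longrightarrow> \<Gamma> \<turnstile> s \<Colon> arr E V \<Longrightarrow> \<Gamma> \<turnstile> t \<Colon> arr E V \<Longrightarrow>
    \<Gamma> \<turnstile> Coeq E V s t \<Colon> \<U>"
| Pt: "\<Gamma> \<turnstile> Coeq E V s t \<Colon> \<U> \<Longrightarrow> \<Gamma> \<turnstile> v \<Colon> V \<Longrightarrow> \<Gamma> \<turnstile> Pt v \<Colon> Coeq E V s t"
| Glue: "\<Gamma> \<turnstile> Coeq E V s t \<Colon> \<U> \<Longrightarrow> \<Gamma> \<turnstile> e \<Colon> E \<Longrightarrow>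
    \<Gamma> \<turnstile> Glue e \<Colon> Eq (Coeq E V s t) (Pt (App s e)) (Pt (App t e))"
| CoeqInd: "Coeq E V s t # \<Gamma> \<turnstile> C \<Colon> Type \<Longrightarrow> V # \<Gamma> \<turnstile> c \<Colon> subn 1 C (Pt (Var 0)) \<Longrightarrow>
    E # \<Gamma> \<turnstile> d \<Colon> coeq_path (wkb 1 C) (wkb 1 c) (wk 1 s) (wk 1 t) (Var 0) \<Longrightarrow>
    \<Gamma> \<turnstile> q \<Colon> Coeq E V s t \<Longrightarrow> \<Gamma> \<turnstile> CoeqInd C c d q \<Colon> sub1 C q"
| Coeq_beta: "Coeq E V s t # \<Gamma> \<turnstile> C \<Colon> Type \<Longrightarrow> V # \<Gamma> \<turnstile> c \<Colon> subn 1 C (Pt (Var 0)) \<Longrightarrow>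
    E # \<Gamma> \<turnstile> d \<Colon> coeq_path (wkb 1 C) (wkb 1 c) (wk 1 s) (wk 1 t) (Var 0) \<Longrightarrow>
    \<Gamma> \<turnstile> v \<Colon> V \<Longrightarrow> \<Gamma> \<turnstile> CoeqInd C c d (Pt v) \<doteq> sub1 c v \<Colon> sub1 C (Pt v)"
| CoeqGlue: "Coeq E V s t # \<Gamma> \<turnstile> C \<Colon> Type \<Longrightarrow> V # \<Gamma> \<turnstile> c \<Colon> subn 1 C (Pt (Var 0)) \<Longrightarrow>
    E # \<Gamma> \<turnstile> d \<Colon> coeq_path (wkb 1 C) (wkb 1 c) (wk 1 s) (wk 1 t) (Var 0) \<Longrightarrow>
    \<Gamma> \<turnstile> e \<Colon> E \<Longrightarrow>
    \<Gamma> \<turnstile> CoeqGlue C c d e \<Colon> Eq (coeq_path C c s t e)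
      (apd C (CoeqInd (wkb 1 C) (wkb 1 c) (wkb 1 d) (Var 0)) (Pt (App s e)) (Pt (App t e)) (Glue e))
      (sub1 d e)"
| Coeq_cong: "\<Gamma> \<turnstile> E \<doteq> E' \<Colon> \<U> \<Longrightarrow> \<Gamma> \<turnstile> V \<doteq> V' \<Colon> \<U> \<Longrightarrow> \<Gamma> \<turnstile> s \<doteq> s' \<Colon> arr E V \<Longrightarrow>
    \<Gamma> \<turnstile> t \<doteq> t' \<Colon> arr E V \<Longrightarrow> \<Gamma> \<turnstile> Coeq E V s t \<doteq> Coeq E' V' s' t' \<Colon> \<U>"
| Pt_cong: "\<Gamma> \<turnstile> Coeq E V s t \<Colon> \<U> \<Longrightarrow> \<Gamma> \<turnstile> v \<doteq> v' \<Colon> V \<Longrightarrow> \<Gamma> \<turnstile> Pt v \<doteq> Pt v' \<Colon> Coeq E V s t"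
| Glue_cong: "\<Gamma> \<turnstile> Coeq E V s t \<Colon> \<U> \<Longrightarrow> \<Gamma> \<turnstile> e \<doteq> e' \<Colon> E \<Longrightarrow>
    \<Gamma> \<turnstile> Glue e \<doteq> Glue e' \<Colon> Eq (Coeq E V s t) (Pt (App s e)) (Pt (App t e))"
| CoeqInd_cong: "Coeq E V s t # \<Gamma> \<turnstile> C \<doteq> C' \<Colon> Type \<Longrightarrow>
    V # \<Gamma> \<turnstile> c \<doteq> c' \<Colon> subn 1 C (Pt (Var 0)) \<Longrightarrow>
    E # \<Gamma> \<turnstile> d \<doteq> d' \<Colon> coeq_path (wkb 1 C) (wkb 1 c) (wk 1 s) (wk 1 t) (Var 0) \<Longrightarrow>
    \<Gamma> \<turnstile> q \<doteq> q' \<Colon> Coeq E V s t \<Longrightarrow> \<Gamma> \<turnstile> CoeqInd C c d q \<doteq> CoeqInd C' c' d' q' \<Colon> sub1 C q"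
| CoeqGlue_cong: "Coeq E V s t # \<Gamma> \<turnstile> C \<doteq> C' \<Colon> Type \<Longrightarrow>
    V # \<Gamma> \<turnstile> c \<doteq> c' \<Colon> subn 1 C (Pt (Var 0)) \<Longrightarrow>
    E # \<Gamma> \<turnstile> d \<doteq> d' \<Colon> coeq_path (wkb 1 C) (wkb 1 c) (wk 1 s) (wk 1 t) (Var 0) \<Longrightarrow>
    \<Gamma> \<turnstile> e \<doteq> e' \<Colon> E \<Longrightarrow>
    \<Gamma> \<turnstile> CoeqGlue C c d e \<doteq> CoeqGlue C' c' d' e' \<Colon> Eq (coeq_path C c s t e)
      (apd C (CoeqInd (wkb 1 C) (wkb 1 c) (wkb 1 d) (Var 0)) (Pt (App s e)) (Pt (App t e)) (Glue e))
      (sub1 d e)"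

  \<comment> \<open>function extensionality and univalence\<close>
| FunExt: "A # \<Gamma> \<turnstile> B \<Colon> Type \<Longrightarrow> \<Gamma> \<turnstile> f \<Colon> Pi A B \<Longrightarrow> \<Gamma> \<turnstile> g \<Colon> Pi A B \<Longrightarrow>
    \<Gamma> \<turnstile> FunExt A B f g \<Colon> is_equiv (Eq (Pi A B) f g) (homot A B f g) (happly A B f g)"
| FunExt_cong: "\<Gamma> \<turnstile> A \<doteq> A' \<Colon> Type \<Longrightarrow> A # \<Gamma> \<turnstile> B \<doteq> B' \<Colon> Type \<Longrightarrow>
    \<Gamma> \<turnstile> f \<doteq> f' \<Colon> Pi A B \<Longrightarrow> \<Gamma> \<turnstile> g \<doteq> g' \<Colon> Pi A B \<Longrightarrow>
    \<Gamma> \<turnstile> FunExt A B f g \<doteq> FunExt A' B' f' g' \<Colon>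
      is_equiv (Eq (Pi A B) f g) (homot A B f g) (happly A B f g)"
| Ua: "\<Gamma> \<turnstile> A \<Colon> \<U> \<Longrightarrow> \<Gamma> \<turnstile> B \<Colon> \<U> \<Longrightarrow>
    \<Gamma> \<turnstile> Ua A B \<Colon> is_equiv (Eq \<U> A B) (equiv A B) (idtoequiv A B)"
| Ua_cong: "\<Gamma> \<turnstile> A \<doteq> A' \<Colon> \<U> \<Longrightarrow> \<Gamma> \<turnstile> B \<doteq> B' \<Colon> \<U> \<Longrightarrow>
    \<Gamma> \<turnstile> Ua A B \<doteq> Ua A' B' \<Colon> is_equiv (Eq \<U> A B) (equiv A B) (idtoequiv A B)"

end

theory Submission
  imports Defs
begin

text \<open>
  An embedding \<open>f\<close> admits elimination of a path \<open>p : f a = f b\<close>: the pair \<open>(a, p)\<close> equals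
  \<open>(b, refl)\<close> in the fiber over \<open>f b\<close>. Hence \<open>inl a \<mapsto> (a, refl)\<close>,
  \<open>inr b \<mapsto> (b, glue (b, b, refl))\<close> extends to a section of \<open>w \<mapsto> fib inl w\<close>: the condition over
  \<open>glue (a, b, p)\<close> reduces to \<open>a = b\<close>, \<open>p = refl\<close>, where it is the instance
  \<open>q = glue (b, b, refl)\<close> of \<open>transport q (b, refl) = (b, q)\<close>. Path induction on \<open>r : inl a = w\<close>
  shows that every \<open>(a, r)\<close> equals the value of this section at \<open>w\<close>, so the fibers of \<open>inl\<close> are
  contractible.

  Conversely, let \<open>inl\<close> be an equivalence and let \<open>j\<close> be the map from the join to \<open>X\<close> induced by
  \<open>f\<close>. The points \<open>(a, glue (a, b, p))\<close> and \<open>(b, glue (b, b, refl))\<close> of the contractible fiber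
  of \<open>inl\<close> over \<open>inr b\<close> are equal. The map \<open>(a, r) \<mapsto> (a, ap j r)\<close> takes them to \<open>(a, p)\<close> and
  \<open>(b, refl)\<close>, by the path computation rule for \<open>j\<close>. So \<open>(a, p) = (b, refl)\<close> in the fiber of \<open>f\<close>
  over \<open>f b\<close>, and path induction on \<open>q : f b = y\<close> gives \<open>(a, p) = (b, q)\<close> in the fiber over \<open>y\<close>.
\<close>

section \<open>Simultaneous substitutions\<close>

text \<open>The theorem asks only that some term exists, so proofs of equalities are mostly left
  unnamed, as \<open>inhabited \<Gamma> T\<close>. Terms are written out where a later step computes
  with them, as for \<open>join_map\<close>, \<open>fib_map\<close> and \<open>center\<close>. The
  main obstacle is that the edge maps of the join are lambdas around eliminators:
  \<open>Glue e\<close> connects \<open>Pt (App (join_src A X f) e)\<close> with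
  \<open>Pt (App (join_tgt A X f) e)\<close>, which become \<open>inl a\<close> and
  \<open>inr b\<close> only judgementally, and only for \<open>e\<close> a triple. Elements of the
  pullback are therefore split into triples, and glue paths carry conversions with them. Pairs have
  no judgemental eta rule, so points of fibers must be split in the same way. A second obstacle is
  that the path computation rule concerns \<open>apd\<close>, while the map of fibers uses
  \<open>ap\<close>. Eliminations pass to larger contexts. Lemmas are stated for arbitrary
  \<open>\<Gamma>\<close> and an arbitrary map in it, and a \<open>context\<close> block is closed
  and reopened when its own lemmas are needed for weakened data.\<close>

lemma upr_simps [simp]: "upr \<rho> 0 = 0" "upr \<rho> (Suc i) = Suc (\<rho> i)"
  by (simp_all add: upr_def)

lemma ups_simps [simp]: "ups \<sigma> 0 = Var 0" "ups \<sigma> (Suc i) = ren Suc (\<sigma> i)"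
  by (simp_all add: ups_def)

lemma ups_Var_comp: "ups (\<lambda>i. Var (\<rho> i)) = (\<lambda>i. Var (upr \<rho> i))"
  by (auto simp: ups_def upr_def split: nat.split)

lemma ren_sub: "ren \<rho> t = sub (\<lambda>i. Var (\<rho> i)) t"
  by (induction t arbitrary: \<rho>) (simp_all add: ups_Var_comp)

lemma sub_Var: "sub Var t = t"
proof -
  have "ups Var = Var" by (auto simp: ups_def split: nat.split)
  then show ?thesis by (induction t) simp_all
qed

lemma sub_ren: "sub \<sigma> (ren \<rho> t) = sub (\<lambda>i. \<sigma> (\<rho> i)) t"
proof -
  have "(\<lambda>i. ups \<sigma> (upr \<rho> i)) = ups (\<lambda>i. \<sigma> (\<rho> i))" for \<sigma> \<rho>
    by (auto simp: ups_def upr_def split: nat.split)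
  then show ?thesis by (induction t arbitrary: \<sigma> \<rho>) simp_all
qed

lemma ren_sub_comp: "ren \<rho> (sub \<sigma> t) = sub (\<lambda>i. ren \<rho> (\<sigma> i)) t"
proof -
  have "(\<lambda>i. ren (upr \<rho>) (ups \<sigma> i)) = ups (\<lambda>i. ren \<rho> (\<sigma> i))" for \<sigma> \<rho>
    by (auto simp: ups_def upr_def ren_sub sub_ren[unfolded ren_sub] split: nat.split)
  then show ?thesis by (induction t arbitrary: \<sigma> \<rho>) simp_all
qed

text \<open>Under a binder, \<open>ups\<close> must commute with composition. On the shifted
  variables this is \<open>sub_ren\<close> followed by \<open>ren_sub_comp\<close>, which is why
  those two come first.\<close>

lemma sub_sub: "sub \<sigma> (sub \<tau> t) = sub (\<lambda>i. sub \<sigma> (\<tau> i)) t"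
proof -
  have "(\<lambda>i. sub (ups \<sigma>) (ups \<tau> i)) = ups (\<lambda>i. sub \<sigma> (\<tau> i))" for \<sigma> \<tau>
    by (auto simp: ups_def sub_ren ren_sub_comp split: nat.split)
  then show ?thesis by (induction t arbitrary: \<sigma> \<tau>) simp_all
qed

text \<open>
  \<open>scons\<close> is kept folded because the simplifier does not rewrite in the branches of a \<open>case\<close>.
  With \<open>sub_eval\<close> all operations on indices become one \<open>sub\<close> with an evaluated substitution.
\<close>

definition scons :: "tm \<Rightarrow> (nat \<Rightarrow> tm) \<Rightarrow> nat \<Rightarrow> tm" where
  "scons = case_nat"

lemma scons_simps: "scons a \<sigma> 0 = a" "scons a \<sigma> (Suc i) = \<sigma> i"
  by (simp_all add: scons_def)

text \<open>Eta for substitutions: prepending exactly the variable that a shift skips gives the next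
  smaller shift. The small shifts are listed separately because \<open>numeral_nat\<close> turns
  their indices into iterated \<open>Suc\<close>.\<close>

lemma scons_eta: "scons (Var 0) (\<lambda>i. Var (Suc i)) = Var"
  "scons (Var (Suc 0)) (\<lambda>i. Var (Suc (Suc i))) = (\<lambda>i. Var (Suc i))"
  "scons (Var (Suc (Suc 0))) (\<lambda>i. Var (Suc (Suc (Suc i)))) = (\<lambda>i. Var (Suc (Suc i)))"
  "scons (Var (Suc (Suc (Suc 0)))) (\<lambda>i. Var (Suc (Suc (Suc (Suc i))))) =
    (\<lambda>i. Var (Suc (Suc (Suc i))))"
  "scons (Var n) (\<lambda>i. Var (Suc (i + n))) = (\<lambda>i. Var (i + n))"
  by (auto simp: scons_def split: nat.split)

lemma sub_scons: "sub \<sigma> (scons a \<tau> i) = scons (sub \<sigma> a) (\<lambda>i. sub \<sigma> (\<tau> i)) i"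
  by (simp add: scons_def split: nat.split)

lemma ups_eq: "ups \<sigma> = scons (Var 0) (\<lambda>i. sub (\<lambda>i. Var (Suc i)) (\<sigma> i))"
  by (simp add: scons_def ups_def ren_sub)

lemma wk_sub: "wk n = sub (\<lambda>i. Var (i + n))"
  by (simp add: wk_def ren_sub fun_eq_iff)

lemma wkb_sub: "wkb n = sub (scons (Var 0) (\<lambda>i. Var (Suc (i + n))))"
proof -
  have "(\<lambda>i. Var (upr (\<lambda>i. i + n) i)) = scons (Var 0) (\<lambda>i. Var (Suc (i + n)))"
    by (auto simp: upr_def scons_def split: nat.split)
  then show ?thesis by (simp add: wkb_def ren_sub fun_eq_iff)
qed

lemmas sub_eval = sub1_def[folded scons_def] sub2_def[folded scons_def] subn_def[folded scons_def]
  wk_sub wkb_sub ren_sub sub_sub ups_eq sub_Var scons_simps scons_eta sub_scons numeral_nat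

lemma sub_arr: "sub \<sigma> (arr A B) = arr (sub \<sigma> A) (sub \<sigma> B)" by (simp add: arr_def sub_eval)
lemma sub_is_prop: "sub \<sigma> (is_prop A) = is_prop (sub \<sigma> A)" by (simp add: is_prop_def sub_eval)
lemma sub_is_contr: "sub \<sigma> (is_contr A) = is_contr (sub \<sigma> A)" by (simp add: is_contr_def sub_eval)
lemma sub_fib: "sub \<sigma> (fib A B f y) = fib (sub \<sigma> A) (sub \<sigma> B) (sub \<sigma> f) (sub \<sigma> y)"
  by (simp add: fib_def sub_eval)
lemma sub_is_emb: "sub \<sigma> (is_emb A B f) = is_emb (sub \<sigma> A) (sub \<sigma> B) (sub \<sigma> f)"
  by (simp add: is_emb_def sub_is_prop sub_fib sub_eval)
lemma sub_is_equiv: "sub \<sigma> (is_equiv A B f) = is_equiv (sub \<sigma> A) (sub \<sigma> B) (sub \<sigma> f)"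
  by (simp add: is_equiv_def sub_is_contr sub_fib sub_eval)
lemma sub_equiv: "sub \<sigma> (equiv A B) = equiv (sub \<sigma> A) (sub \<sigma> B)"
  by (simp add: equiv_def sub_is_equiv sub_arr sub_eval)
lemma sub_transp: "sub \<sigma> (transp C a b q u) = transp (sub (ups \<sigma>) C) (sub \<sigma> a) (sub \<sigma> b) (sub \<sigma> q)
  (sub \<sigma> u)"
  by (simp add: transp_def sub_eval)
lemma sub_apd: "sub \<sigma> (apd C F a b q) = apd (sub (ups \<sigma>) C) (sub (ups \<sigma>) F) (sub \<sigma> a) (sub \<sigma> b)
  (sub \<sigma> q)"
  by (simp add: apd_def sub_transp sub_eval)
lemma sub_coeq_path: "sub \<sigma> (coeq_path C c s t e) = coeq_path (sub (ups \<sigma>) C) (sub (ups \<sigma>) c)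
  (sub \<sigma> s) (sub \<sigma> t) (sub \<sigma> e)"
  by (simp add: coeq_path_def sub_transp sub_eval)
lemma sub_homot: "sub \<sigma> (homot A B f g) = homot (sub \<sigma> A) (sub (ups \<sigma>) B) (sub \<sigma> f) (sub \<sigma> g)"
  by (simp add: homot_def sub_eval)
lemma sub_happly: "sub \<sigma> (happly A B f g) = happly (sub \<sigma> A) (sub (ups \<sigma>) B) (sub \<sigma> f) (sub \<sigma> g)"
  by (simp add: happly_def sub_homot sub_eval)
lemma sub_idfun: "sub \<sigma> (idfun A) = idfun (sub \<sigma> A)" by (simp add: idfun_def sub_eval)
lemma sub_idfun_equiv: "sub \<sigma> (idfun_equiv A) = idfun_equiv (sub \<sigma> A)"
  by (simp add: idfun_equiv_def sub_fib sub_idfun sub_eval)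
lemma sub_idtoequiv: "sub \<sigma> (idtoequiv A B) = idtoequiv (sub \<sigma> A) (sub \<sigma> B)"
  by (simp add: idtoequiv_def sub_equiv sub_idfun sub_idfun_equiv sub_eval)
lemma sub_pullback: "sub \<sigma> (pullback A B X f g) = pullback (sub \<sigma> A) (sub \<sigma> B) (sub \<sigma> X) (sub \<sigma> f)
  (sub \<sigma> g)"
  by (simp add: pullback_def sub_eval)
lemma sub_pullback_fst: "sub \<sigma> (pullback_fst A B X f g) = pullback_fst (sub \<sigma> A) (sub \<sigma> B)
  (sub \<sigma> X) (sub \<sigma> f) (sub \<sigma> g)"
  by (simp add: pullback_fst_def sub_pullback sub_eval)
lemma sub_pullback_snd: "sub \<sigma> (pullback_snd A B X f g) = pullback_snd (sub \<sigma> A) (sub \<sigma> B)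
  (sub \<sigma> X) (sub \<sigma> f) (sub \<sigma> g)"
  by (simp add: pullback_snd_def sub_pullback sub_eval)
lemma sub_pushout: "sub \<sigma> (pushout S A B h k) = pushout (sub \<sigma> S) (sub \<sigma> A) (sub \<sigma> B) (sub \<sigma> h)
  (sub \<sigma> k)"
  by (simp add: pushout_def sub_eval)
lemma sub_pushout_inl: "sub \<sigma> (pushout_inl A) = pushout_inl (sub \<sigma> A)"
  by (simp add: pushout_inl_def sub_eval)
lemma sub_join: "sub \<sigma> (join A B X f g) = join (sub \<sigma> A) (sub \<sigma> B) (sub \<sigma> X) (sub \<sigma> f) (sub \<sigma> g)"
  by (simp add: join_def sub_pushout sub_pullback sub_pullback_fst sub_pullback_snd)

section \<open>Renaming and substitution preserve judgements\<close>

text \<open>These equations keep \<open>sub1\<close>, \<open>sub2\<close>, \<open>subn\<close>,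
  \<open>wk\<close> and \<open>wkb\<close> folded, so that a substituted instance of a typing rule
  has again the literal shape of that rule.\<close>

lemma sub_subst:
  "sub \<sigma> (sub1 C a) = sub1 (sub (ups \<sigma>) C) (sub \<sigma> a)"
  "sub \<sigma> (sub2 C a b) = sub2 (sub (ups (ups \<sigma>)) C) (sub \<sigma> a) (sub \<sigma> b)"
  "sub (ups \<sigma>) (subn 1 C a) = subn 1 (sub (ups \<sigma>) C) (sub (ups \<sigma>) a)"
  "sub (ups (ups \<sigma>)) (subn 2 C a) = subn 2 (sub (ups \<sigma>) C) (sub (ups (ups \<sigma>)) a)"
  "sub (ups \<sigma>) (wk 1 A) = wk 1 (sub \<sigma> A)"
  "sub (ups (ups \<sigma>)) (wkb 1 A) = wkb 1 (sub (ups \<sigma>) A)"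
  "ups \<sigma> 0 = Var 0" "ups (ups \<sigma>) 1 = Var 1"
  by (simp_all add: sub_eval)

text \<open>
  Renamings and substitutions are treated by one induction: a class of simultaneous substitutions
  that is closed under binders and maps variables to terms of the right type preserves all
  judgements. A rule need not have the formation of the types in its contexts among its premises;
  \<open>substitutable\<close> carries it through the induction.
\<close>

locale substitutive =
  fixes K :: "(nat \<Rightarrow> tm) \<Rightarrow> tm list \<Rightarrow> tm list \<Rightarrow> bool"
  assumes K_wf: "K \<sigma> \<Gamma> \<Delta> \<Longrightarrow> \<turnstile> \<Delta>"
    and K_Var: "K \<sigma> \<Gamma> \<Delta> \<Longrightarrow> i < length \<Gamma> \<Longrightarrow> \<Delta> \<turnstile> \<sigma> i \<Colon> sub \<sigma> (wk (Suc i) (\<Gamma> ! i))"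
    and K_ups: "K \<sigma> \<Gamma> \<Delta> \<Longrightarrow> \<Delta> \<turnstile> sub \<sigma> A \<Colon> Type \<Longrightarrow> K (ups \<sigma>) (A # \<Gamma>) (sub \<sigma> A # \<Delta>)"
begin

primrec substitutable :: "tm list \<Rightarrow> bool" where
  "substitutable [] = True"
| "substitutable (A # \<Gamma>) =
     (substitutable \<Gamma> \<and> (\<forall>\<sigma> \<Delta>. K \<sigma> \<Gamma> \<Delta> \<longrightarrow> \<Delta> \<turnstile> sub \<sigma> A \<Colon> Type))"

definition sub_typing :: "tm list \<Rightarrow> tm \<Rightarrow> tm \<Rightarrow> bool" where
  "sub_typing \<Gamma> t T \<longleftrightarrow>
     substitutable \<Gamma> \<and> (\<forall>\<sigma> \<Delta>. K \<sigma> \<Gamma> \<Delta> \<longrightarrow> \<Delta> \<turnstile> sub \<sigma> t \<Colon> sub \<sigma> T)"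

definition sub_equality :: "tm list \<Rightarrow> tm \<Rightarrow> tm \<Rightarrow> tm \<Rightarrow> bool" where
  "sub_equality \<Gamma> t u T \<longleftrightarrow>
     substitutable \<Gamma> \<and> (\<forall>\<sigma> \<Delta>. K \<sigma> \<Gamma> \<Delta> \<longrightarrow> \<Delta> \<turnstile> sub \<sigma> t \<doteq> sub \<sigma> u \<Colon> sub \<sigma> T)"

lemma sub_judgementI:
  "substitutable \<Gamma> \<Longrightarrow> (\<And>\<sigma> \<Delta>. K \<sigma> \<Gamma> \<Delta> \<Longrightarrow> \<Delta> \<turnstile> sub \<sigma> t \<Colon> sub \<sigma> T) \<Longrightarrow> sub_typing \<Gamma> t T"
  "substitutable \<Gamma> \<Longrightarrow> (\<And>\<sigma> \<Delta>. K \<sigma> \<Gamma> \<Delta> \<Longrightarrow> \<Delta> \<turnstile> sub \<sigma> t \<doteq> sub \<sigma> u \<Colon> sub \<sigma> T) \<Longrightarrow>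
    sub_equality \<Gamma> t u T"
  by (auto simp: sub_typing_def sub_equality_def)

lemma sub_judgement_substitutable:
  "sub_typing \<Gamma> t T \<Longrightarrow> substitutable \<Gamma>" "sub_equality \<Gamma> t u T \<Longrightarrow> substitutable \<Gamma>"
  by (auto simp: sub_typing_def sub_equality_def)

text \<open>The clauses cover premises with zero, one or two additional variables. Extending
  \<open>K\<close> under a binder needs the substituted type to be well formed, which
  \<open>substitutable\<close> supplies.\<close>

lemma sub_judgementD:
  "sub_typing \<Gamma> t T \<Longrightarrow> K \<sigma> \<Gamma> \<Delta> \<Longrightarrow> \<Delta> \<turnstile> sub \<sigma> t \<Colon> sub \<sigma> T"
  "sub_typing (A # \<Gamma>) t T \<Longrightarrow> K \<sigma> \<Gamma> \<Delta> \<Longrightarrow>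
    sub \<sigma> A # \<Delta> \<turnstile> sub (ups \<sigma>) t \<Colon> sub (ups \<sigma>) T"
  "sub_typing (B # A # \<Gamma>) t T \<Longrightarrow> K \<sigma> \<Gamma> \<Delta> \<Longrightarrow>
    sub (ups \<sigma>) B # sub \<sigma> A # \<Delta> \<turnstile> sub (ups (ups \<sigma>)) t \<Colon> sub (ups (ups \<sigma>)) T"
  "sub_equality \<Gamma> t u T \<Longrightarrow> K \<sigma> \<Gamma> \<Delta> \<Longrightarrow> \<Delta> \<turnstile> sub \<sigma> t \<doteq> sub \<sigma> u \<Colon> sub \<sigma> T"
  "sub_equality (A # \<Gamma>) t u T \<Longrightarrow> K \<sigma> \<Gamma> \<Delta> \<Longrightarrow>
    sub \<sigma> A # \<Delta> \<turnstile> sub (ups \<sigma>) t \<doteq> sub (ups \<sigma>) u \<Colon> sub (ups \<sigma>) T"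
  "sub_equality (B # A # \<Gamma>) t u T \<Longrightarrow> K \<sigma> \<Gamma> \<Delta> \<Longrightarrow>
    sub (ups \<sigma>) B # sub \<sigma> A # \<Delta> \<turnstile>
      sub (ups (ups \<sigma>)) t \<doteq> sub (ups (ups \<sigma>)) u \<Colon> sub (ups (ups \<sigma>)) T"
  by (auto simp: sub_typing_def sub_equality_def K_ups)

lemmas sub_unfolds = sub.simps sub_subst sub_arr sub_is_equiv sub_equiv sub_apd sub_coeq_path
  sub_homot
  sub_happly sub_idtoequiv

lemma preserves_judgements:
  "\<turnstile> \<Gamma> \<Longrightarrow> substitutable \<Gamma>"
  "\<Gamma> \<turnstile> t \<Colon> T \<Longrightarrow> sub_typing \<Gamma> t T"
  "\<Gamma> \<turnstile> t \<doteq> u \<Colon> T \<Longrightarrow> sub_equality \<Gamma> t u T"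
proof (induction rule: wf_typing_equality.inducts)
  case wf_Nil
  show ?case by simp
next
  case (wf_Cons \<Gamma> A)
  then show ?case by (simp add: sub_typing_def)
next
  case (Var \<Gamma> i)
  then show ?case by (auto intro!: sub_judgementI K_Var)
\<comment> \<open>All remaining rules follow one pattern: the induction hypotheses are used at
  \<open>\<sigma>\<close> lifted under the binders of each premise, \<open>sub\<close> is commuted
  inwards, and the same rule is applied. \<open>K_wf\<close> serves the rules whose premise is a
  well-formed context.\<close>
qed (rule sub_judgementI, (auto dest: sub_judgement_substitutable)[1],
    ((drule (1) sub_judgementD)+ | drule K_wf), (unfold sub_unfolds)?,
    rule Univ Pi Lam App Pi_beta Pi_eta Pi_cong Lam_cong App_cong Sig Pr SigInd Sig_beta Sig_cong
      Pr_cong SigInd_cong Sum InL InR SumInd Sum_beta_l Sum_beta_r Sum_cong InL_cong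
      InR_cong SumInd_cong EmptyInd EmptyInd_cong UnitInd Unit_beta UnitInd_cong Succ
      NatInd Nat_beta_0 Nat_beta_Suc Succ_cong NatInd_cong Eq Refl EqInd Eq_beta Eq_cong
      Refl_cong EqInd_cong Coeq Pt Glue CoeqInd Coeq_beta CoeqGlue Coeq_cong Pt_cong
      Glue_cong CoeqInd_cong CoeqGlue_cong FunExt FunExt_cong Ua Ua_cong Empty Unit Star
      Nat Zero wf_typing_equality.refl conv sym trans eq_conv cumul eq_cumul;
    assumption)+

end

text \<open>The lookup condition is an equation between types instead of a typing judgement. Closure
  under binders can then be proved without weakening, which is itself derived from this
  class.\<close>

definition is_ren :: "(nat \<Rightarrow> tm) \<Rightarrow> tm list \<Rightarrow> tm list \<Rightarrow> bool" where
  "is_ren \<sigma> \<Gamma> \<Delta> \<longleftrightarrow> \<turnstile> \<Delta> \<and>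
     (\<exists>\<rho>. \<sigma> = (\<lambda>i. Var (\<rho> i)) \<and> (\<forall>i<length \<Gamma>. \<rho> i < length \<Delta> \<and>
        wk (Suc (\<rho> i)) (\<Delta> ! \<rho> i) = ren \<rho> (wk (Suc i) (\<Gamma> ! i))))"

definition is_sub :: "(nat \<Rightarrow> tm) \<Rightarrow> tm list \<Rightarrow> tm list \<Rightarrow> bool" where
  "is_sub \<sigma> \<Gamma> \<Delta> \<longleftrightarrow> \<turnstile> \<Delta> \<and> (\<forall>i<length \<Gamma>. \<Delta> \<turnstile> \<sigma> i \<Colon> sub \<sigma> (wk (Suc i) (\<Gamma> ! i)))"

interpretation renaming: substitutive is_ren
proof
  fix \<sigma> \<Gamma> \<Delta> A i
  assume K: "is_ren \<sigma> \<Gamma> \<Delta>"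
  then obtain \<rho> where \<rho>: "\<sigma> = (\<lambda>i. Var (\<rho> i))"
      "\<And>i. i < length \<Gamma> \<Longrightarrow> \<rho> i < length \<Delta> \<and> wk (Suc (\<rho> i)) (\<Delta> ! \<rho> i) = ren \<rho> (wk (Suc i) (\<Gamma> ! i))"
    by (auto simp: is_ren_def)
  show wf: "\<turnstile> \<Delta>" using K by (simp add: is_ren_def)
  show "\<Delta> \<turnstile> \<sigma> i \<Colon> sub \<sigma> (wk (Suc i) (\<Gamma> ! i))" if "i < length \<Gamma>"
    using Var[OF wf] \<rho> that by (metis ren_sub)
  show "is_ren (ups \<sigma>) (A # \<Gamma>) (sub \<sigma> A # \<Delta>)" if A: "\<Delta> \<turnstile> sub \<sigma> A \<Colon> Type"
    unfolding is_ren_def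
  proof (intro conjI exI allI impI)
    show "\<turnstile> sub \<sigma> A # \<Delta>" using A by (rule wf_Cons)
    show "ups \<sigma> = (\<lambda>i. Var (upr \<rho> i))" by (simp add: \<rho>(1) ups_Var_comp)
    fix i
    assume i: "i < length (A # \<Gamma>)"
    have S: "wk (Suc (Suc k)) t = wk (Suc 0) (wk (Suc k) t)" for k t
      by (simp add: sub_eval)
    have S': "ren (upr \<rho>) (wk (Suc 0) B) = wk (Suc 0) (ren \<rho> B)" for B
      by (simp add: sub_eval)
    show "upr \<rho> i < length (sub \<sigma> A # \<Delta>)"
      using i \<rho>(2) by (cases i) auto
    show "wk (Suc (upr \<rho> i)) ((sub \<sigma> A # \<Delta>) ! upr \<rho> i) = ren (upr \<rho>) (wk (Suc i) ((A # \<Gamma>) ! i))"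
      using i \<rho>(2) by (cases i) (simp_all add: S S' \<rho>(1) flip: ren_sub)
  qed
qed

section \<open>Derived rules\<close>

text \<open>The quantifier over \<open>n\<close> covers the context and all its tails;
  \<open>n = 0\<close> gives \<open>wf_typing\<close> and \<open>n = 1\<close> gives
  \<open>wf_tl\<close>.\<close>

lemma wf_drop:
  "\<turnstile> \<Gamma> \<Longrightarrow> \<forall>n. \<turnstile> drop n \<Gamma>" "\<Gamma> \<turnstile> t \<Colon> T \<Longrightarrow> \<forall>n. \<turnstile> drop n \<Gamma>" "\<Gamma> \<turnstile> t \<doteq> u \<Colon> T \<Longrightarrow> \<forall>n. \<turnstile> drop n \<Gamma>"
proof (induction rule: wf_typing_equality.inducts)
  case wf_Nil
  show ?case by (simp add: wf_typing_equality.wf_Nil)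
next
  case (wf_Cons \<Gamma> A)
  then show ?case by (auto simp: drop_Cons' intro: wf_typing_equality.wf_Cons)
qed (use drop_Suc_Cons in \<open>metis drop_0\<close>)+

lemma wf_typing: "\<Gamma> \<turnstile> t \<Colon> T \<Longrightarrow> \<turnstile> \<Gamma>"
  using wf_drop(2) by (metis drop_0)

lemma wf_tl: "\<turnstile> A # \<Gamma> \<Longrightarrow> \<turnstile> \<Gamma>"
  using wf_drop(1) by (metis drop_0 drop_Suc_Cons)

lemma wf_hd: "\<turnstile> A # \<Gamma> \<Longrightarrow> \<Gamma> \<turnstile> A \<Colon> Type"
  by (auto elim: wf.cases)

definition ext :: "nat \<Rightarrow> tm list \<Rightarrow> tm list \<Rightarrow> bool" where
  "ext n \<Gamma> \<Delta> \<longleftrightarrow> \<turnstile> \<Delta> \<and> n \<le> length \<Delta> \<and> drop n \<Delta> = \<Gamma>"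

lemma ext_is_ren: "ext n \<Gamma> \<Delta> \<Longrightarrow> is_ren (\<lambda>i. Var (i + n)) \<Gamma> \<Delta>"
  by (auto simp: ext_def is_ren_def sub_eval ac_simps intro!: exI[of _ "\<lambda>i. i + n"])

lemma weaken: "\<Gamma> \<turnstile> t \<Colon> T \<Longrightarrow> ext n \<Gamma> \<Delta> \<Longrightarrow> \<Delta> \<turnstile> wk n t \<Colon> wk n T"
  unfolding wk_sub
  using renaming.preserves_judgements(2) ext_is_ren renaming.sub_judgementD(1) by blast

lemma weaken_eq: "\<Gamma> \<turnstile> t \<doteq> u \<Colon> T \<Longrightarrow> ext n \<Gamma> \<Delta> \<Longrightarrow> \<Delta> \<turnstile> wk n t \<doteq> wk n u \<Colon> wk n T"
  unfolding wk_sub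
  using renaming.preserves_judgements(3) ext_is_ren renaming.sub_judgementD(4) by blast

lemma weaken_Univ: "\<Gamma> \<turnstile> t \<Colon> Univ l \<Longrightarrow> ext n \<Gamma> \<Delta> \<Longrightarrow> \<Delta> \<turnstile> wk n t \<Colon> Univ l"
  by (drule (1) weaken) (simp add: sub_eval)

lemma ext1: "\<turnstile> A # \<Gamma> \<Longrightarrow> ext 1 \<Gamma> (A # \<Gamma>)" by (simp add: ext_def)
lemma ext2: "\<turnstile> B # A # \<Gamma> \<Longrightarrow> ext 2 \<Gamma> (B # A # \<Gamma>)" by (simp add: ext_def)
lemma ext3: "\<turnstile> C # B # A # \<Gamma> \<Longrightarrow> ext 3 \<Gamma> (C # B # A # \<Gamma>)" by (simp add: ext_def)

lemmas sub_eval_defs = sub_eval sub_arr sub_is_prop sub_is_contr sub_fib sub_is_emb sub_is_equiv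
  sub_transp
  sub_apd sub_coeq_path sub_pullback sub_pullback_fst sub_pullback_snd sub_pushout_inl sub_join

text \<open>Closure under a binder weakens the terms substituted for the old variables, so this
  instance depends on \<open>weaken\<close>, obtained from the renaming instance.\<close>

interpretation substitution: substitutive is_sub
proof
  fix \<sigma> \<Gamma> \<Delta> A i
  assume K: "is_sub \<sigma> \<Gamma> \<Delta>"
  then show wf: "\<turnstile> \<Delta>" by (simp add: is_sub_def)
  show "\<Delta> \<turnstile> \<sigma> i \<Colon> sub \<sigma> (wk (Suc i) (\<Gamma> ! i))" if "i < length \<Gamma>"
    using K that by (simp add: is_sub_def)
  show "is_sub (ups \<sigma>) (A # \<Gamma>) (sub \<sigma> A # \<Delta>)" if A: "\<Delta> \<turnstile> sub \<sigma> A \<Colon> Type"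
    unfolding is_sub_def
  proof (intro conjI allI impI)
    show wf': "\<turnstile> sub \<sigma> A # \<Delta>" using A by (rule wf_Cons)
    fix i
    assume i: "i < length (A # \<Gamma>)"
    show "sub \<sigma> A # \<Delta> \<turnstile> ups \<sigma> i \<Colon> sub (ups \<sigma>) (wk (Suc i) ((A # \<Gamma>) ! i))"
    proof (cases i)
      case 0
      then show ?thesis using Var[OF wf', of 0] by (simp add: sub_eval)
    next
      case (Suc j)
      then have "\<Delta> \<turnstile> \<sigma> j \<Colon> sub \<sigma> (wk (Suc j) (\<Gamma> ! j))"
        using K i by (simp add: is_sub_def)
      from weaken[OF this ext1[OF wf']] show ?thesis
        using Suc by (simp add: sub_eval)
    qed
  qed
qed

lemma substitution:
  "\<Gamma> \<turnstile> t \<Colon> T \<Longrightarrow> is_sub \<sigma> \<Gamma> \<Delta> \<Longrightarrow> \<Delta> \<turnstile> sub \<sigma> t \<Colon> sub \<sigma> T"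
  using substitution.preserves_judgements(2) substitution.sub_judgementD(1) by blast

lemma is_sub_wk: "ext n \<Gamma> \<Delta> \<Longrightarrow> is_sub (\<lambda>i. Var (i + n)) \<Gamma> \<Delta>"
  unfolding is_sub_def using renaming.K_Var[OF ext_is_ren] ext_def by blast

lemma is_sub_scons: "is_sub \<sigma> \<Gamma> \<Delta> \<Longrightarrow> \<Delta> \<turnstile> a \<Colon> sub \<sigma> A \<Longrightarrow> is_sub (scons a \<sigma>) (A # \<Gamma>) \<Delta>"
  by (auto simp: is_sub_def nth_Cons' sub_eval gr0_conv_Suc less_Suc_eq_0_disj)

lemma is_sub_Var: "\<turnstile> \<Gamma> \<Longrightarrow> is_sub Var \<Gamma> \<Gamma>"
  using Var by (auto simp: is_sub_def sub_Var)

lemma conv_Univ: "\<Gamma> \<turnstile> a \<Colon> A \<Longrightarrow> \<Gamma> \<turnstile> A \<doteq> B \<Colon> Univ l \<Longrightarrow> \<Gamma> \<turnstile> a \<Colon> B"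
  by (cases l) (auto intro: conv eq_cumul)

lemma conv_sym_Univ: "\<Gamma> \<turnstile> a \<Colon> A \<Longrightarrow> \<Gamma> \<turnstile> B \<doteq> A \<Colon> Univ l \<Longrightarrow> \<Gamma> \<turnstile> a \<Colon> B"
  by (cases l) (auto intro: conv sym eq_cumul)

lemma eq_conv_Univ: "\<Gamma> \<turnstile> a \<doteq> b \<Colon> A \<Longrightarrow> \<Gamma> \<turnstile> A \<doteq> B \<Colon> Univ l \<Longrightarrow> \<Gamma> \<turnstile> a \<doteq> b \<Colon> B"
  by (cases l) (auto intro: eq_conv eq_cumul)

text \<open>Like several rules below, this variant of a typing rule takes its substituted type as a
  variable constrained by an equation. Unification then never has to invert a substitution, and the
  equation is left to \<open>sub_eval\<close>.\<close>

lemma ty_Var: "\<turnstile> \<Gamma> \<Longrightarrow> i < length \<Gamma> \<Longrightarrow> wk (Suc i) (\<Gamma> ! i) = T \<Longrightarrow> \<Gamma> \<turnstile> Var i \<Colon> T"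
  using Var by blast

lemma ty_App: "\<Gamma> \<turnstile> f \<Colon> arr A B \<Longrightarrow> \<Gamma> \<turnstile> a \<Colon> A \<Longrightarrow> \<Gamma> \<turnstile> App f a \<Colon> B"
  using App[of \<Gamma> f A "wk 1 B" a] by (simp add: arr_def sub_eval)

lemma ty_App_dep: "\<Gamma> \<turnstile> f \<Colon> Pi A B \<Longrightarrow> \<Gamma> \<turnstile> a \<Colon> A \<Longrightarrow> sub1 B a = B' \<Longrightarrow> \<Gamma> \<turnstile> App f a \<Colon> B'"
  using App by blast

lemma ty_Lam: "\<Gamma> \<turnstile> A \<Colon> Type \<Longrightarrow> A # \<Gamma> \<turnstile> b \<Colon> wk 1 B \<Longrightarrow> \<Gamma> \<turnstile> Lam A b \<Colon> arr A B"
  unfolding arr_def by (rule Lam)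

lemma eq_beta: "A # \<Gamma> \<turnstile> b \<Colon> B \<Longrightarrow> \<Gamma> \<turnstile> a \<Colon> A \<Longrightarrow> sub1 b a = b' \<Longrightarrow> sub1 B a = B' \<Longrightarrow>
    \<Gamma> \<turnstile> App (Lam A b) a \<doteq> b' \<Colon> B'"
  using Pi_beta by blast

lemma ty_arr: "\<Gamma> \<turnstile> A \<Colon> Univ l \<Longrightarrow> \<Gamma> \<turnstile> B \<Colon> Univ l \<Longrightarrow> \<Gamma> \<turnstile> arr A B \<Colon> Univ l"
  unfolding arr_def
  by (rule Pi, assumption, rule weaken_Univ, assumption, rule ext1)
     (cases l; simp add: wf_Cons cumul)

lemma to_Type: "\<Gamma> \<turnstile> A \<Colon> Univ l \<Longrightarrow> \<Gamma> \<turnstile> A \<Colon> Type"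
  by (cases l) (auto intro: cumul)

lemma wf_Cons_Univ: "\<Gamma> \<turnstile> A \<Colon> Univ l \<Longrightarrow> \<turnstile> A # \<Gamma>"
  by (rule wf_Cons, rule to_Type)

lemma wf_path_ctx:
  assumes "\<Gamma> \<turnstile> A \<Colon> Univ l" and "\<Gamma> \<turnstile> a \<Colon> A"
  shows "\<turnstile> Eq (wk 1 A) (wk 1 a) (Var 0) # A # \<Gamma>"
proof -
  have e: "ext 1 \<Gamma> (A # \<Gamma>)" using assms wf_Cons_Univ ext1 by blast
  show ?thesis
    by (rule wf_Cons_Univ, rule Eq, rule weaken_Univ[OF assms(1) e], rule weaken[OF assms(2) e],
        rule ty_Var) (use e in \<open>auto simp: ext_def\<close>)
qed

lemma ty_EqInd: "Eq (wk 1 A) (wk 1 a) (Var 0) # A # \<Gamma> \<turnstile> C \<Colon> Univ l \<Longrightarrow> \<Gamma> \<turnstile> a \<Colon> A \<Longrightarrow>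
    \<Gamma> \<turnstile> c \<Colon> T0 \<Longrightarrow> \<Gamma> \<turnstile> b \<Colon> A \<Longrightarrow> \<Gamma> \<turnstile> q \<Colon> Eq A a b \<Longrightarrow> T0 = sub2 C a (Refl a) \<Longrightarrow> sub2 C b q = T \<Longrightarrow>
      \<Gamma> \<turnstile> EqInd a C c b q \<Colon> T"
  using EqInd to_Type by blast

lemma eq_EqInd: "Eq (wk 1 A) (wk 1 a) (Var 0) # A # \<Gamma> \<turnstile> C \<Colon> Univ l \<Longrightarrow> \<Gamma> \<turnstile> a \<Colon> A \<Longrightarrow>
    \<Gamma> \<turnstile> c \<Colon> T0 \<Longrightarrow> T0 = sub2 C a (Refl a) \<Longrightarrow> \<Gamma> \<turnstile> EqInd a C c a (Refl a) \<doteq> c \<Colon> T0"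
  using Eq_beta to_Type by blast

section \<open>Inhabited types and the algebra of paths\<close>

definition inhabited :: "tm list \<Rightarrow> tm \<Rightarrow> bool" where "inhabited \<Gamma> T \<longleftrightarrow> (\<exists>t. \<Gamma> \<turnstile> t \<Colon> T)"

lemma inhabitedI: "\<Gamma> \<turnstile> t \<Colon> T \<Longrightarrow> inhabited \<Gamma> T" by (auto simp: inhabited_def)
lemma inhabitedE: "inhabited \<Gamma> T \<Longrightarrow> (\<And>t. \<Gamma> \<turnstile> t \<Colon> T \<Longrightarrow> P) \<Longrightarrow> P" by (auto simp: inhabited_def)

lemma inhabited_wk: "inhabited \<Gamma> T \<Longrightarrow> ext n \<Gamma> \<Delta> \<Longrightarrow> inhabited \<Delta> (wk n T)"
  by (auto simp: inhabited_def dest: weaken)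

lemma inhabited_conv: "inhabited \<Gamma> T \<Longrightarrow> \<Gamma> \<turnstile> T \<doteq> T' \<Colon> Univ l \<Longrightarrow> inhabited \<Gamma> T'"
  by (cases l) (auto simp: inhabited_def intro: conv eq_cumul)

lemma inhabited_Pi: "\<Gamma> \<turnstile> A \<Colon> Univ l \<Longrightarrow> inhabited (A # \<Gamma>) B \<Longrightarrow> inhabited \<Gamma> (Pi A B)"
  by (auto simp: inhabited_def intro: Lam to_Type)

lemma inhabited_App: "inhabited \<Gamma> (Pi A B) \<Longrightarrow> \<Gamma> \<turnstile> a \<Colon> A \<Longrightarrow> sub1 B a = B' \<Longrightarrow> inhabited \<Gamma> B'"
  by (auto simp: inhabited_def intro: App)

lemma inhabited_arr: "\<Gamma> \<turnstile> A \<Colon> Univ l \<Longrightarrow> inhabited (A # \<Gamma>) (wk 1 B) \<Longrightarrow> inhabited \<Gamma> (arr A B)"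
  unfolding arr_def by (rule inhabited_Pi)

lemma inhabited_arr_App: "inhabited \<Gamma> (arr A B) \<Longrightarrow> inhabited \<Gamma> A \<Longrightarrow> inhabited \<Gamma> B"
  by (auto simp: inhabited_def intro: ty_App)

lemma inhabited_EqInd: "Eq (wk 1 A) (wk 1 a) (Var 0) # A # \<Gamma> \<turnstile> C \<Colon> Univ l \<Longrightarrow> \<Gamma> \<turnstile> a \<Colon> A \<Longrightarrow>
    inhabited \<Gamma> T0 \<Longrightarrow> \<Gamma> \<turnstile> b \<Colon> A \<Longrightarrow> \<Gamma> \<turnstile> q \<Colon> Eq A a b \<Longrightarrow> T0 = sub2 C a (Refl a) \<Longrightarrow> sub2 C b q = T \<Longrightarrow>
      inhabited \<Gamma> T"
  unfolding inhabited_def using ty_EqInd by blast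

lemma inhabited_SigInd: "Sig A B # \<Gamma> \<turnstile> C \<Colon> Univ l \<Longrightarrow> inhabited (B # A # \<Gamma>) T0 \<Longrightarrow> \<Gamma> \<turnstile> p \<Colon> Sig A B \<Longrightarrow>
    T0 = subn 2 C (Pr (Var 1) (Var 0)) \<Longrightarrow> sub1 C p = T \<Longrightarrow> inhabited \<Gamma> T"
  unfolding inhabited_def using SigInd to_Type by blast

text \<open>Path induction with a motive that ignores the path, hence \<open>wk 1 C\<close>.
  Symmetry, transitivity and the action of maps on paths are instances of it.\<close>

lemma inhabited_transport:
  assumes A: "\<Gamma> \<turnstile> A \<Colon> Univ l" and C: "A # \<Gamma> \<turnstile> C \<Colon> Univ l'" and a: "\<Gamma> \<turnstile> a \<Colon> A" and b: "\<Gamma> \<turnstile> b \<Colon> A"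
    and q: "inhabited \<Gamma> (Eq A a b)" and c: "inhabited \<Gamma> Ca" and "sub1 C a = Ca" and "sub1 C b = Cb"
  shows "inhabited \<Gamma> Cb"
proof -
  obtain q where q: "\<Gamma> \<turnstile> q \<Colon> Eq A a b" using q by (rule inhabitedE)
  show ?thesis
    by (rule inhabited_EqInd[OF _ a c b q, of "wk 1 C"], rule weaken_Univ[OF C], rule ext1,
      rule wf_path_ctx[OF A a])
       (use assms(7,8) in \<open>simp_all add: sub_eval\<close>)
qed

lemma inhabited_sym:
  assumes A: "\<Gamma> \<turnstile> A \<Colon> Univ l" and a: "\<Gamma> \<turnstile> a \<Colon> A" and b: "\<Gamma> \<turnstile> b \<Colon> A" and q: "inhabited \<Gamma> (Eq A a b)"
  shows "inhabited \<Gamma> (Eq A b a)"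
proof -
  have w: "\<turnstile> A # \<Gamma>" using A by (rule wf_Cons_Univ)
  note e = ext1[OF w]
  show ?thesis
    by (rule inhabited_transport[OF A _ a b q inhabitedI, of "Eq (wk 1 A) (Var 0) (wk 1 a)"],
      rule Eq, rule weaken_Univ[OF A e],
      rule ty_Var[OF w], simp, simp, rule weaken[OF a e], rule Refl[OF a]) (simp_all add: sub_eval)
qed

lemma inhabited_trans:
  assumes A: "\<Gamma> \<turnstile> A \<Colon> Univ l" and a: "\<Gamma> \<turnstile> a \<Colon> A" and b: "\<Gamma> \<turnstile> b \<Colon> A" and c: "\<Gamma> \<turnstile> c \<Colon> A"
    and q: "inhabited \<Gamma> (Eq A a b)" and r: "inhabited \<Gamma> (Eq A b c)"
  shows "inhabited \<Gamma> (Eq A a c)"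
proof -
  have w: "\<turnstile> A # \<Gamma>" using A by (rule wf_Cons_Univ)
  note e = ext1[OF w]
  show ?thesis
    by (rule inhabited_transport[OF A _ b c r q, of "Eq (wk 1 A) (wk 1 a) (Var 0)"], rule Eq,
      rule weaken_Univ[OF A e],
      rule weaken[OF a e], rule ty_Var[OF w]) (simp_all add: sub_eval)
qed

text \<open>Transport in the family \<open>x. fa = f[x]\<close>. The map is an open term instead of
  an element of a function type, which avoids beta conversions at its uses.\<close>

lemma inhabited_ap:
  assumes A: "\<Gamma> \<turnstile> A \<Colon> Univ l" and B: "\<Gamma> \<turnstile> B \<Colon> Univ l'" and f: "A # \<Gamma> \<turnstile> f \<Colon> wk 1 B"
    and a: "\<Gamma> \<turnstile> a \<Colon> A" and b: "\<Gamma> \<turnstile> b \<Colon> A" and q: "inhabited \<Gamma> (Eq A a b)"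
    and fa: "\<Gamma> \<turnstile> fa \<Colon> B" "sub1 f a = fa" and fb: "sub1 f b = fb"
  shows "inhabited \<Gamma> (Eq B fa fb)"
proof -
  have w: "\<turnstile> A # \<Gamma>" using A by (rule wf_Cons_Univ)
  note e = ext1[OF w]
  show ?thesis
    by (rule inhabited_transport[OF A _ a b q inhabitedI, of "Eq (wk 1 B) (wk 1 fa) f"], rule Eq,
      rule weaken_Univ[OF B e],
      rule weaken[OF fa(1) e], rule f, rule Refl[OF fa(1)])
      (use fa fb in \<open>simp_all add: sub_eval\<close>)
qed

section \<open>Iterated dependent pairs\<close>

abbreviation triple :: "tm \<Rightarrow> tm \<Rightarrow> tm \<Rightarrow> tm" where "triple a b p \<equiv> Pr a (Pr b p)"

text \<open>Two nested pair eliminations. The inner one takes place after the inner pair has been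
  declared as a variable: its motive re-pairs the first component \<open>Var 2\<close> with the new
  pair \<open>Var 0\<close>, and \<open>g\<close> is renamed to skip the variable of the old
  pair.\<close>

definition triple_ind :: "tm \<Rightarrow> tm \<Rightarrow> tm \<Rightarrow> tm" where
  "triple_ind C g e =
     SigInd C
       (SigInd (sub (scons (Pr (Var 2) (Var 0)) (\<lambda>i. Var (i + 3))) C)
         (sub (scons (Var 0) (scons (Var 1) (\<lambda>i. Var (i + 3)))) g) (Var 0)) e"

lemma sub_triple_ind:
  "sub \<sigma> (triple_ind C g e) = triple_ind (sub (ups \<sigma>) C) (sub (ups (ups (ups \<sigma>))) g) (sub \<sigma> e)"
  by (simp add: triple_ind_def sub_eval)

context
  fixes \<Gamma> A B D C g l
  assumes C: "Sig A (Sig B D) # \<Gamma> \<turnstile> C \<Colon> Univ l"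
    and g: "D # B # A # \<Gamma> \<turnstile> g \<Colon> sub (scons (triple (Var 2) (Var 1) (Var 0)) (\<lambda>i. Var (i + 3))) C"
begin

lemma triple_types:
  "\<Gamma> \<turnstile> A \<Colon> Type" "A # \<Gamma> \<turnstile> B \<Colon> Type" "B # A # \<Gamma> \<turnstile> D \<Colon> Type" "A # \<Gamma> \<turnstile> Sig B D \<Colon> Type"
  using wf_typing[OF g] by (auto intro: wf_hd wf_tl Sig)

text \<open>
  The elimination of the inner pair is typed under a substitution, since the first component is a
  variable in the typing rule of \<open>triple_ind\<close> and a term in its computation rule.
\<close>

lemma triple_motive:
  assumes \<sigma>: "is_sub \<sigma> \<Gamma> \<Delta>" and a: "\<Delta> \<turnstile> a \<Colon> sub \<sigma> A"
  shows "sub (scons a \<sigma>) (Sig B D) # \<Delta> \<turnstile>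
    sub (scons (Pr (wk 1 a) (Var 0)) (\<lambda>i. wk 1 (\<sigma> i))) C \<Colon> Univ l"
proof -
  have s: "is_sub (scons a \<sigma>) (A # \<Gamma>) \<Delta>" using \<sigma> a by (rule is_sub_scons)
  have S: "\<Delta> \<turnstile> sub (scons a \<sigma>) (Sig B D) \<Colon> Type"
    using substitution[OF triple_types(4) s] by simp
  note e = ext1[OF wf_Cons[OF S]]
  have \<sigma>': "is_sub (\<lambda>i. wk 1 (\<sigma> i)) \<Gamma> (sub (scons a \<sigma>) (Sig B D) # \<Delta>)"
    unfolding is_sub_def
  proof (intro conjI allI impI)
    fix i assume "i < length \<Gamma>"
    then have "\<Delta> \<turnstile> \<sigma> i \<Colon> sub \<sigma> (wk (Suc i) (\<Gamma> ! i))" using \<sigma> by (simp add: is_sub_def)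
    from weaken[OF this e] show "sub (scons a \<sigma>) (Sig B D) # \<Delta> \<turnstile> wk 1 (\<sigma> i) \<Colon>
      sub (\<lambda>i. wk 1 (\<sigma> i)) (wk (Suc i) (\<Gamma> ! i))" by (simp add: sub_eval)
  qed (use e in \<open>simp add: ext_def\<close>)
  have "sub (scons a \<sigma>) (Sig B D) # \<Delta> \<turnstile> Pr (wk 1 a) (Var 0) \<Colon>
      Sig (sub (\<lambda>i. wk 1 (\<sigma> i)) A) (sub (ups (\<lambda>i. wk 1 (\<sigma> i))) (Sig B D))"
  proof (rule Pr)
    show "sub (\<lambda>i. wk 1 (\<sigma> i)) A # sub (scons a \<sigma>) (Sig B D) # \<Delta> \<turnstile>
        sub (ups (\<lambda>i. wk 1 (\<sigma> i))) (Sig B D) \<Colon> Type"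
      using substitution[OF triple_types(4) substitution.K_ups[OF \<sigma>']]
        substitution[OF triple_types(1) \<sigma>']
      by simp
    show "sub (scons a \<sigma>) (Sig B D) # \<Delta> \<turnstile> wk 1 a \<Colon> sub (\<lambda>i. wk 1 (\<sigma> i)) A"
      using weaken[OF a e] by (simp add: sub_eval)
    show "sub (scons a \<sigma>) (Sig B D) # \<Delta> \<turnstile> Var 0 \<Colon>
        sub1 (sub (ups (\<lambda>i. wk 1 (\<sigma> i))) (Sig B D)) (wk 1 a)"
      by (rule ty_Var) (use e in \<open>simp_all add: ext_def sub_eval\<close>)
  qed
  then have "is_sub (scons (Pr (wk 1 a) (Var 0)) (\<lambda>i. wk 1 (\<sigma> i))) (Sig A (Sig B D) # \<Gamma>)
      (sub (scons a \<sigma>) (Sig B D) # \<Delta>)"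
    by (intro is_sub_scons[OF \<sigma>']) simp
  from substitution[OF C this] show ?thesis by simp
qed

lemma triple_step:
  assumes \<sigma>: "is_sub \<sigma> \<Gamma> \<Delta>" and a: "\<Delta> \<turnstile> a \<Colon> sub \<sigma> A"
  shows "sub (ups (scons a \<sigma>)) D # sub (scons a \<sigma>) B # \<Delta> \<turnstile> sub (ups (ups (scons a \<sigma>))) g \<Colon>
    subn 2 (sub (scons (Pr (wk 1 a) (Var 0)) (\<lambda>i. wk 1 (\<sigma> i))) C) (Pr (Var 1) (Var 0))"
proof -
  have s: "is_sub (scons a \<sigma>) (A # \<Gamma>) \<Delta>" using \<sigma> a by (rule is_sub_scons)
  have B: "is_sub (ups (scons a \<sigma>)) (B # A # \<Gamma>) (sub (scons a \<sigma>) B # \<Delta>)"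
    using substitution[OF triple_types(2) s] substitution.K_ups[OF s] by simp
  have "is_sub (ups (ups (scons a \<sigma>))) (D # B # A # \<Gamma>)
    (sub (ups (scons a \<sigma>)) D # sub (scons a \<sigma>) B # \<Delta>)"
    using substitution[OF triple_types(3) B] substitution.K_ups[OF B] by simp
  from substitution[OF g this] show ?thesis by (simp add: sub_eval)
qed

lemma triple_inner:
  "Sig B D # A # \<Gamma> \<turnstile>
     SigInd (sub (scons (Pr (Var 2) (Var 0)) (\<lambda>i. Var (i + 3))) C)
         (sub (scons (Var 0) (scons (Var 1) (\<lambda>i. Var (i + 3)))) g) (Var 0) \<Colon>
           subn 2 C (Pr (Var 1) (Var 0))"
proof -
  have w: "\<turnstile> Sig B D # A # \<Gamma>" using triple_types(4) by (rule wf_Cons)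
  \<comment> \<open>For typing, the substitution is the shift past the first component and the inner
    pair, and the first component is the variable \<open>Var 1\<close>. The computation rule below
    uses the identity substitution and the term \<open>a\<close> instead.\<close>
  have \<sigma>: "is_sub (\<lambda>i. Var (i + 2)) \<Gamma> (Sig B D # A # \<Gamma>)" using is_sub_wk ext2[OF w] by blast
  have a: "Sig B D # A # \<Gamma> \<turnstile> Var 1 \<Colon> sub (\<lambda>i. Var (i + 2)) A"
    by (rule ty_Var[OF w]) (simp_all add: sub_eval)
  note m = triple_motive[OF \<sigma> a] and st = triple_step[OF \<sigma> a]
  have v: "Sig B D # A # \<Gamma> \<turnstile> Var 0 \<Colon> sub (scons (Var 1) (\<lambda>i. Var (i + 2))) (Sig B D)"
    by (rule ty_Var[OF w]) (simp_all add: sub_eval)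
  from SigInd[OF to_Type[OF m[unfolded sub.simps]] st v[unfolded sub.simps]]
  show ?thesis by (simp add: sub_eval)
qed

lemma ty_triple_ind:
  assumes "\<Gamma> \<turnstile> e \<Colon> Sig A (Sig B D)" and "sub1 C e = T"
  shows "\<Gamma> \<turnstile> triple_ind C g e \<Colon> T"
  unfolding triple_ind_def using SigInd[OF to_Type[OF C] triple_inner assms(1)] assms(2) by simp

text \<open>Two beta steps: the outer one substitutes \<open>a\<close> and \<open>Pr b p\<close>
  into the inner eliminator, which is then applied to a pair and computes in turn.\<close>

lemma eq_triple_ind:
  assumes a: "\<Gamma> \<turnstile> a \<Colon> A" and b: "\<Gamma> \<turnstile> b \<Colon> sub1 B a" and p: "\<Gamma> \<turnstile> p \<Colon> sub2 D a b"
    and g': "sub (scons p (scons b (scons a Var))) g = g'" and T: "sub1 C (triple a b p) = T"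
  shows "\<Gamma> \<turnstile> triple_ind C g (triple a b p) \<doteq> g' \<Colon> T"
proof -
  have s: "is_sub Var \<Gamma> \<Gamma>" and a': "\<Gamma> \<turnstile> a \<Colon> sub Var A"
    using is_sub_Var wf_typing[OF a] a by (auto simp: sub_eval)
  note m = triple_motive[OF s a'] and st = triple_step[OF s a']
  have D: "sub (scons a Var) B # \<Gamma> \<turnstile> sub (ups (scons a Var)) D \<Colon> Type"
    using wf_hd[OF wf_typing[OF st]] .
  have bp: "\<Gamma> \<turnstile> Pr b p \<Colon> sub1 (Sig B D) a"
    unfolding sub1_def scons_def[symmetric] sub.simps
    by (rule Pr[OF D]) (use b p in \<open>simp_all add: sub_eval\<close>)
  have "\<Gamma> \<turnstile> triple_ind C g (triple a b p) \<doteq>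
     sub2 (SigInd (sub (scons (Pr (Var 2) (Var 0)) (\<lambda>i. Var (i + 3))) C)
         (sub (scons (Var 0) (scons (Var 1) (\<lambda>i. Var (i + 3)))) g) (Var 0)) a (Pr b p) \<Colon> T"
    unfolding triple_ind_def T[symmetric] by (rule Sig_beta[OF to_Type[OF C] triple_inner a bp])
  moreover have "\<Gamma> \<turnstile> sub2 (SigInd (sub (scons (Pr (Var 2) (Var 0)) (\<lambda>i. Var (i + 3))) C)
         (sub (scons (Var 0) (scons (Var 1) (\<lambda>i. Var (i + 3)))) g) (Var 0)) a (Pr b p) \<doteq> g' \<Colon> T"
    using Sig_beta[OF to_Type[OF m[unfolded sub.simps]] st, of b p] b p
      unfolding g'[symmetric] T[symmetric]
    by (simp add: sub_eval)
  ultimately show ?thesis by (rule trans)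
qed

end

section \<open>Pullbacks and joins\<close>

definition is_map :: "tm list \<Rightarrow> tm \<Rightarrow> tm \<Rightarrow> tm \<Rightarrow> bool" where
  "is_map \<Gamma> A X f \<longleftrightarrow> \<Gamma> \<turnstile> A \<Colon> \<U> \<and> \<Gamma> \<turnstile> X \<Colon> \<U> \<and> \<Gamma> \<turnstile> f \<Colon> arr A X"

lemma is_map_wk: "is_map \<Gamma> A X f \<Longrightarrow> ext n \<Gamma> \<Delta> \<Longrightarrow> is_map \<Delta> (wk n A) (wk n X) (wk n f)"
  unfolding is_map_def using weaken weaken_Univ by (fastforce simp: sub_eval_defs)

definition join_src :: "tm \<Rightarrow> tm \<Rightarrow> tm \<Rightarrow> tm" where
  "join_src A X f = Lam (pullback A A X f f) (InL (App (wk 1 (pullback_fst A A X f f)) (Var 0)))"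
definition join_tgt :: "tm \<Rightarrow> tm \<Rightarrow> tm \<Rightarrow> tm" where
  "join_tgt A X f = Lam (pullback A A X f f) (InR (App (wk 1 (pullback_snd A A X f f)) (Var 0)))"

lemma sub_join_src: "sub \<sigma> (join_src A X f) = join_src (sub \<sigma> A) (sub \<sigma> X) (sub \<sigma> f)"
  by (simp add: join_src_def sub_eval_defs)
lemma sub_join_tgt: "sub \<sigma> (join_tgt A X f) = join_tgt (sub \<sigma> A) (sub \<sigma> X) (sub \<sigma> f)"
  by (simp add: join_tgt_def sub_eval_defs)

lemma join_eq: "join A A X f f = Coeq (pullback A A X f f) (Sum A A) (join_src A X f)
  (join_tgt A X f)"
  by (simp add: join_def pushout_def join_src_def join_tgt_def)

abbreviation fpath :: "tm \<Rightarrow> tm \<Rightarrow> tm" where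
  "fpath X f \<equiv> Eq (wk 2 X) (App (wk 2 f) (Var 1)) (App (wk 2 f) (Var 0))"
abbreviation inl :: "tm \<Rightarrow> tm" where "inl a \<equiv> Pt (InL a)"
abbreviation inr :: "tm \<Rightarrow> tm" where "inr a \<equiv> Pt (InR a)"

lemma pb_eq: "pullback A A X f f = Sig A (Sig (wk 1 A) (fpath X f))"
  by (simp add: pullback_def)

context
  fixes \<Gamma> A X f
  assumes f_map: "is_map \<Gamma> A X f"
begin

lemma ty_A: "\<Gamma> \<turnstile> A \<Colon> \<U>" and ty_X: "\<Gamma> \<turnstile> X \<Colon> \<U>" and ty_f: "\<Gamma> \<turnstile> f \<Colon> arr A X"
  using f_map by (auto simp: is_map_def)

lemma ty_fa: "\<Gamma> \<turnstile> a \<Colon> A \<Longrightarrow> \<Gamma> \<turnstile> App f a \<Colon> X"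
  using ty_f by (rule ty_App)

lemma wf_AA: "\<turnstile> wk 1 A # A # \<Gamma>"
  using wf_Cons_Univ weaken_Univ ext1 ty_A by blast

lemma ty_fpath: "wk 1 A # A # \<Gamma> \<turnstile> fpath X f \<Colon> \<U>"
proof -
  note e = ext2[OF wf_AA]
  have f: "wk 1 A # A # \<Gamma> \<turnstile> wk 2 f \<Colon> arr (wk 2 A) (wk 2 X)"
    using weaken[OF ty_f e] by (simp add: sub_eval_defs)
  show ?thesis
    by (rule Eq, rule weaken_Univ[OF ty_X e]; rule ty_App[OF f], rule ty_Var[OF wf_AA])
      (simp_all add: sub_eval)
qed

lemma wf_fpath: "\<turnstile> fpath X f # wk 1 A # A # \<Gamma>"
  using ty_fpath by (rule wf_Cons_Univ)

lemma ty_A_AA: "A # \<Gamma> \<turnstile> wk 1 A \<Colon> \<U>"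
  using weaken_Univ[OF ty_A] ext1 wf_Cons_Univ[OF ty_A] by blast

lemma ty_Sig_fpath: "A # \<Gamma> \<turnstile> Sig (wk 1 A) (fpath X f) \<Colon> \<U>"
  using ty_A_AA ty_fpath by (rule Sig)

lemma ty_pb: "\<Gamma> \<turnstile> pullback A A X f f \<Colon> \<U>"
  unfolding pb_eq using ty_A ty_Sig_fpath by (rule Sig)

lemma ty_triple:
  assumes a: "\<Gamma> \<turnstile> a \<Colon> A" and b: "\<Gamma> \<turnstile> b \<Colon> A" and p: "\<Gamma> \<turnstile> p \<Colon> Eq X (App f a) (App f b)"
  shows "\<Gamma> \<turnstile> Pr b p \<Colon> Sig A (Eq (wk 1 X) (App (wk 1 f) (wk 1 a)) (App (wk 1 f) (Var 0)))"
    and "\<Gamma> \<turnstile> triple a b p \<Colon> pullback A A X f f"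
proof -
  have s: "is_sub (scons a Var) (A # \<Gamma>) \<Gamma>"
    using a is_sub_scons is_sub_Var wf_typing by (simp add: sub_Var)
  \<comment> \<open>The first component is substituted into \<open>fpath\<close> underneath the
    binder of the second one.\<close>
  have "is_sub (ups (scons a Var)) (wk 1 A # A # \<Gamma>) (sub (scons a Var) (wk 1 A) # \<Gamma>)"
    by (rule substitution.K_ups[OF s]) (use to_Type[OF ty_A] in \<open>simp add: sub_eval\<close>)
  from substitution[OF ty_fpath this]
  have "A # \<Gamma> \<turnstile> Eq (wk 1 X) (App (wk 1 f) (wk 1 a)) (App (wk 1 f) (Var 0)) \<Colon> \<U>"
    by (simp add: sub_eval)
  from Pr[OF to_Type[OF this] b] p
  show 1: "\<Gamma> \<turnstile> Pr b p \<Colon> Sig A (Eq (wk 1 X) (App (wk 1 f) (wk 1 a)) (App (wk 1 f) (Var 0)))"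
    by (simp add: sub_eval)
  show "\<Gamma> \<turnstile> triple a b p \<Colon> pullback A A X f f"
    unfolding pb_eq by (rule Pr[OF to_Type[OF ty_Sig_fpath] a]) (use 1 in \<open>simp add: sub_eval\<close>)
qed

end

context
  fixes \<Gamma> A X f
  assumes f_map: "is_map \<Gamma> A X f"
begin

lemma wf_pb: "\<turnstile> pullback A A X f f # \<Gamma>" using ty_pb[OF f_map] by (rule wf_Cons_Univ)

lemma ty_pb_fst: "\<Gamma> \<turnstile> e \<Colon> pullback A A X f f \<Longrightarrow> \<Gamma> \<turnstile> SigInd (wk 1 A) (Var 1) e \<Colon> A"
  and eq_pb_fst: "\<Gamma> \<turnstile> a \<Colon> A \<Longrightarrow> \<Gamma> \<turnstile> b \<Colon> A \<Longrightarrow> \<Gamma> \<turnstile> p \<Colon> Eq X (App f a) (App f b) \<Longrightarrow>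
    \<Gamma> \<turnstile> SigInd (wk 1 A) (Var 1) (triple a b p) \<doteq> a \<Colon> A"
proof -
  have C: "Sig A (Sig (wk 1 A) (fpath X f)) # \<Gamma> \<turnstile> wk 1 A \<Colon> Type"
    using weaken_Univ[OF to_Type[OF ty_A[OF f_map]] ext1[OF wf_pb]] by (simp add: pb_eq)
  have g: "Sig (wk 1 A) (fpath X f) # A # \<Gamma> \<turnstile> Var 1 \<Colon> subn 2 (wk 1 A) (Pr (Var 1) (Var 0))"
    by (rule ty_Var[OF wf_Cons_Univ[OF ty_Sig_fpath[OF f_map]]]) (simp_all add: sub_eval)
  show "\<Gamma> \<turnstile> SigInd (wk 1 A) (Var 1) e \<Colon> A" if "\<Gamma> \<turnstile> e \<Colon> pullback A A X f f"
    using SigInd[OF C g that[unfolded pb_eq]] by (simp add: sub_eval)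
  show "\<Gamma> \<turnstile> SigInd (wk 1 A) (Var 1) (triple a b p) \<doteq> a \<Colon> A"
    if "\<Gamma> \<turnstile> a \<Colon> A" "\<Gamma> \<turnstile> b \<Colon> A" "\<Gamma> \<turnstile> p \<Colon> Eq X (App f a) (App f b)"
    using Sig_beta[OF C g that(1), of "Pr b p"] ty_triple(1)[OF f_map that] by (simp add: sub_eval)
qed

lemma ty_pb_snd: "\<Gamma> \<turnstile> e \<Colon> pullback A A X f f \<Longrightarrow>
  \<Gamma> \<turnstile> SigInd (wk 1 A) (SigInd (wk 3 A) (Var 1) (Var 0)) e \<Colon> A"
  and eq_pb_snd: "\<Gamma> \<turnstile> a \<Colon> A \<Longrightarrow> \<Gamma> \<turnstile> b \<Colon> A \<Longrightarrow> \<Gamma> \<turnstile> p \<Colon> Eq X (App f a) (App f b) \<Longrightarrow>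
    \<Gamma> \<turnstile> SigInd (wk 1 A) (SigInd (wk 3 A) (Var 1) (Var 0)) (triple a b p) \<doteq> b \<Colon> A"
proof -
  have C: "Sig A (Sig (wk 1 A) (fpath X f)) # \<Gamma> \<turnstile> wk 1 A \<Colon> Type"
    using weaken_Univ[OF to_Type[OF ty_A[OF f_map]] ext1[OF wf_pb]] by (simp add: pb_eq)
  have g: "fpath X f # wk 1 A # A # \<Gamma> \<turnstile> Var 1 \<Colon>
    sub (scons (triple (Var 2) (Var 1) (Var 0)) (\<lambda>i. Var (i + 3))) (wk 1 A)"
    by (rule ty_Var[OF wf_fpath[OF f_map]]) (simp_all add: sub_eval)
  \<comment> \<open>The second projection is the elimination of triples into a constant family that
    returns the middle variable.\<close>
  have *: "SigInd (wk 1 A) (SigInd (wk 3 A) (Var 1) (Var 0)) e = triple_ind (wk 1 A) (Var 1) e"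
    for e
    by (simp add: triple_ind_def sub_eval)
  show "\<Gamma> \<turnstile> SigInd (wk 1 A) (SigInd (wk 3 A) (Var 1) (Var 0)) e \<Colon> A" if "\<Gamma> \<turnstile> e \<Colon> pullback A A X f f"
    unfolding * by (rule ty_triple_ind[OF C g that[unfolded pb_eq]]) (simp add: sub_eval)
  show "\<Gamma> \<turnstile> SigInd (wk 1 A) (SigInd (wk 3 A) (Var 1) (Var 0)) (triple a b p) \<doteq> b \<Colon> A"
    if "\<Gamma> \<turnstile> a \<Colon> A" "\<Gamma> \<turnstile> b \<Colon> A" "\<Gamma> \<turnstile> p \<Colon> Eq X (App f a) (App f b)"
    unfolding * by (rule eq_triple_ind[OF C g that(1)]) (use that in \<open>simp_all add: sub_eval\<close>)
qed

end

context
  fixes \<Gamma> A X f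
  assumes f_map: "is_map \<Gamma> A X f"
begin

lemma is_map_pb: "is_map (pullback A A X f f # \<Gamma>) (wk 1 A) (wk 1 X) (wk 1 f)"
  using is_map_wk[OF f_map ext1[OF wf_pb[OF f_map]]] .

lemma ty_pb_var: "pullback A A X f f # \<Gamma> \<turnstile> Var 0 \<Colon> pullback (wk 1 A) (wk 1 A) (wk 1 X) (wk 1 f)
  (wk 1 f)"
  by (rule ty_Var[OF wf_pb[OF f_map]]) (simp_all add: sub_eval_defs)

lemma ty_pb_fst_body: "pullback A A X f f # \<Gamma> \<turnstile> SigInd (wk 2 A) (Var 1) (Var 0) \<Colon> wk 1 A"
  using ty_pb_fst[OF is_map_pb ty_pb_var] by (simp add: sub_eval)

lemma ty_pullback_fst: "\<Gamma> \<turnstile> pullback_fst A A X f f \<Colon> arr (pullback A A X f f) A"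
  unfolding pullback_fst_def
  using to_Type[OF ty_pb[OF f_map]] ty_pb_fst_body by (rule ty_Lam)

lemma ty_pb_snd_body: "pullback A A X f f # \<Gamma> \<turnstile> SigInd (wk 2 A) (SigInd (wk 4 A) (Var 1) (Var 0))
  (Var 0) \<Colon> wk 1 A"
  using ty_pb_snd[OF is_map_pb ty_pb_var] by (simp add: sub_eval)

lemma ty_pullback_snd: "\<Gamma> \<turnstile> pullback_snd A A X f f \<Colon> arr (pullback A A X f f) A"
  unfolding pullback_snd_def
  using to_Type[OF ty_pb[OF f_map]] ty_pb_snd_body by (rule ty_Lam)

lemma ty_Sum: "\<Gamma> \<turnstile> Sum A A \<Colon> \<U>"
  using ty_A[OF f_map] by (intro Sum)

lemma ty_join_src_body: "pullback A A X f f # \<Gamma> \<turnstile> InL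
  (App (wk 1 (pullback_fst A A X f f)) (Var 0)) \<Colon> wk 1 (Sum A A)"
proof -
  note e = ext1[OF wf_pb[OF f_map]]
  have "pullback A A X f f # \<Gamma> \<turnstile> wk 1 (pullback_fst A A X f f) \<Colon>
    arr (wk 1 (pullback A A X f f)) (wk 1 A)"
    using weaken[OF ty_pullback_fst e] by (simp add: sub_eval_defs)
  from ty_App[OF this, of "Var 0"] ty_pb_var
  have "pullback A A X f f # \<Gamma> \<turnstile> App (wk 1 (pullback_fst A A X f f)) (Var 0) \<Colon> wk 1 A"
    by (simp add: sub_eval_defs)
  from InL[OF to_Type[OF weaken_Univ[OF ty_Sum e, simplified wk_sub sub.simps]], folded wk_sub,
    OF this]
  show ?thesis by (simp add: sub_eval)
qed

lemma ty_join_tgt_body: "pullback A A X f f # \<Gamma> \<turnstile> InR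
  (App (wk 1 (pullback_snd A A X f f)) (Var 0)) \<Colon> wk 1 (Sum A A)"
proof -
  note e = ext1[OF wf_pb[OF f_map]]
  have "pullback A A X f f # \<Gamma> \<turnstile> wk 1 (pullback_snd A A X f f) \<Colon>
    arr (wk 1 (pullback A A X f f)) (wk 1 A)"
    using weaken[OF ty_pullback_snd e] by (simp add: sub_eval_defs)
  from ty_App[OF this, of "Var 0"] ty_pb_var
  have "pullback A A X f f # \<Gamma> \<turnstile> App (wk 1 (pullback_snd A A X f f)) (Var 0) \<Colon> wk 1 A"
    by (simp add: sub_eval_defs)
  from InR[OF to_Type[OF weaken_Univ[OF ty_Sum e, simplified wk_sub sub.simps]], folded wk_sub,
    OF this]
  show ?thesis by (simp add: sub_eval)
qed

lemma ty_join_src: "\<Gamma> \<turnstile> join_src A X f \<Colon> arr (pullback A A X f f) (Sum A A)"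
  unfolding join_src_def using to_Type[OF ty_pb[OF f_map]] ty_join_src_body by (rule ty_Lam)

lemma ty_join_tgt: "\<Gamma> \<turnstile> join_tgt A X f \<Colon> arr (pullback A A X f f) (Sum A A)"
  unfolding join_tgt_def using to_Type[OF ty_pb[OF f_map]] ty_join_tgt_body by (rule ty_Lam)

lemma eq_join_src:
  assumes abp: "\<Gamma> \<turnstile> a \<Colon> A" "\<Gamma> \<turnstile> b \<Colon> A" "\<Gamma> \<turnstile> p \<Colon> Eq X (App f a) (App f b)"
  shows "\<Gamma> \<turnstile> App (join_src A X f) (triple a b p) \<doteq> InL a \<Colon> Sum A A"
proof (rule trans)
  show "\<Gamma> \<turnstile> App (join_src A X f) (triple a b p) \<doteq>
    InL (App (pullback_fst A A X f f) (triple a b p)) \<Colon> Sum A A"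
    unfolding join_src_def by (rule eq_beta[OF ty_join_src_body ty_triple(2)[OF f_map abp]])
      (simp_all add: sub_eval_defs)
  have "\<Gamma> \<turnstile> App (pullback_fst A A X f f) (triple a b p) \<doteq> SigInd (wk 1 A) (Var 1) (triple a b p) \<Colon>
    A"
    unfolding pullback_fst_def
    by (rule eq_beta[OF ty_pb_fst_body ty_triple(2)[OF f_map abp]]) (simp_all add: sub_eval_defs)
  from trans[OF this eq_pb_fst[OF f_map abp]]
  show "\<Gamma> \<turnstile> InL (App (pullback_fst A A X f f) (triple a b p)) \<doteq> InL a \<Colon> Sum A A"
    using to_Type[OF ty_Sum] by (intro InL_cong)
qed

lemma eq_join_tgt:
  assumes abp: "\<Gamma> \<turnstile> a \<Colon> A" "\<Gamma> \<turnstile> b \<Colon> A" "\<Gamma> \<turnstile> p \<Colon> Eq X (App f a) (App f b)"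
  shows "\<Gamma> \<turnstile> App (join_tgt A X f) (triple a b p) \<doteq> InR b \<Colon> Sum A A"
proof (rule trans)
  show "\<Gamma> \<turnstile> App (join_tgt A X f) (triple a b p) \<doteq>
    InR (App (pullback_snd A A X f f) (triple a b p)) \<Colon> Sum A A"
    unfolding join_tgt_def by (rule eq_beta[OF ty_join_tgt_body ty_triple(2)[OF f_map abp]])
      (simp_all add: sub_eval_defs)
  have "\<Gamma> \<turnstile> App (pullback_snd A A X f f) (triple a b p) \<doteq>
    SigInd (wk 1 A) (SigInd (wk 3 A) (Var 1) (Var 0)) (triple a b p) \<Colon> A"
    unfolding pullback_snd_def
    by (rule eq_beta[OF ty_pb_snd_body ty_triple(2)[OF f_map abp]]) (simp_all add: sub_eval_defs)
  from trans[OF this eq_pb_snd[OF f_map abp]]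
  show "\<Gamma> \<turnstile> InR (App (pullback_snd A A X f f) (triple a b p)) \<doteq> InR b \<Colon> Sum A A"
    using to_Type[OF ty_Sum] by (intro InR_cong)
qed

lemma ty_join: "\<Gamma> \<turnstile> join A A X f f \<Colon> \<U>"
  unfolding join_eq using ty_pb[OF f_map] ty_Sum ty_join_src ty_join_tgt by (rule Coeq)

lemma ty_Pt: "\<Gamma> \<turnstile> v \<Colon> Sum A A \<Longrightarrow> \<Gamma> \<turnstile> Pt v \<Colon> join A A X f f"
  using ty_join unfolding join_eq by (rule Pt)

lemma eq_Pt: "\<Gamma> \<turnstile> v \<doteq> v' \<Colon> Sum A A \<Longrightarrow> \<Gamma> \<turnstile> Pt v \<doteq> Pt v' \<Colon> join A A X f f"
  using ty_join unfolding join_eq by (rule Pt_cong)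

lemma ty_inl: "\<Gamma> \<turnstile> a \<Colon> A \<Longrightarrow> \<Gamma> \<turnstile> inl a \<Colon> join A A X f f"
  by (intro ty_Pt InL to_Type[OF ty_Sum])

lemma ty_inr: "\<Gamma> \<turnstile> a \<Colon> A \<Longrightarrow> \<Gamma> \<turnstile> inr a \<Colon> join A A X f f"
  by (intro ty_Pt InR to_Type[OF ty_Sum])

lemma ty_Glue: "\<Gamma> \<turnstile> e \<Colon> pullback A A X f f \<Longrightarrow>
    \<Gamma> \<turnstile> Glue e \<Colon> Eq (join A A X f f) (Pt (App (join_src A X f) e)) (Pt (App (join_tgt A X f) e))"
  using ty_join unfolding join_eq by (rule Glue)

text \<open>On a triple both edge maps compute, and the congruence of \<open>Pt\<close> carries this
  to the endpoints of the path.\<close>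

lemma ty_glue:
  assumes abp: "\<Gamma> \<turnstile> a \<Colon> A" "\<Gamma> \<turnstile> b \<Colon> A" "\<Gamma> \<turnstile> p \<Colon> Eq X (App f a) (App f b)"
  shows "\<Gamma> \<turnstile> Glue (triple a b p) \<Colon> Eq (join A A X f f) (inl a) (inr b)"
  by (rule conv[OF ty_Glue[OF ty_triple(2)[OF f_map abp]]], rule eq_cumul,
    rule Eq_cong[OF refl[OF ty_join]])
    (use eq_join_src[OF abp] eq_join_tgt[OF abp] in \<open>auto intro: eq_Pt\<close>)

end

section \<open>The map induced on the join\<close>

text \<open>
  \<open>join_map A X f\<close> is the map \<open>A *\<^sub>X A \<rightarrow> X\<close> that extends \<open>copair X f : A + A \<rightarrow> X\<close>. Its datum over
  \<open>Glue e\<close> must have type \<open>transp_const X _ _ (Glue e) v = v'\<close>, while the pullback supplies \<open>p : v = v'\<close>;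
  \<open>transp_path\<close> converts the latter into the former.
\<close>

definition copair :: "tm \<Rightarrow> tm \<Rightarrow> tm \<Rightarrow> tm" where
  "copair X f v = SumInd (wk 1 X) (App (wk 1 f) (Var 0)) (App (wk 1 f) (Var 0)) v"

text \<open>This is the third component of \<open>e\<close>. For a general \<open>e\<close> its
  endpoints can only be named through the edge maps, which explains the motive; on a triple the type
  becomes \<open>f a = f b\<close> judgementally.\<close>

definition pullback_path :: "tm \<Rightarrow> tm \<Rightarrow> tm \<Rightarrow> tm \<Rightarrow> tm" where
  "pullback_path A X f e = triple_ind
     (Eq (wk 1 X) (copair (wk 1 X) (wk 1 f) (App (join_src (wk 1 A) (wk 1 X) (wk 1 f)) (Var 0)))
       (copair (wk 1 X) (wk 1 f) (App (join_tgt (wk 1 A) (wk 1 X) (wk 1 f)) (Var 0)))) (Var 0) e"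

definition transp_const :: "tm \<Rightarrow> tm \<Rightarrow> tm \<Rightarrow> tm \<Rightarrow> tm \<Rightarrow> tm" where
  "transp_const X w w' q v = transp (wk 1 X) w w' q v"

definition transp_path :: "tm \<Rightarrow> tm \<Rightarrow> tm \<Rightarrow> tm \<Rightarrow> tm \<Rightarrow> tm \<Rightarrow> tm \<Rightarrow> tm" where
  "transp_path X w w' q v v' p = EqInd w
     (Eq (wk 2 X) (transp_const (wk 2 X) (wk 2 w) (Var 1) (Var 0) (wk 2 v)) (wk 2 v')) p w' q"

definition join_map_glue :: "tm \<Rightarrow> tm \<Rightarrow> tm \<Rightarrow> tm \<Rightarrow> tm" where
  "join_map_glue A X f e = transp_path X (Pt (App (join_src A X f) e))
    (Pt (App (join_tgt A X f) e)) (Glue e)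
     (copair X f (App (join_src A X f) e)) (copair X f (App (join_tgt A X f) e))
       (pullback_path A X f e)"

text \<open>The argument \<open>w\<close> is built in instead of being bound by a
  \<open>Lam\<close>, so the computation rules of the coequalizer apply without a beta step.\<close>

definition join_map :: "tm \<Rightarrow> tm \<Rightarrow> tm \<Rightarrow> tm \<Rightarrow> tm" where
  "join_map A X f w = CoeqInd (wk 1 X) (copair (wk 1 X) (wk 1 f) (Var 0))
     (join_map_glue (wk 1 A) (wk 1 X) (wk 1 f) (Var 0)) w"

definition apd_join_map :: "tm \<Rightarrow> tm \<Rightarrow> tm \<Rightarrow> tm \<Rightarrow> tm \<Rightarrow> tm \<Rightarrow> tm" where
  "apd_join_map A X f w w' q = apd (wk 1 X) (join_map (wk 1 A) (wk 1 X) (wk 1 f) (Var 0)) w w' q"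

text \<open>The nondependent counterpart of \<open>apd_join_map\<close>: its motive contains no
  transport, so its values are paths between the images of \<open>w\<close> and
  \<open>w'\<close>.\<close>

definition ap_join_map :: "tm \<Rightarrow> tm \<Rightarrow> tm \<Rightarrow> tm \<Rightarrow> tm \<Rightarrow> tm \<Rightarrow> tm" where
  "ap_join_map A X f w w' q = EqInd w
     (Eq (wk 2 X) (join_map (wk 2 A) (wk 2 X) (wk 2 f) (wk 2 w))
       (join_map (wk 2 A) (wk 2 X) (wk 2 f) (Var 1)))
     (Refl (join_map A X f w)) w' q"

lemma sub_copair: "sub \<sigma> (copair X f v) = copair (sub \<sigma> X) (sub \<sigma> f) (sub \<sigma> v)"
  by (simp add: copair_def sub_eval_defs)
lemma sub_pullback_path: "sub \<sigma> (pullback_path A X f v) = pullback_path (sub \<sigma> A) (sub \<sigma> X)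
  (sub \<sigma> f) (sub \<sigma> v)"
  by (simp add: pullback_path_def sub_eval_defs sub_triple_ind sub_copair sub_join_src sub_join_tgt)
lemma sub_transp_const: "sub \<sigma> (transp_const X w w' q v) = transp_const (sub \<sigma> X) (sub \<sigma> w)
  (sub \<sigma> w') (sub \<sigma> q) (sub \<sigma> v)"
  by (simp add: transp_const_def sub_eval_defs)
lemma sub_transp_path: "sub \<sigma> (transp_path X w w' q v v' p) =
    transp_path (sub \<sigma> X) (sub \<sigma> w) (sub \<sigma> w') (sub \<sigma> q) (sub \<sigma> v) (sub \<sigma> v') (sub \<sigma> p)"
  by (simp add: transp_path_def sub_eval_defs sub_transp_const)
lemma sub_join_map_glue: "sub \<sigma> (join_map_glue A X f e) = join_map_glue (sub \<sigma> A) (sub \<sigma> X)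
  (sub \<sigma> f) (sub \<sigma> e)"
  by (simp add: join_map_glue_def sub_transp_path sub_copair sub_join_src sub_join_tgt
    sub_pullback_path)
lemma sub_join_map: "sub \<sigma> (join_map A X f e) = join_map (sub \<sigma> A) (sub \<sigma> X) (sub \<sigma> f) (sub \<sigma> e)"
  by (simp add: join_map_def sub_join_map_glue sub_copair sub_eval)
lemma sub_apd_join_map: "sub \<sigma> (apd_join_map A X f w w' q) =
    apd_join_map (sub \<sigma> A) (sub \<sigma> X) (sub \<sigma> f) (sub \<sigma> w) (sub \<sigma> w') (sub \<sigma> q)"
  by (simp add: apd_join_map_def sub_join_map sub_apd sub_eval)
lemma sub_ap_join_map: "sub \<sigma> (ap_join_map A X f w w' q) =
    ap_join_map (sub \<sigma> A) (sub \<sigma> X) (sub \<sigma> f) (sub \<sigma> w) (sub \<sigma> w') (sub \<sigma> q)"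
  by (simp add: ap_join_map_def sub_join_map sub_eval)

lemmas sub_eval_join = sub_eval_defs sub_join_src sub_join_tgt sub_copair sub_pullback_path
  sub_transp_const sub_transp_path sub_join_map_glue sub_join_map sub_apd_join_map sub_ap_join_map

context
  fixes \<Gamma> J X w
  assumes J: "\<Gamma> \<turnstile> J \<Colon> \<U>" and X: "\<Gamma> \<turnstile> X \<Colon> \<U>" and w: "\<Gamma> \<turnstile> w \<Colon> J"
begin

lemma path_ext: "ext 2 \<Gamma> (Eq (wk 1 J) (wk 1 w) (Var 0) # J # \<Gamma>)"
  using ext2[OF wf_path_ctx[OF J w]] .

lemma path_vars:
  "Eq (wk 1 J) (wk 1 w) (Var 0) # J # \<Gamma> \<turnstile> Var 1 \<Colon> wk 2 J"
  "Eq (wk 1 J) (wk 1 w) (Var 0) # J # \<Gamma> \<turnstile> Var 0 \<Colon> Eq (wk 2 J) (wk 2 w) (Var 1)"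
  by (rule ty_Var[OF wf_path_ctx[OF J w]]; simp add: sub_eval)+

lemma transp_const_motive: "Eq (wk 1 J) (wk 1 w) (Var 0) # J # \<Gamma> \<turnstile> wk 1 (wk 1 X) \<Colon> \<U>"
  using weaken_Univ[OF X path_ext] by (simp add: sub_eval)

lemma ty_transp_const: "\<Gamma> \<turnstile> w' \<Colon> J \<Longrightarrow> \<Gamma> \<turnstile> q \<Colon> Eq J w w' \<Longrightarrow> \<Gamma> \<turnstile> v \<Colon> X \<Longrightarrow> \<Gamma> \<turnstile> transp_const X w w' q v \<Colon>
  X"
  unfolding transp_const_def transp_def
    by (rule ty_EqInd[OF transp_const_motive w]) (simp_all add: sub_eval)

lemma eq_transp_const: "\<Gamma> \<turnstile> v \<Colon> X \<Longrightarrow> \<Gamma> \<turnstile> transp_const X w w (Refl w) v \<doteq> v \<Colon> X"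
  unfolding transp_const_def transp_def
    by (rule eq_EqInd[OF transp_const_motive w]) (simp_all add: sub_eval)

lemma transp_const_cong: "\<Gamma> \<turnstile> w' \<Colon> J \<Longrightarrow> \<Gamma> \<turnstile> q \<Colon> Eq J w w' \<Longrightarrow> \<Gamma> \<turnstile> v \<doteq> v' \<Colon> X \<Longrightarrow>
    \<Gamma> \<turnstile> transp_const X w w' q v \<doteq> transp_const X w w' q v' \<Colon> X"
  unfolding transp_const_def transp_def
  using EqInd_cong[OF refl[OF to_Type[OF transp_const_motive]] refl[OF w], of v v' w' w' q q]
  by (simp add: sub_eval refl)

end

context
  fixes \<Gamma> J X w
  assumes J: "\<Gamma> \<turnstile> J \<Colon> \<U>" and X: "\<Gamma> \<turnstile> X \<Colon> \<U>" and w: "\<Gamma> \<turnstile> w \<Colon> J"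
begin

lemma path_transp_const:
  assumes "\<Gamma> \<turnstile> v \<Colon> X"
  shows "Eq (wk 1 J) (wk 1 w) (Var 0) # J # \<Gamma> \<turnstile> transp_const (wk 2 X) (wk 2 w) (Var 1) (Var 0)
    (wk 2 v) \<Colon> wk 2 X"
  by (rule ty_transp_const[OF weaken_Univ[OF J path_ext] weaken_Univ[OF X path_ext]
    weaken[OF w path_ext]])
    (use J w X path_vars weaken[OF assms path_ext] in auto)

lemma transp_path_motive:
  assumes "\<Gamma> \<turnstile> v \<Colon> X" "\<Gamma> \<turnstile> v' \<Colon> X"
  shows "Eq (wk 1 J) (wk 1 w) (Var 0) # J # \<Gamma> \<turnstile>
    Eq (wk 2 X) (transp_const (wk 2 X) (wk 2 w) (Var 1) (Var 0) (wk 2 v)) (wk 2 v') \<Colon> \<U>"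
  using weaken_Univ[OF X path_ext] path_transp_const weaken[OF assms(2) path_ext] assms J X w
    by (auto intro: Eq)

lemma eq_transp_path_type: "\<Gamma> \<turnstile> v \<Colon> X \<Longrightarrow> \<Gamma> \<turnstile> v' \<Colon> X \<Longrightarrow> \<Gamma> \<turnstile> Eq X (transp_const X w w (Refl w) v) v' \<doteq>
  Eq X v v' \<Colon> \<U>"
  by (intro Eq_cong eq_transp_const[OF J X w] refl X)

text \<open>Over \<open>Refl w\<close> the transport reduces to \<open>v\<close>, so
  \<open>p\<close> itself, after a conversion of its type, is the base case of the path
  induction.\<close>

lemma ty_transp_path: "\<Gamma> \<turnstile> w' \<Colon> J \<Longrightarrow> \<Gamma> \<turnstile> q \<Colon> Eq J w w' \<Longrightarrow> \<Gamma> \<turnstile> v \<Colon> X \<Longrightarrow> \<Gamma> \<turnstile> v' \<Colon> X \<Longrightarrow>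
    \<Gamma> \<turnstile> p \<Colon> Eq X v v' \<Longrightarrow> \<Gamma> \<turnstile> transp_path X w w' q v v' p \<Colon> Eq X (transp_const X w w' q v) v'"
  unfolding transp_path_def
  by (rule ty_EqInd[OF transp_path_motive w conv_sym_Univ[OF _ eq_transp_path_type]])
    (simp_all add: sub_eval sub_transp_const)

lemma eq_transp_path: "\<Gamma> \<turnstile> v \<Colon> X \<Longrightarrow> \<Gamma> \<turnstile> v' \<Colon> X \<Longrightarrow> \<Gamma> \<turnstile> p \<Colon> Eq X v v' \<Longrightarrow>
    \<Gamma> \<turnstile> transp_path X w w (Refl w) v v' p \<doteq> p \<Colon> Eq X (transp_const X w w (Refl w) v) v'"
  unfolding transp_path_def
  by (rule eq_EqInd[OF transp_path_motive w conv_sym_Univ[OF _ eq_transp_path_type]])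
    (simp_all add: sub_eval sub_transp_const)

lemma transp_path_cong:
  assumes "\<Gamma> \<turnstile> w' \<Colon> J" "\<Gamma> \<turnstile> q \<Colon> Eq J w w'" and v: "\<Gamma> \<turnstile> v \<Colon> X" and v': "\<Gamma> \<turnstile> v' \<Colon> X"
    and eqs: "\<Gamma> \<turnstile> v \<doteq> u \<Colon> X" "\<Gamma> \<turnstile> v' \<doteq> u' \<Colon> X" and p: "\<Gamma> \<turnstile> p \<Colon> Eq X v v'"
  shows "\<Gamma> \<turnstile> transp_path X w w' q v v' p \<doteq> transp_path X w w' q u u' p \<Colon>
    Eq X (transp_const X w w' q v) v'"
proof -
  have "Eq (wk 1 J) (wk 1 w) (Var 0) # J # \<Gamma> \<turnstile>
    Eq (wk 2 X) (transp_const (wk 2 X) (wk 2 w) (Var 1) (Var 0) (wk 2 v)) (wk 2 v') \<doteq>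
    Eq (wk 2 X) (transp_const (wk 2 X) (wk 2 w) (Var 1) (Var 0) (wk 2 u)) (wk 2 u') \<Colon> Type"
    using transp_const_cong[OF weaken_Univ[OF J path_ext] weaken_Univ[OF X path_ext]
      weaken[OF w path_ext]
        path_vars weaken_eq[OF eqs(1) path_ext]] weaken_eq[OF eqs(2) path_ext]
          weaken_Univ[OF X path_ext]
      J X w by (auto intro!: eq_cumul Eq_cong refl)
  from EqInd_cong[OF this refl[OF w], of p p w' w' q q]
    conv_sym_Univ[OF p eq_transp_path_type[OF v v']] assms
  show ?thesis unfolding transp_path_def by (simp add: sub_eval sub_transp_const refl)
qed

end

context
  fixes \<Gamma> A X f
  assumes f_map: "is_map \<Gamma> A X f"
begin

lemma copair_premises:
  "Sum A A # \<Gamma> \<turnstile> wk 1 X \<Colon> Type"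
  "A # \<Gamma> \<turnstile> App (wk 1 f) (Var 0) \<Colon> subn 1 (wk 1 X) (InL (Var 0))"
  "A # \<Gamma> \<turnstile> App (wk 1 f) (Var 0) \<Colon> subn 1 (wk 1 X) (InR (Var 0))"
proof -
  show "Sum A A # \<Gamma> \<turnstile> wk 1 X \<Colon> Type"
    using weaken_Univ[OF ty_X[OF f_map] ext1[OF wf_Cons_Univ[OF ty_Sum[OF f_map]]]]
      by (rule to_Type)
  have w: "\<turnstile> A # \<Gamma>" using ty_A[OF f_map] by (rule wf_Cons_Univ)
  have "A # \<Gamma> \<turnstile> App (wk 1 f) (Var 0) \<Colon> wk 1 X"
    by (rule ty_fa[OF is_map_wk[OF f_map ext1[OF w]]], rule ty_Var[OF w]) simp_all
  then show "A # \<Gamma> \<turnstile> App (wk 1 f) (Var 0) \<Colon> subn 1 (wk 1 X) (InL (Var 0))"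
    "A # \<Gamma> \<turnstile> App (wk 1 f) (Var 0) \<Colon> subn 1 (wk 1 X) (InR (Var 0))"
    by (simp_all add: sub_eval)
qed

lemma ty_copair: "\<Gamma> \<turnstile> v \<Colon> Sum A A \<Longrightarrow> \<Gamma> \<turnstile> copair X f v \<Colon> X"
  unfolding copair_def using SumInd[OF copair_premises] by (simp add: sub_eval)

lemma eq_copair_InL: "\<Gamma> \<turnstile> a \<Colon> A \<Longrightarrow> \<Gamma> \<turnstile> copair X f (InL a) \<doteq> App f a \<Colon> X"
  unfolding copair_def using Sum_beta_l[OF copair_premises] by (simp add: sub_eval)

lemma eq_copair_InR: "\<Gamma> \<turnstile> a \<Colon> A \<Longrightarrow> \<Gamma> \<turnstile> copair X f (InR a) \<doteq> App f a \<Colon> X"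
  unfolding copair_def using Sum_beta_r[OF copair_premises] by (simp add: sub_eval)

lemma copair_cong: "\<Gamma> \<turnstile> v \<doteq> v' \<Colon> Sum A A \<Longrightarrow> \<Gamma> \<turnstile> copair X f v \<doteq> copair X f v' \<Colon> X"
  unfolding copair_def using SumInd_cong[OF copair_premises[THEN refl]] by (simp add: sub_eval)

lemma ty_App_join_src: "\<Gamma> \<turnstile> e \<Colon> pullback A A X f f \<Longrightarrow> \<Gamma> \<turnstile> App (join_src A X f) e \<Colon> Sum A A"
  using ty_join_src[OF f_map] by (rule ty_App)

lemma ty_App_join_tgt: "\<Gamma> \<turnstile> e \<Colon> pullback A A X f f \<Longrightarrow> \<Gamma> \<turnstile> App (join_tgt A X f) e \<Colon> Sum A A"
  using ty_join_tgt[OF f_map] by (rule ty_App)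

lemma ty_copair_path: "\<Gamma> \<turnstile> e \<Colon> pullback A A X f f \<Longrightarrow>
    \<Gamma> \<turnstile> Eq X (copair X f (App (join_src A X f) e)) (copair X f (App (join_tgt A X f) e)) \<Colon> \<U>"
  by (intro Eq ty_X[OF f_map] ty_copair ty_App_join_src ty_App_join_tgt)

lemma eq_copair_path:
  assumes abp: "\<Gamma> \<turnstile> a \<Colon> A" "\<Gamma> \<turnstile> b \<Colon> A" "\<Gamma> \<turnstile> p \<Colon> Eq X (App f a) (App f b)"
  shows "\<Gamma> \<turnstile> copair X f (App (join_src A X f) (triple a b p)) \<doteq> App f a \<Colon> X"
    and "\<Gamma> \<turnstile> copair X f (App (join_tgt A X f) (triple a b p)) \<doteq> App f b \<Colon> X"
    and "\<Gamma> \<turnstile> Eq X (copair X f (App (join_src A X f) (triple a b p)))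
      (copair X f (App (join_tgt A X f) (triple a b p)))
      \<doteq> Eq X (App f a) (App f b) \<Colon> \<U>"
  using trans[OF copair_cong[OF eq_join_src[OF f_map abp]] eq_copair_InL[OF abp(1)]]
    trans[OF copair_cong[OF eq_join_tgt[OF f_map abp]] eq_copair_InR[OF abp(2)]]
      refl[OF ty_X[OF f_map]]
  by (auto intro: Eq_cong)

lemma fpath_vars:
  "fpath X f # wk 1 A # A # \<Gamma> \<turnstile> Var 2 \<Colon> wk 3 A" "fpath X f # wk 1 A # A # \<Gamma> \<turnstile> Var 1 \<Colon> wk 3 A"
  "fpath X f # wk 1 A # A # \<Gamma> \<turnstile> Var 0 \<Colon> Eq (wk 3 X) (App (wk 3 f) (Var 2)) (App (wk 3 f) (Var 1))"
  by (rule ty_Var[OF wf_fpath[OF f_map]]; simp add: sub_eval)+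

lemma fpath_map: "is_map (fpath X f # wk 1 A # A # \<Gamma>) (wk 3 A) (wk 3 X) (wk 3 f)"
  by (rule is_map_wk[OF f_map ext3[OF wf_fpath[OF f_map]]])

end

context
  fixes \<Gamma> A X f
  assumes f_map: "is_map \<Gamma> A X f"
begin

lemma pullback_path_premises:
  "Sig A (Sig (wk 1 A) (fpath X f)) # \<Gamma> \<turnstile>
     Eq (wk 1 X) (copair (wk 1 X) (wk 1 f) (App (join_src (wk 1 A) (wk 1 X) (wk 1 f)) (Var 0)))
       (copair (wk 1 X) (wk 1 f) (App (join_tgt (wk 1 A) (wk 1 X) (wk 1 f)) (Var 0))) \<Colon> \<U>"
  "fpath X f # wk 1 A # A # \<Gamma> \<turnstile> Var 0 \<Colon>
    sub (scons (triple (Var 2) (Var 1) (Var 0)) (\<lambda>i. Var (i + 3)))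
     (Eq (wk 1 X) (copair (wk 1 X) (wk 1 f) (App (join_src (wk 1 A) (wk 1 X) (wk 1 f)) (Var 0)))
       (copair (wk 1 X) (wk 1 f) (App (join_tgt (wk 1 A) (wk 1 X) (wk 1 f)) (Var 0))))"
  subgoal using ty_copair_path[OF is_map_pb[OF f_map] ty_pb_var[OF f_map]] by (simp add: pb_eq)
  subgoal using conv_sym_Univ[OF fpath_vars(3)[OF f_map]
    eq_copair_path(3)[OF fpath_map fpath_vars, OF f_map f_map f_map f_map]]
    by (simp add: sub_eval_join)
  done

lemma ty_pullback_path: "\<Gamma> \<turnstile> e \<Colon> pullback A A X f f \<Longrightarrow>
    \<Gamma> \<turnstile> pullback_path A X f e \<Colon> Eq X (copair X f (App (join_src A X f) e))
      (copair X f (App (join_tgt A X f) e))"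
  unfolding pullback_path_def pb_eq
    by (rule ty_triple_ind[OF pullback_path_premises]) (simp_all add: sub_eval_join)

lemma eq_pullback_path:
  assumes abp: "\<Gamma> \<turnstile> a \<Colon> A" "\<Gamma> \<turnstile> b \<Colon> A" "\<Gamma> \<turnstile> p \<Colon> Eq X (App f a) (App f b)"
  shows "\<Gamma> \<turnstile> pullback_path A X f (triple a b p) \<doteq> p \<Colon> Eq X (App f a) (App f b)"
  by (rule eq_conv_Univ[OF _ eq_copair_path(3)[OF f_map abp]], unfold pullback_path_def,
      rule eq_triple_ind[OF pullback_path_premises abp(1)])
        (use abp in \<open>simp_all add: sub_eval_join\<close>)

lemma ty_Glue_ends:
  assumes "\<Gamma> \<turnstile> e \<Colon> pullback A A X f f"
  shows "\<Gamma> \<turnstile> Pt (App (join_src A X f) e) \<Colon> join A A X f f" "\<Gamma> \<turnstile> Pt (App (join_tgt A X f) e) \<Colon>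
    join A A X f f"
  using assms by (auto intro: ty_Pt[OF f_map] ty_App_join_src[OF f_map] ty_App_join_tgt[OF f_map])

lemma ty_join_map_glue:
  assumes e: "\<Gamma> \<turnstile> e \<Colon> pullback A A X f f"
  shows "\<Gamma> \<turnstile> join_map_glue A X f e \<Colon>
    Eq X (transp_const X (Pt (App (join_src A X f) e)) (Pt (App (join_tgt A X f) e)) (Glue e)
      (copair X f (App (join_src A X f) e)))
      (copair X f (App (join_tgt A X f) e))"
  unfolding join_map_glue_def
  using ty_transp_path[OF ty_join[OF f_map] ty_X[OF f_map] ty_Glue_ends[OF e] ty_Glue[OF f_map e]]
    ty_copair[OF f_map ty_App_join_src[OF f_map e]]
      ty_copair[OF f_map ty_App_join_tgt[OF f_map e]] ty_pullback_path[OF e] by blast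

text \<open>Identifies the datum that \<open>CoeqInd\<close> demands in a constant family with the
  type of \<open>join_map_glue\<close>.\<close>

lemma coeq_path_copair: "coeq_path (wk 1 X) (copair (wk 1 X) (wk 1 f) (Var 0)) s t e =
    Eq X (transp_const X (Pt (App s e)) (Pt (App t e)) (Glue e) (copair X f (App s e)))
      (copair X f (App t e))"
  by (simp add: coeq_path_def transp_const_def sub_copair sub_eval_defs)

end

context
  fixes \<Gamma> A X f
  assumes f_map: "is_map \<Gamma> A X f"
begin

lemma wf_join: "\<turnstile> join A A X f f # \<Gamma>" using ty_join[OF f_map] by (rule wf_Cons_Univ)

lemma join_map_premises:
  "Coeq (pullback A A X f f) (Sum A A) (join_src A X f) (join_tgt A X f) # \<Gamma> \<turnstile> wk 1 X \<Colon> Type"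
  "Sum A A # \<Gamma> \<turnstile> copair (wk 1 X) (wk 1 f) (Var 0) \<Colon> subn 1 (wk 1 X) (Pt (Var 0))"
  "pullback A A X f f # \<Gamma> \<turnstile> join_map_glue (wk 1 A) (wk 1 X) (wk 1 f) (Var 0) \<Colon>
    coeq_path (wkb 1 (wk 1 X)) (wkb 1 (copair (wk 1 X) (wk 1 f) (Var 0)))
      (wk 1 (join_src A X f)) (wk 1 (join_tgt A X f)) (Var 0)"
proof -
  show "Coeq (pullback A A X f f) (Sum A A) (join_src A X f) (join_tgt A X f) # \<Gamma> \<turnstile> wk 1 X \<Colon> Type"
    using weaken_Univ[OF ty_X[OF f_map] ext1[OF wf_join]] by (simp add: join_eq to_Type)
  have w: "\<turnstile> Sum A A # \<Gamma>" using ty_Sum[OF f_map] by (rule wf_Cons_Univ)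
  show "Sum A A # \<Gamma> \<turnstile> copair (wk 1 X) (wk 1 f) (Var 0) \<Colon> subn 1 (wk 1 X) (Pt (Var 0))"
    using ty_copair[OF is_map_wk[OF f_map ext1[OF w]] ty_Var[OF w, of 0]] by (simp add: sub_eval)
  show "pullback A A X f f # \<Gamma> \<turnstile> join_map_glue (wk 1 A) (wk 1 X) (wk 1 f) (Var 0) \<Colon>
    coeq_path (wkb 1 (wk 1 X)) (wkb 1 (copair (wk 1 X) (wk 1 f) (Var 0)))
      (wk 1 (join_src A X f)) (wk 1 (join_tgt A X f)) (Var 0)"
    using ty_join_map_glue[OF is_map_pb[OF f_map] ty_pb_var[OF f_map]]
    unfolding coeq_path_copair[OF is_map_pb[OF f_map], symmetric] by (simp add: sub_eval_join)
qed

lemma ty_join_map: "\<Gamma> \<turnstile> w \<Colon> join A A X f f \<Longrightarrow> \<Gamma> \<turnstile> join_map A X f w \<Colon> X"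
  unfolding join_map_def join_eq using CoeqInd[OF join_map_premises] by (simp add: sub_eval)

lemma join_map_cong: "\<Gamma> \<turnstile> w \<doteq> w' \<Colon> join A A X f f \<Longrightarrow> \<Gamma> \<turnstile> join_map A X f w \<doteq> join_map A X f w' \<Colon> X"
  unfolding join_map_def join_eq using CoeqInd_cong[OF join_map_premises[THEN refl]]
    by (simp add: sub_eval)

lemma eq_join_map_Pt: "\<Gamma> \<turnstile> v \<Colon> Sum A A \<Longrightarrow> \<Gamma> \<turnstile> join_map A X f (Pt v) \<doteq> copair X f v \<Colon> X"
  unfolding join_map_def using Coeq_beta[OF join_map_premises] by (simp add: sub_eval sub_copair)

lemma eq_join_map_inl: "\<Gamma> \<turnstile> a \<Colon> A \<Longrightarrow> \<Gamma> \<turnstile> join_map A X f (inl a) \<doteq> App f a \<Colon> X"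
  by (rule trans[OF eq_join_map_Pt eq_copair_InL[OF f_map]])
    (intro InL to_Type[OF ty_Sum[OF f_map]])

lemma eq_join_map_inr: "\<Gamma> \<turnstile> a \<Colon> A \<Longrightarrow> \<Gamma> \<turnstile> join_map A X f (inr a) \<doteq> App f a \<Colon> X"
  by (rule trans[OF eq_join_map_Pt eq_copair_InR[OF f_map]])
    (intro InR to_Type[OF ty_Sum[OF f_map]])

text \<open>This is where the path computation rule for coequalizers enters the argument.\<close>

lemma apd_join_map_Glue:
  assumes e: "\<Gamma> \<turnstile> e \<Colon> pullback A A X f f"
  shows "inhabited \<Gamma> (Eq (Eq X (transp_const X (Pt (App (join_src A X f) e))
    (Pt (App (join_tgt A X f) e)) (Glue e)
        (copair X f (App (join_src A X f) e))) (copair X f (App (join_tgt A X f) e)))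
      (apd_join_map A X f (Pt (App (join_src A X f) e)) (Pt (App (join_tgt A X f) e)) (Glue e))
        (join_map_glue A X f e))"
proof -
  have 1: "CoeqInd (wkb 1 (wk 1 X)) (wkb 1 (copair (wk 1 X) (wk 1 f) (Var 0)))
      (wkb 1 (join_map_glue (wk 1 A) (wk 1 X) (wk 1 f) (Var 0))) (Var 0) = join_map (wk 1 A)
        (wk 1 X) (wk 1 f) (Var 0)"
    by (simp add: join_map_def sub_eval_join)
  have 2: "sub1 (join_map_glue (wk 1 A) (wk 1 X) (wk 1 f) (Var 0)) e = join_map_glue A X f e"
    by (simp add: sub_eval_join)
  show ?thesis
    using CoeqGlue[OF join_map_premises e]
      unfolding 1 2 coeq_path_copair[OF f_map] apd_join_map_def by (rule inhabitedI)
qed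

end

context
  fixes \<Gamma> A X f w
  assumes f_map: "is_map \<Gamma> A X f" and w: "\<Gamma> \<turnstile> w \<Colon> join A A X f f"
begin

abbreviation (input) "join_path_ctx \<equiv>
  Eq (wk 1 (join A A X f f)) (wk 1 w) (Var 0) # join A A X f f # \<Gamma>"

lemma join_path_ext: "ext 2 \<Gamma> join_path_ctx"
  using path_ext[OF ty_join[OF f_map] ty_X[OF f_map] w] .

lemma join_path_map: "is_map join_path_ctx (wk 2 A) (wk 2 X) (wk 2 f)"
  using is_map_wk[OF f_map join_path_ext] .

lemma join_path_vars:
  "join_path_ctx \<turnstile> Var 1 \<Colon> join (wk 2 A) (wk 2 A) (wk 2 X) (wk 2 f) (wk 2 f)"
  "join_path_ctx \<turnstile> Var 0 \<Colon> Eq (join (wk 2 A) (wk 2 A) (wk 2 X) (wk 2 f) (wk 2 f)) (wk 2 w) (Var 1)"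
  "join_path_ctx \<turnstile> wk 2 w \<Colon> join (wk 2 A) (wk 2 A) (wk 2 X) (wk 2 f) (wk 2 f)"
  using path_vars[OF ty_join[OF f_map] ty_X[OF f_map] w] weaken[OF w join_path_ext]
    by (simp_all add: sub_eval_defs)

lemma apd_join_map_unfold: "apd_join_map A X f w w' q = EqInd w
    (Eq (wk 2 X) (transp_const (wk 2 X) (wk 2 w) (Var 1) (Var 0)
      (join_map (wk 2 A) (wk 2 X) (wk 2 f) (wk 2 w)))
      (join_map (wk 2 A) (wk 2 X) (wk 2 f) (Var 1)))
    (Refl (join_map A X f w)) w' q"
  by (simp add: apd_join_map_def apd_def transp_const_def sub_eval_join)

lemma apd_join_map_motive: "join_path_ctx \<turnstile>
    Eq (wk 2 X) (transp_const (wk 2 X) (wk 2 w) (Var 1) (Var 0)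
      (join_map (wk 2 A) (wk 2 X) (wk 2 f) (wk 2 w)))
      (join_map (wk 2 A) (wk 2 X) (wk 2 f) (Var 1)) \<Colon> \<U>"
  by (rule Eq[OF ty_X[OF join_path_map]
    ty_transp_const[OF ty_join[OF join_path_map] ty_X[OF join_path_map] join_path_vars(3,1,2)]])
    (rule ty_join_map[OF join_path_map], rule join_path_vars)+

lemma eq_apd_join_map_type: "\<Gamma> \<turnstile> Eq X (transp_const X w w (Refl w) (join_map A X f w))
  (join_map A X f w) \<doteq>
    Eq X (join_map A X f w) (join_map A X f w) \<Colon> \<U>"
  by (rule eq_transp_path_type[OF ty_join[OF f_map] ty_X[OF f_map] w]; rule ty_join_map[OF f_map w])

lemma Refl_apd_join_map: "\<Gamma> \<turnstile> Refl (join_map A X f w) \<Colon>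
  Eq X (transp_const X w w (Refl w) (join_map A X f w)) (join_map A X f w)"
  using conv_sym_Univ[OF Refl[OF ty_join_map[OF f_map w]] eq_apd_join_map_type] .

lemma ty_apd_join_map: "\<Gamma> \<turnstile> w' \<Colon> join A A X f f \<Longrightarrow> \<Gamma> \<turnstile> q \<Colon> Eq (join A A X f f) w w' \<Longrightarrow>
    \<Gamma> \<turnstile> apd_join_map A X f w w' q \<Colon> Eq X (transp_const X w w' q (join_map A X f w))
      (join_map A X f w')"
  unfolding apd_join_map_unfold by (rule ty_EqInd[OF apd_join_map_motive w Refl_apd_join_map])
    (simp_all add: sub_eval_join)

lemma eq_apd_join_map: "\<Gamma> \<turnstile> apd_join_map A X f w w (Refl w) \<doteq> Refl (join_map A X f w) \<Colon>
    Eq X (transp_const X w w (Refl w) (join_map A X f w)) (join_map A X f w)"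
  unfolding apd_join_map_unfold by (rule eq_EqInd[OF apd_join_map_motive w Refl_apd_join_map])
    (simp_all add: sub_eval_join)

lemma ap_join_map_motive: "join_path_ctx \<turnstile>
    Eq (wk 2 X) (join_map (wk 2 A) (wk 2 X) (wk 2 f) (wk 2 w))
      (join_map (wk 2 A) (wk 2 X) (wk 2 f) (Var 1)) \<Colon> \<U>"
  by (intro Eq ty_X[OF join_path_map] ty_join_map[OF join_path_map] join_path_vars)

lemma ty_ap_join_map: "\<Gamma> \<turnstile> w' \<Colon> join A A X f f \<Longrightarrow> \<Gamma> \<turnstile> q \<Colon> Eq (join A A X f f) w w' \<Longrightarrow>
    \<Gamma> \<turnstile> ap_join_map A X f w w' q \<Colon> Eq X (join_map A X f w) (join_map A X f w')"
  unfolding ap_join_map_def by (rule ty_EqInd[OF ap_join_map_motive w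
    Refl[OF ty_join_map[OF f_map w]]]) (simp_all add: sub_eval_join)

lemma eq_ap_join_map: "\<Gamma> \<turnstile> ap_join_map A X f w w (Refl w) \<doteq> Refl (join_map A X f w) \<Colon>
  Eq X (join_map A X f w) (join_map A X f w)"
  unfolding ap_join_map_def by (rule eq_EqInd[OF ap_join_map_motive w
    Refl[OF ty_join_map[OF f_map w]]]) (simp_all add: sub_eval_join)

text \<open>Needed to replace the endpoints given by the edge maps by \<open>inl a\<close> and
  \<open>inr b\<close> while the glue path stays the same.\<close>

lemma ap_join_map_cong:
  assumes v: "\<Gamma> \<turnstile> w \<doteq> v \<Colon> join A A X f f" and v': "\<Gamma> \<turnstile> w' \<doteq> v' \<Colon> join A A X f f"
    and q: "\<Gamma> \<turnstile> q \<Colon> Eq (join A A X f f) w w'"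
  shows "\<Gamma> \<turnstile> ap_join_map A X f w w' q \<doteq> ap_join_map A X f v v' q \<Colon>
    Eq X (join_map A X f w) (join_map A X f w')"
proof -
  have "join_path_ctx \<turnstile> wk 2 w \<doteq> wk 2 v \<Colon> join (wk 2 A) (wk 2 A) (wk 2 X) (wk 2 f) (wk 2 f)"
    using weaken_eq[OF v join_path_ext] by (simp add: sub_eval_defs)
  then have "join_path_ctx \<turnstile>
    Eq (wk 2 X) (join_map (wk 2 A) (wk 2 X) (wk 2 f) (wk 2 w))
      (join_map (wk 2 A) (wk 2 X) (wk 2 f) (Var 1)) \<doteq>
    Eq (wk 2 X) (join_map (wk 2 A) (wk 2 X) (wk 2 f) (wk 2 v))
      (join_map (wk 2 A) (wk 2 X) (wk 2 f) (Var 1)) \<Colon> \<U>"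
    by (intro Eq_cong refl[OF ty_X[OF join_path_map]] join_map_cong[OF join_path_map]
      refl[OF join_path_vars(1)])
  from EqInd_cong[OF eq_cumul[OF this] v, of "Refl (join_map A X f w)" "Refl (join_map A X f v)"
    w' v' q q]
  show ?thesis
    using Refl_cong[OF join_map_cong[OF f_map v]] v' refl[OF q] unfolding ap_join_map_def
      by (simp add: sub_eval_join)
qed

end

text \<open>Together with \<open>ap_join_map_eq\<close> this expresses the relation between
  \<open>apd\<close> and \<open>ap\<close> in a constant family: the dependent action is the
  converted \<open>p\<close>, respectively the plain action is \<open>p\<close>. An implication from
  the first to the second suffices.\<close>

definition apd_join_map_eq :: "tm \<Rightarrow> tm \<Rightarrow> tm \<Rightarrow> tm \<Rightarrow> tm \<Rightarrow> tm \<Rightarrow> tm \<Rightarrow> tm" where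
  "apd_join_map_eq A X f w w' q p = Eq
    (Eq X (transp_const X w w' q (join_map A X f w)) (join_map A X f w'))
     (apd_join_map A X f w w' q) (transp_path X w w' q (join_map A X f w) (join_map A X f w') p)"

definition ap_join_map_eq :: "tm \<Rightarrow> tm \<Rightarrow> tm \<Rightarrow> tm \<Rightarrow> tm \<Rightarrow> tm \<Rightarrow> tm \<Rightarrow> tm" where
  "ap_join_map_eq A X f w w' q p = Eq (Eq X (join_map A X f w) (join_map A X f w'))
    (ap_join_map A X f w w' q) p"

lemma sub_apd_join_map_eq: "sub \<sigma> (apd_join_map_eq A X f w w' q p) =
    apd_join_map_eq (sub \<sigma> A) (sub \<sigma> X) (sub \<sigma> f) (sub \<sigma> w) (sub \<sigma> w') (sub \<sigma> q) (sub \<sigma> p)"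
  by (simp add: apd_join_map_eq_def sub_eval_join)
lemma sub_ap_join_map_eq: "sub \<sigma> (ap_join_map_eq A X f w w' q p) =
    ap_join_map_eq (sub \<sigma> A) (sub \<sigma> X) (sub \<sigma> f) (sub \<sigma> w) (sub \<sigma> w') (sub \<sigma> q) (sub \<sigma> p)"
  by (simp add: ap_join_map_eq_def sub_eval_join)

context
  fixes \<Gamma> A X f w
  assumes f_map: "is_map \<Gamma> A X f" and w: "\<Gamma> \<turnstile> w \<Colon> join A A X f f"
begin

lemma ty_apd_join_map_eq:
  assumes w': "\<Gamma> \<turnstile> w' \<Colon> join A A X f f" and q: "\<Gamma> \<turnstile> q \<Colon> Eq (join A A X f f) w w'"
    and p: "\<Gamma> \<turnstile> p \<Colon> Eq X (join_map A X f w) (join_map A X f w')"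
  shows "\<Gamma> \<turnstile> apd_join_map_eq A X f w w' q p \<Colon> \<U>"
  unfolding apd_join_map_eq_def
  by (intro Eq ty_X[OF f_map] ty_transp_const[OF ty_join[OF f_map]]
    ty_transp_path[OF ty_join[OF f_map]] ty_join_map[OF f_map] ty_apd_join_map[OF f_map] w assms)

lemma ty_join_map_path: "\<Gamma> \<turnstile> w' \<Colon> join A A X f f \<Longrightarrow>
  \<Gamma> \<turnstile> Eq X (join_map A X f w) (join_map A X f w') \<Colon> \<U>"
  by (intro Eq ty_X[OF f_map] ty_join_map[OF f_map] w)

lemma ty_ap_join_map_eq:
  assumes w': "\<Gamma> \<turnstile> w' \<Colon> join A A X f f" and q: "\<Gamma> \<turnstile> q \<Colon> Eq (join A A X f f) w w'"
    and p: "\<Gamma> \<turnstile> p \<Colon> Eq X (join_map A X f w) (join_map A X f w')"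
  shows "\<Gamma> \<turnstile> ap_join_map_eq A X f w w' q p \<Colon> \<U>"
  unfolding ap_join_map_eq_def by (intro Eq[OF ty_join_map_path] ty_ap_join_map[OF f_map] w assms)

text \<open>At reflexivity \<open>apd\<close>, \<open>ap\<close>, \<open>transp_const\<close> and
  \<open>transp_path\<close> all compute. Both sides become the type
  \<open>Refl (join_map A X f w) = p\<close>, and the identity function proves the
  implication.\<close>

lemma ap_join_map_eq_if_apd_refl:
  assumes p: "\<Gamma> \<turnstile> p \<Colon> Eq X (join_map A X f w) (join_map A X f w)"
  shows "inhabited \<Gamma> (arr (apd_join_map_eq A X f w w (Refl w) p)
    (ap_join_map_eq A X f w w (Refl w) p))"
proof -
  note cw = ty_join_map[OF f_map w]
  have "\<Gamma> \<turnstile> apd_join_map_eq A X f w w (Refl w) p \<doteq> Eq (Eq X (join_map A X f w) (join_map A X f w))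
    (Refl (join_map A X f w)) p \<Colon> \<U>"
    unfolding apd_join_map_eq_def
    by (intro Eq_cong eq_apd_join_map_type[OF f_map w] eq_apd_join_map[OF f_map w]
      eq_transp_path[OF ty_join[OF f_map] ty_X[OF f_map] w] cw p)
  moreover have "\<Gamma> \<turnstile> ap_join_map_eq A X f w w (Refl w) p \<doteq>
    Eq (Eq X (join_map A X f w) (join_map A X f w)) (Refl (join_map A X f w)) p \<Colon> \<U>"
    unfolding ap_join_map_eq_def by
      (intro Eq_cong eq_ap_join_map[OF f_map w] refl p ty_X[OF f_map] cw)
  ultimately have eq: "\<Gamma> \<turnstile> apd_join_map_eq A X f w w (Refl w) p \<doteq>
    ap_join_map_eq A X f w w (Refl w) p \<Colon> \<U>"
    by (blast intro: trans sym)
  have h: "\<Gamma> \<turnstile> apd_join_map_eq A X f w w (Refl w) p \<Colon> \<U>"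
    by (rule ty_apd_join_map_eq[OF w Refl[OF w] p])
  note W = wf_Cons_Univ[OF h]
  show ?thesis
    by (rule inhabitedI, rule ty_Lam[OF to_Type[OF h]], rule conv[OF ty_Var[OF W, of 0]])
      (use weaken_eq[OF eq ext1[OF W]] in \<open>auto simp: sub_eval intro: eq_cumul\<close>)
qed

end

text \<open>Path induction on \<open>q\<close>. The type of \<open>p\<close> and the hypothesis on
  \<open>apd\<close> depend on \<open>w'\<close> and \<open>q\<close>, so the motive is a product
  over \<open>p\<close> of an implication.\<close>

lemma ap_join_map_eq_if_apd:
  assumes f_map: "is_map \<Gamma> A X f" and w: "\<Gamma> \<turnstile> w \<Colon> join A A X f f"
    and w': "\<Gamma> \<turnstile> w' \<Colon> join A A X f f" and q: "\<Gamma> \<turnstile> q \<Colon> Eq (join A A X f f) w w'"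
    and p: "\<Gamma> \<turnstile> p \<Colon> Eq X (join_map A X f w) (join_map A X f w')"
      and h: "inhabited \<Gamma> (apd_join_map_eq A X f w w' q p)"
  shows "inhabited \<Gamma> (ap_join_map_eq A X f w w' q p)"
proof -
  let ?M = "Pi (Eq (wk 2 X) (join_map (wk 2 A) (wk 2 X) (wk 2 f) (wk 2 w))
    (join_map (wk 2 A) (wk 2 X) (wk 2 f) (Var 1)))
    (arr (apd_join_map_eq (wk 3 A) (wk 3 X) (wk 3 f) (wk 3 w) (Var 2) (Var 1) (Var 0))
       (ap_join_map_eq (wk 3 A) (wk 3 X) (wk 3 f) (wk 3 w) (Var 2) (Var 1) (Var 0)))"
  \<comment> \<open>The motive as a function of all its parameters. Its formation is proved once for
    arbitrary contexts and then used in the context of the path induction.\<close>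
  let ?N = "\<lambda>A X f w w' q. Pi (Eq X (join_map A X f w) (join_map A X f w'))
    (arr (apd_join_map_eq (wk 1 A) (wk 1 X) (wk 1 f) (wk 1 w) (wk 1 w') (wk 1 q) (Var 0))
       (ap_join_map_eq (wk 1 A) (wk 1 X) (wk 1 f) (wk 1 w) (wk 1 w') (wk 1 q) (Var 0)))"
  have N: "\<Gamma> \<turnstile> ?N A X f w w' q \<Colon> \<U>"
    if f_map: "is_map \<Gamma> A X f" and w: "\<Gamma> \<turnstile> w \<Colon> join A A X f f"
    and w': "\<Gamma> \<turnstile> w' \<Colon> join A A X f f" and q: "\<Gamma> \<turnstile> q \<Colon> Eq (join A A X f f) w w'" for \<Gamma> A X f w w' q
  proof (rule Pi[OF ty_join_map_path[OF f_map w w']])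
    note W = wf_Cons_Univ[OF ty_join_map_path[OF f_map w w']]
    note e = ext1[OF W]
    note 1 = is_map_wk[OF f_map e]
    have 2: "Eq X (join_map A X f w) (join_map A X f w') # \<Gamma> \<turnstile> wk 1 w \<Colon>
      join (wk 1 A) (wk 1 A) (wk 1 X) (wk 1 f) (wk 1 f)"
      "Eq X (join_map A X f w) (join_map A X f w') # \<Gamma> \<turnstile> wk 1 w' \<Colon>
        join (wk 1 A) (wk 1 A) (wk 1 X) (wk 1 f) (wk 1 f)"
      "Eq X (join_map A X f w) (join_map A X f w') # \<Gamma> \<turnstile> wk 1 q \<Colon>
        Eq (join (wk 1 A) (wk 1 A) (wk 1 X) (wk 1 f) (wk 1 f)) (wk 1 w) (wk 1 w')"
      using weaken[OF w e] weaken[OF w' e] weaken[OF q e] by (simp_all add: sub_eval_defs)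
    have 3: "Eq X (join_map A X f w) (join_map A X f w') # \<Gamma> \<turnstile> Var 0 \<Colon>
        Eq (wk 1 X) (join_map (wk 1 A) (wk 1 X) (wk 1 f) (wk 1 w))
          (join_map (wk 1 A) (wk 1 X) (wk 1 f) (wk 1 w'))"
      by (rule ty_Var[OF W]) (simp_all add: sub_eval_join)
    show "Eq X (join_map A X f w) (join_map A X f w') # \<Gamma> \<turnstile>
      arr (apd_join_map_eq (wk 1 A) (wk 1 X) (wk 1 f) (wk 1 w) (wk 1 w') (wk 1 q) (Var 0))
       (ap_join_map_eq (wk 1 A) (wk 1 X) (wk 1 f) (wk 1 w) (wk 1 w') (wk 1 q) (Var 0)) \<Colon> \<U>"
      by (rule ty_arr[OF ty_apd_join_map_eq[OF 1 2 3] ty_ap_join_map_eq[OF 1 2 3]])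
  qed
  have M: "Eq (wk 1 (join A A X f f)) (wk 1 w) (Var 0) # join A A X f f # \<Gamma> \<turnstile> ?M \<Colon> \<U>"
    using N[OF join_path_map[OF f_map w] join_path_vars(3,1,2)[OF f_map w]]
      by (simp add: sub_eval_join sub_apd_join_map_eq sub_ap_join_map_eq)
  have base: "inhabited \<Gamma> (?N A X f w w (Refl w))"
  proof (rule inhabited_Pi[OF ty_join_map_path[OF f_map w w]])
    note W = wf_Cons_Univ[OF ty_join_map_path[OF f_map w w]]
    note e = ext1[OF W]
    have "Eq X (join_map A X f w) (join_map A X f w) # \<Gamma> \<turnstile> wk 1 w \<Colon>
      join (wk 1 A) (wk 1 A) (wk 1 X) (wk 1 f) (wk 1 f)"
      using weaken[OF w e] by (simp_all add: sub_eval_defs)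
    from ap_join_map_eq_if_apd_refl[OF is_map_wk[OF f_map e] this ty_Var[OF W, of 0]]
    show "inhabited (Eq X (join_map A X f w) (join_map A X f w) # \<Gamma>)
      (arr (apd_join_map_eq (wk 1 A) (wk 1 X) (wk 1 f) (wk 1 w) (wk 1 w) (wk 1 (Refl w)) (Var 0))
       (ap_join_map_eq (wk 1 A) (wk 1 X) (wk 1 f) (wk 1 w) (wk 1 w) (wk 1 (Refl w)) (Var 0)))"
      by (simp add: sub_eval_join)
  qed
  have "inhabited \<Gamma> (?N A X f w w' q)"
    by (rule inhabited_EqInd[OF M w base w' q])
      (simp_all add: sub_eval_join sub_apd_join_map_eq sub_ap_join_map_eq sub_arr)
  from inhabited_App[OF this p, of "arr (apd_join_map_eq A X f w w' q p)
    (ap_join_map_eq A X f w w' q p)"] h show ?thesis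
    by (auto simp: sub_eval_join sub_apd_join_map_eq sub_ap_join_map_eq intro: inhabited_arr_App)
qed

text \<open>The path computation rule describes \<open>apd\<close> on the glue path,
  \<open>ap_join_map_eq_if_apd\<close> turns this into a statement about \<open>ap\<close>, and on a
  triple \<open>pullback_path\<close> computes to \<open>p\<close>. The rest is conversion: the rule
  speaks of \<open>copair\<close> and the edge maps, the claim of \<open>f a\<close>,
  \<open>f b\<close>, \<open>inl a\<close> and \<open>inr b\<close>.\<close>

lemma ap_join_map_Glue:
  assumes f_map: "is_map \<Gamma> A X f"
    and abp: "\<Gamma> \<turnstile> a \<Colon> A" "\<Gamma> \<turnstile> b \<Colon> A" "\<Gamma> \<turnstile> p \<Colon> Eq X (App f a) (App f b)"
  shows "inhabited \<Gamma> (Eq (Eq X (App f a) (App f b))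
    (ap_join_map A X f (inl a) (inr b) (Glue (triple a b p))) p)"
proof -
  let ?e = "triple a b p"
  let ?w = "Pt (App (join_src A X f) ?e)" and ?w' = "Pt (App (join_tgt A X f) ?e)"
  let ?s = "copair X f (App (join_src A X f) ?e)" and ?t = "copair X f (App (join_tgt A X f) ?e)"
  note e = ty_triple(2)[OF f_map abp]
  note J = ty_join[OF f_map] and X = ty_X[OF f_map] and g = ty_Glue[OF f_map e]
  note w = ty_Glue_ends[OF f_map e]
  note s = ty_App_join_src[OF f_map e] ty_App_join_tgt[OF f_map e]
  note copair = ty_copair[OF f_map s(1)] ty_copair[OF f_map s(2)]
  note c = eq_join_map_Pt[OF f_map s(1)] eq_join_map_Pt[OF f_map s(2)]
  have t: "\<Gamma> \<turnstile> pullback_path A X f ?e \<Colon> Eq X (join_map A X f ?w) (join_map A X f ?w')"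
    by (rule conv_sym_Univ[OF ty_pullback_path[OF f_map e]], rule Eq_cong[OF refl[OF X] c])
  have "inhabited \<Gamma> (ap_join_map_eq A X f ?w ?w' (Glue ?e) (pullback_path A X f ?e))"
  proof (rule ap_join_map_eq_if_apd[OF f_map w g t],
    rule inhabited_conv[OF apd_join_map_Glue[OF f_map e]], unfold apd_join_map_eq_def
    join_map_glue_def)
    have T: "\<Gamma> \<turnstile> Eq X (transp_const X ?w ?w' (Glue ?e) ?s) ?t \<doteq>
        Eq X (transp_const X ?w ?w' (Glue ?e) (join_map A X f ?w)) (join_map A X f ?w') \<Colon> \<U>"
      by (intro Eq_cong refl[OF X] transp_const_cong[OF J X w(1,2) g] sym[OF c(1)] sym[OF c(2)])
    show "\<Gamma> \<turnstile> Eq (Eq X (transp_const X ?w ?w' (Glue ?e) ?s) ?t)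
      (apd_join_map A X f ?w ?w' (Glue ?e))
         (transp_path X ?w ?w' (Glue ?e) ?s ?t (pullback_path A X f ?e)) \<doteq>
        Eq (Eq X (transp_const X ?w ?w' (Glue ?e) (join_map A X f ?w)) (join_map A X f ?w'))
          (apd_join_map A X f ?w ?w' (Glue ?e))
         (transp_path X ?w ?w' (Glue ?e) (join_map A X f ?w) (join_map A X f ?w')
           (pullback_path A X f ?e)) \<Colon> \<U>"
      by (rule Eq_cong[OF T refl[OF conv_sym_Univ[OF ty_apd_join_map[OF f_map w g] T]]
            transp_path_cong[OF J X w(1,2) g copair sym[OF c(1)] sym[OF c(2)]
              ty_pullback_path[OF f_map e]]])
  qed
  moreover have "\<Gamma> \<turnstile> ap_join_map_eq A X f ?w ?w' (Glue ?e) (pullback_path A X f ?e) \<doteq>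
      Eq (Eq X (App f a) (App f b)) (ap_join_map A X f (inl a) (inr b) (Glue ?e)) p \<Colon> \<U>"
    unfolding ap_join_map_eq_def
  proof (rule Eq_cong)
    show T: "\<Gamma> \<turnstile> Eq X (join_map A X f ?w) (join_map A X f ?w') \<doteq> Eq X (App f a) (App f b) \<Colon> \<U>"
      by (rule trans[OF Eq_cong[OF refl[OF X] c] eq_copair_path(3)[OF f_map abp]])
    show "\<Gamma> \<turnstile> ap_join_map A X f ?w ?w' (Glue ?e) \<doteq> ap_join_map A X f (inl a) (inr b) (Glue ?e) \<Colon>
      Eq X (join_map A X f ?w) (join_map A X f ?w')"
      by (rule ap_join_map_cong[OF f_map w(1) eq_Pt[OF f_map eq_join_src[OF f_map abp]]
        eq_Pt[OF f_map eq_join_tgt[OF f_map abp]] g])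
    show "\<Gamma> \<turnstile> pullback_path A X f ?e \<doteq> p \<Colon> Eq X (join_map A X f ?w) (join_map A X f ?w')"
      using eq_conv_Univ[OF eq_pullback_path[OF f_map abp] sym[OF T]] .
  qed
  ultimately show ?thesis by (rule inhabited_conv)
qed

section \<open>Homotopy fibers of \<open>f\<close>, and \<open>inl\<close> as a map\<close>

context
  fixes \<Gamma> A X f
  assumes f_map: "is_map \<Gamma> A X f"
begin

lemma ty_fib_path:
  assumes "\<Gamma> \<turnstile> y \<Colon> X"
  shows "A # \<Gamma> \<turnstile> Eq (wk 1 X) (App (wk 1 f) (Var 0)) (wk 1 y) \<Colon> \<U>"
proof -
  note W = wf_Cons_Univ[OF ty_A[OF f_map]]
  note e = ext1[OF W]
  show ?thesis
    by (rule Eq, rule weaken_Univ[OF ty_X[OF f_map] e], rule ty_fa[OF is_map_wk[OF f_map e]],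
      rule ty_Var[OF W])
      (use weaken[OF assms e] in simp_all)
qed

lemma ty_fib: "\<Gamma> \<turnstile> y \<Colon> X \<Longrightarrow> \<Gamma> \<turnstile> fib A X f y \<Colon> \<U>"
  unfolding fib_def using ty_A[OF f_map] ty_fib_path by (rule Sig)

lemma ty_fib_Pr: "\<Gamma> \<turnstile> y \<Colon> X \<Longrightarrow> \<Gamma> \<turnstile> a \<Colon> A \<Longrightarrow> \<Gamma> \<turnstile> r \<Colon> Eq X (App f a) y \<Longrightarrow> \<Gamma> \<turnstile> Pr a r \<Colon> fib A X f y"
  unfolding fib_def by (rule Pr[OF to_Type[OF ty_fib_path]]) (simp_all add: sub_eval)

lemma fib_cong: "\<Gamma> \<turnstile> y \<doteq> y' \<Colon> X \<Longrightarrow> \<Gamma> \<turnstile> fib A X f y \<doteq> fib A X f y' \<Colon> \<U>"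
proof -
  assume y: "\<Gamma> \<turnstile> y \<doteq> y' \<Colon> X"
  note W = wf_Cons_Univ[OF ty_A[OF f_map]]
  note e = ext1[OF W]
  show ?thesis
    unfolding fib_def
    by (rule Sig_cong[OF refl[OF ty_A[OF f_map]]], rule Eq_cong,
      rule refl[OF weaken_Univ[OF ty_X[OF f_map] e]],
      rule refl, rule ty_fa[OF is_map_wk[OF f_map e]], rule ty_Var[OF W])
      (use weaken_eq[OF y e] in simp_all)
qed

lemma wf_fib_ctx:
  assumes "\<Gamma> \<turnstile> y \<Colon> X"
  shows "\<turnstile> Eq (wk 1 X) (App (wk 1 f) (Var 0)) (wk 1 y) # A # \<Gamma>"
  using ty_fib_path[OF assms] by (rule wf_Cons_Univ)

lemma fib_ctx_vars:
  assumes "\<Gamma> \<turnstile> y \<Colon> X"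
  shows "Eq (wk 1 X) (App (wk 1 f) (Var 0)) (wk 1 y) # A # \<Gamma> \<turnstile> Var 1 \<Colon> wk 2 A"
    "Eq (wk 1 X) (App (wk 1 f) (Var 0)) (wk 1 y) # A # \<Gamma> \<turnstile> Var 0 \<Colon>
      Eq (wk 2 X) (App (wk 2 f) (Var 1)) (wk 2 y)"
  by (rule ty_Var[OF wf_fib_ctx[OF assms]]; simp add: sub_eval)+

lemma is_map_inl: "is_map \<Gamma> A (join A A X f f) (pushout_inl A)"
  and eq_pushout_inl: "\<Gamma> \<turnstile> a \<Colon> A \<Longrightarrow> \<Gamma> \<turnstile> App (pushout_inl A) a \<doteq> inl a \<Colon> join A A X f f"
proof -
  note W = wf_Cons_Univ[OF ty_A[OF f_map]]
  have b: "A # \<Gamma> \<turnstile> inl (Var 0) \<Colon> wk 1 (join A A X f f)"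
    using ty_inl[OF is_map_wk[OF f_map ext1[OF W]] ty_Var[OF W, of 0]] by (simp add: sub_eval_defs)
  show "is_map \<Gamma> A (join A A X f f) (pushout_inl A)"
    unfolding is_map_def pushout_inl_def
    using ty_A[OF f_map] ty_join[OF f_map] ty_Lam[OF to_Type[OF ty_A[OF f_map]] b] by simp
  show "\<Gamma> \<turnstile> App (pushout_inl A) a \<doteq> inl a \<Colon> join A A X f f" if "\<Gamma> \<turnstile> a \<Colon> A"
    unfolding pushout_inl_def using b that by (rule eq_beta) (simp_all add: sub_eval_defs)
qed

end

section \<open>If inl is an equivalence, then the map is an embedding\<close>

text \<open>Pair elimination turns the center and the contraction into variables; both points are
  then equal to the center.\<close>

lemma inhabited_contr_eq:
  assumes P: "\<Gamma> \<turnstile> P \<Colon> \<U>" and c: "inhabited \<Gamma> (is_contr P)" and u: "\<Gamma> \<turnstile> u \<Colon> P" and v: "\<Gamma> \<turnstile> v \<Colon> P"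
  shows "inhabited \<Gamma> (Eq P u v)"
proof -
  note W1 = wf_Cons_Univ[OF P]
  note P1 = weaken_Univ[OF P ext1[OF W1]]
  note W2 = wf_Cons_Univ[OF P1]
  have H: "P # \<Gamma> \<turnstile> Pi (wk 1 P) (Eq (wk 2 P) (Var 1) (Var 0)) \<Colon> \<U>"
    by (rule Pi[OF P1 Eq[OF weaken_Univ[OF P ext2[OF W2]]]]; rule ty_Var[OF W2]; simp add: sub_eval)
  note W = wf_Cons_Univ[OF H]
  note e = ext2[OF W]
  let ?\<Delta> = "Pi (wk 1 P) (Eq (wk 2 P) (Var 1) (Var 0)) # P # \<Gamma>"
  have h: "?\<Delta> \<turnstile> Var 0 \<Colon> Pi (wk 2 P) (Eq (wk 3 P) (Var 2) (Var 0))"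
    by (rule ty_Var[OF W]) (simp_all add: sub_eval)
  have c': "?\<Delta> \<turnstile> Var 1 \<Colon> wk 2 P"
    by (rule ty_Var[OF W]) (simp_all add: sub_eval)
  have hx: "inhabited ?\<Delta> (Eq (wk 2 P) (Var 1) (wk 2 x))" if "\<Gamma> \<turnstile> x \<Colon> P" for x
    by (rule inhabitedI, rule ty_App_dep[OF h weaken[OF that e]]) (simp add: sub_eval)
  note P2 = weaken_Univ[OF P e] and u2 = weaken[OF u e] and v2 = weaken[OF v e]
  have 1: "inhabited ?\<Delta> (Eq (wk 2 P) (wk 2 u) (wk 2 v))"
    by (rule inhabited_trans[OF P2 u2 c' v2 inhabited_sym[OF P2 c' u2 hx[OF u]] hx[OF v]])
  have 2: "Sig P (Pi (wk 1 P) (Eq (wk 2 P) (Var 1) (Var 0))) # \<Gamma> \<turnstile> wk 1 (Eq P u v) \<Colon> \<U>"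
    by (rule weaken_Univ[OF Eq[OF P u v] ext1[OF wf_Cons_Univ[OF Sig[OF P H]]]])
  from c obtain t where "\<Gamma> \<turnstile> t \<Colon> is_contr P" by (rule inhabitedE)
  from inhabited_SigInd[OF 2 1 this[unfolded is_contr_def]] show ?thesis by (simp add: sub_eval)
qed

text \<open>
  \<open>(a, r) \<mapsto> (a, ap j r)\<close> from the fiber of \<open>inl\<close> over \<open>inr b\<close> to the fiber of \<open>f\<close> over \<open>f b\<close>,
  where \<open>j\<close> is \<open>join_map\<close>
\<close>

definition fib_map :: "tm \<Rightarrow> tm \<Rightarrow> tm \<Rightarrow> tm \<Rightarrow> tm \<Rightarrow> tm" where
  "fib_map A X f b z = SigInd (fib (wk 1 A) (wk 1 X) (wk 1 f) (wk 1 (App f b)))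
     (Pr (Var 1) (ap_join_map (wk 2 A) (wk 2 X) (wk 2 f) (inl (Var 1)) (inr (wk 2 b)) (Var 0))) z"

lemma sub_fib_map: "sub \<sigma> (fib_map A X f b z) = fib_map (sub \<sigma> A) (sub \<sigma> X) (sub \<sigma> f) (sub \<sigma> b)
  (sub \<sigma> z)"
  by (simp add: fib_map_def sub_eval_join)

lemma ty_ap_join_map_inl_inr:
  assumes f_map: "is_map \<Gamma> A X f" and a: "\<Gamma> \<turnstile> a \<Colon> A" and b: "\<Gamma> \<turnstile> b \<Colon> A"
    and r: "\<Gamma> \<turnstile> r \<Colon> Eq (join A A X f f) (inl a) (inr b)"
  shows "\<Gamma> \<turnstile> ap_join_map A X f (inl a) (inr b) r \<Colon> Eq X (App f a) (App f b)"
  by (rule conv_Univ[OF ty_ap_join_map[OF f_map ty_inl[OF f_map a] ty_inr[OF f_map b] r]],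
      rule Eq_cong[OF refl[OF ty_X[OF f_map]] eq_join_map_inl[OF f_map a]
        eq_join_map_inr[OF f_map b]])

text \<open>Fibers of \<open>inl\<close> are formed with \<open>App (pushout_inl A) a\<close>,
  whereas glue paths start at \<open>inl a\<close>; this conversion mediates between them.\<close>

lemma eq_inl_path:
  assumes f_map: "is_map \<Gamma> A X f" and a: "\<Gamma> \<turnstile> a \<Colon> A" and w: "\<Gamma> \<turnstile> w \<Colon> join A A X f f"
  shows "\<Gamma> \<turnstile> Eq (join A A X f f) (App (pushout_inl A) a) w \<doteq> Eq (join A A X f f) (inl a) w \<Colon> \<U>"
  by (intro Eq_cong refl ty_join f_map w eq_pushout_inl[OF f_map] a)

context
  fixes \<Gamma> A X f b
  assumes f_map: "is_map \<Gamma> A X f" and b: "\<Gamma> \<turnstile> b \<Colon> A"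
begin

lemma fib_map_premises:
  "Sig A (Eq (wk 1 (join A A X f f)) (App (wk 1 (pushout_inl A)) (Var 0)) (wk 1 (inr b))) # \<Gamma> \<turnstile>
     fib (wk 1 A) (wk 1 X) (wk 1 f) (wk 1 (App f b)) \<Colon> Type"
  "Eq (wk 1 (join A A X f f)) (App (wk 1 (pushout_inl A)) (Var 0)) (wk 1 (inr b)) # A # \<Gamma> \<turnstile>
     Pr (Var 1) (ap_join_map (wk 2 A) (wk 2 X) (wk 2 f) (inl (Var 1)) (inr (wk 2 b)) (Var 0)) \<Colon>
     subn 2 (fib (wk 1 A) (wk 1 X) (wk 1 f) (wk 1 (App f b))) (Pr (Var 1) (Var 0))"
proof -
  note m = is_map_inl[OF f_map] and w = ty_inr[OF f_map b]
  have e: "ext 1 \<Gamma> (fib A (join A A X f f) (pushout_inl A) (inr b) # \<Gamma>)"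
    by (rule ext1[OF wf_Cons_Univ[OF ty_fib[OF m w]]])
  show "Sig A (Eq (wk 1 (join A A X f f)) (App (wk 1 (pushout_inl A)) (Var 0)) (wk 1 (inr b))) # \<Gamma> \<turnstile>
     fib (wk 1 A) (wk 1 X) (wk 1 f) (wk 1 (App f b)) \<Colon> Type"
    using to_Type[OF weaken_Univ[OF ty_fib[OF f_map ty_fa[OF f_map b]] e]]
      by (simp add: sub_eval_defs fib_def)
  let ?\<Delta> = "Eq (wk 1 (join A A X f f)) (App (wk 1 (pushout_inl A)) (Var 0)) (wk 1 (inr b)) # A # \<Gamma>"
  have e2: "ext 2 \<Gamma> ?\<Delta>" by (rule ext2[OF wf_fib_ctx[OF m w]])
  note mp2 = is_map_wk[OF f_map e2] and b2 = weaken[OF b e2]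
  note v = fib_ctx_vars[OF m w]
  have w2: "?\<Delta> \<turnstile> inr (wk 2 b) \<Colon> join (wk 2 A) (wk 2 A) (wk 2 X) (wk 2 f) (wk 2 f)"
    by (rule ty_inr[OF mp2 b2])
  have "?\<Delta> \<turnstile> Var 0 \<Colon> Eq (join (wk 2 A) (wk 2 A) (wk 2 X) (wk 2 f) (wk 2 f)) (inl (Var 1))
    (inr (wk 2 b))"
    using conv_Univ[OF _ eq_inl_path[OF mp2 v(1) w2]] v(2) by (simp add: sub_eval_defs)
  from ty_fib_Pr[OF mp2 ty_fa[OF mp2 b2] v(1) ty_ap_join_map_inl_inr[OF mp2 v(1) b2 this]]
  show "?\<Delta> \<turnstile> Pr (Var 1) (ap_join_map (wk 2 A) (wk 2 X) (wk 2 f) (inl (Var 1)) (inr (wk 2 b))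
    (Var 0)) \<Colon>
     subn 2 (fib (wk 1 A) (wk 1 X) (wk 1 f) (wk 1 (App f b))) (Pr (Var 1) (Var 0))"
    by (simp add: sub_eval_defs)
qed

lemma ty_fib_map: "\<Gamma> \<turnstile> z \<Colon> fib A (join A A X f f) (pushout_inl A) (inr b) \<Longrightarrow>
  \<Gamma> \<turnstile> fib_map A X f b z \<Colon> fib A X f (App f b)"
  unfolding fib_map_def fib_def[of A "join A A X f f"] using SigInd[OF fib_map_premises]
    by (simp add: sub_eval_defs)

lemma eq_fib_map:
  assumes a: "\<Gamma> \<turnstile> a \<Colon> A" and r: "\<Gamma> \<turnstile> r \<Colon> Eq (join A A X f f) (inl a) (inr b)"
  shows "\<Gamma> \<turnstile> fib_map A X f b (Pr a r) \<doteq> Pr a (ap_join_map A X f (inl a) (inr b) r) \<Colon>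
    fib A X f (App f b)"
proof -
  have "\<Gamma> \<turnstile> r \<Colon> Eq (join A A X f f) (App (pushout_inl A) a) (inr b)"
    by (rule conv_sym_Univ[OF r eq_inl_path[OF f_map a ty_inr[OF f_map b]]])
  then show ?thesis
    using Sig_beta[OF fib_map_premises a, of r] unfolding fib_map_def by (simp add: sub_eval_join)
qed

end

lemma fib_eq_Refl_if_inl_equiv:
  assumes f_map: "is_map \<Gamma> A X f"
    and eqv: "inhabited \<Gamma> (is_equiv A (join A A X f f) (pushout_inl A))"
    and abp: "\<Gamma> \<turnstile> a \<Colon> A" "\<Gamma> \<turnstile> b \<Colon> A" "\<Gamma> \<turnstile> p \<Colon> Eq X (App f a) (App f b)"
  shows "inhabited \<Gamma> (Eq (fib A X f (App f b)) (Pr a p) (Pr b (Refl (App f b))))"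
proof -
  note m = is_map_inl[OF f_map] and w = ty_inr[OF f_map abp(2)] and fb = ty_fa[OF f_map abp(2)]
  let ?F = "fib A (join A A X f f) (pushout_inl A) (inr b)"
  let ?Q = "fib A X f (App f b)"
  note F = ty_fib[OF m w] and Q = ty_fib[OF f_map fb]
  have contr: "inhabited \<Gamma> (is_contr ?F)"
    by (rule inhabited_App[OF eqv[unfolded is_equiv_def] w]) (simp add: sub_eval_defs)
  \<comment> \<open>Stated for all \<open>a\<close> and \<open>p\<close> because it is used twice:
    for the given pair, and for \<open>b\<close> with reflexivity.\<close>
  have *: "inhabited \<Gamma> (Eq ?Q (Pr a (ap_join_map A X f (inl a) (inr b) (Glue (triple a b p))))
    (Pr a p))"
    and u: "\<Gamma> \<turnstile> Pr a (Glue (triple a b p)) \<Colon> ?F"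
    and t: "\<Gamma> \<turnstile> Pr a (ap_join_map A X f (inl a) (inr b) (Glue (triple a b p))) \<Colon> ?Q"
    and eq: "\<Gamma> \<turnstile> fib_map A X f b (Pr a (Glue (triple a b p))) \<doteq>
      Pr a (ap_join_map A X f (inl a) (inr b) (Glue (triple a b p))) \<Colon> ?Q"
    if a: "\<Gamma> \<turnstile> a \<Colon> A" and p: "\<Gamma> \<turnstile> p \<Colon> Eq X (App f a) (App f b)" for a p
  proof -
    note g = ty_glue[OF f_map a abp(2) p]
    note ap = ty_ap_join_map_inl_inr[OF f_map a abp(2) g]
    show "\<Gamma> \<turnstile> Pr a (Glue (triple a b p)) \<Colon> ?F"
      by (rule ty_fib_Pr[OF m w a conv_sym_Univ[OF g eq_inl_path[OF f_map a w]]])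
    show t: "\<Gamma> \<turnstile> Pr a (ap_join_map A X f (inl a) (inr b) (Glue (triple a b p))) \<Colon> ?Q"
      by (rule ty_fib_Pr[OF f_map fb a ap])
    show "\<Gamma> \<turnstile> fib_map A X f b (Pr a (Glue (triple a b p))) \<doteq>
      Pr a (ap_join_map A X f (inl a) (inr b) (Glue (triple a b p))) \<Colon> ?Q"
      by (rule eq_fib_map[OF f_map abp(2) a g])
    let ?P = "Eq X (App f a) (App f b)"
    have P: "\<Gamma> \<turnstile> ?P \<Colon> \<U>" by (rule Eq[OF ty_X[OF f_map] ty_fa[OF f_map a] fb])
    note W = wf_Cons_Univ[OF P]
    note e = ext1[OF W]
    have "?P # \<Gamma> \<turnstile> Var 0 \<Colon> Eq (wk 1 X) (App (wk 1 f) (wk 1 a)) (wk 1 (App f b))"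
      by (rule ty_Var[OF W]) (simp_all add: sub_eval)
    from ty_fib_Pr[OF is_map_wk[OF f_map e] weaken[OF fb e] weaken[OF a e] this]
    have "?P # \<Gamma> \<turnstile> Pr (wk 1 a) (Var 0) \<Colon> wk 1 ?Q" by (simp add: sub_eval_defs)
    \<comment> \<open>The path between the second components is pushed through
      \<open>r \<mapsto> (a, r)\<close>.\<close>
    from inhabited_ap[OF P Q this ap p ap_join_map_Glue[OF f_map a abp(2) p] t]
    show "inhabited \<Gamma> (Eq ?Q (Pr a (ap_join_map A X f (inl a) (inr b) (Glue (triple a b p))))
      (Pr a p))"
      by (simp add: sub_eval)
  qed
  let ?r = "Refl (App f b)"
  note r = Refl[OF fb]
  note ap = * [OF abp(1,3)] and bp = * [OF abp(2) r]
  note W = wf_Cons_Univ[OF F]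
  note e = ext1[OF W]
  have "?F # \<Gamma> \<turnstile> fib_map (wk 1 A) (wk 1 X) (wk 1 f) (wk 1 b) (Var 0) \<Colon> wk 1 ?Q"
    using ty_fib_map[OF is_map_wk[OF f_map e] weaken[OF abp(2) e] ty_Var[OF W, of 0]]
      by (simp add: sub_eval_defs)
  from inhabited_ap[OF F Q this u[OF abp(1,3)] u[OF abp(2) r]
      inhabited_contr_eq[OF F contr u[OF abp(1,3)] u[OF abp(2) r]]
        ty_fib_map[OF f_map abp(2) u[OF abp(1,3)]]]
  have "inhabited \<Gamma> (Eq ?Q (fib_map A X f b (Pr a (Glue (triple a b p))))
    (fib_map A X f b (Pr b (Glue (triple b b ?r)))))"
    by (simp add: sub_eval sub_fib_map)
  then have "inhabited \<Gamma> (Eq ?Q (Pr a (ap_join_map A X f (inl a) (inr b) (Glue (triple a b p))))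
      (Pr b (ap_join_map A X f (inl b) (inr b) (Glue (triple b b ?r)))))"
    by (rule inhabited_conv) (rule Eq_cong[OF refl[OF Q] eq[OF abp(1,3)] eq[OF abp(2) r]])
  \<comment> \<open>The chain is
    \<open>(a, p) = (a, ap j glue) = (b, ap j glue) = (b, refl)\<close>. The middle path is the
    image under \<open>fib_map\<close> of the one given by contractibility.\<close>
  from inhabited_trans[OF Q _ _ _ inhabited_sym[OF Q _ _ ap] inhabited_trans[OF Q _ _ _ this bp]]
  show ?thesis using t[OF abp(1,3)] t[OF abp(2) r] ty_fib_Pr[OF f_map fb] abp r by blast
qed

section \<open>Formation of the two conditions, and equality of arbitrary points of a fiber\<close>

lemma ty_is_prop:
  assumes P: "\<Gamma> \<turnstile> P \<Colon> \<U>"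
  shows "\<Gamma> \<turnstile> is_prop P \<Colon> \<U>" and "P # \<Gamma> \<turnstile> Pi (wk 1 P) (Eq (wk 2 P) (Var 1) (Var 0)) \<Colon> \<U>"
    and "\<turnstile> wk 1 P # P # \<Gamma>"
proof -
  note W1 = wf_Cons_Univ[OF P]
  note P1 = weaken_Univ[OF P ext1[OF W1]]
  show W2: "\<turnstile> wk 1 P # P # \<Gamma>" using P1 by (rule wf_Cons_Univ)
  show 1: "P # \<Gamma> \<turnstile> Pi (wk 1 P) (Eq (wk 2 P) (Var 1) (Var 0)) \<Colon> \<U>"
    by (rule Pi[OF P1 Eq[OF weaken_Univ[OF P ext2[OF W2]]]]; rule ty_Var[OF W2]; simp add: sub_eval)
  show "\<Gamma> \<turnstile> is_prop P \<Colon> \<U>" unfolding is_prop_def using P 1 by (rule Pi)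
qed

lemma ty_is_contr: "\<Gamma> \<turnstile> P \<Colon> \<U> \<Longrightarrow> \<Gamma> \<turnstile> is_contr P \<Colon> \<U>"
  unfolding is_contr_def using ty_is_prop(2) by (blast intro: Sig)

lemma is_map_fib_var:
  assumes f_map: "is_map \<Gamma> A X f"
  shows "X # \<Gamma> \<turnstile> fib (wk 1 A) (wk 1 X) (wk 1 f) (Var 0) \<Colon> \<U>"
proof -
  note W = wf_Cons_Univ[OF ty_X[OF f_map]]
  show ?thesis
    by (rule ty_fib[OF is_map_wk[OF f_map ext1[OF W]]], rule ty_Var[OF W]) simp_all
qed

lemma ty_is_emb: "is_map \<Gamma> A X f \<Longrightarrow> \<Gamma> \<turnstile> is_emb A X f \<Colon> \<U>"
  unfolding is_emb_def by (intro Pi ty_X ty_is_prop(1) is_map_fib_var)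

lemma ty_is_equiv: "is_map \<Gamma> A X f \<Longrightarrow> \<Gamma> \<turnstile> is_equiv A X f \<Colon> \<U>"
  unfolding is_equiv_def by (intro Pi ty_X ty_is_contr is_map_fib_var)

lemma ty_fib_pair_path:
  assumes f_map: "is_map \<Gamma> A X f" and y: "\<Gamma> \<turnstile> y \<Colon> X"
    and a: "\<Gamma> \<turnstile> a \<Colon> A" and b: "\<Gamma> \<turnstile> b \<Colon> A" and q: "\<Gamma> \<turnstile> q \<Colon> Eq X (App f b) y"
  shows "\<Gamma> \<turnstile> Eq X (App f a) y \<Colon> \<U>"
    and "Eq X (App f a) y # \<Gamma> \<turnstile> Eq (fib (wk 1 A) (wk 1 X) (wk 1 f) (wk 1 y))
      (Pr (wk 1 a) (Var 0)) (Pr (wk 1 b) (wk 1 q)) \<Colon> \<U>"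
proof -
  show P: "\<Gamma> \<turnstile> Eq X (App f a) y \<Colon> \<U>" by (rule Eq[OF ty_X[OF f_map] ty_fa[OF f_map a] y])
  note W = wf_Cons_Univ[OF P]
  note e = ext1[OF W]
  note mp1 = is_map_wk[OF f_map e] and y1 = weaken[OF y e] and a1 = weaken[OF a e]
    and b1 = weaken[OF b e]
  have "Eq X (App f a) y # \<Gamma> \<turnstile> Var 0 \<Colon> Eq (wk 1 X) (App (wk 1 f) (wk 1 a)) (wk 1 y)"
    by (rule ty_Var[OF W]) (simp_all add: sub_eval)
  moreover have "Eq X (App f a) y # \<Gamma> \<turnstile> wk 1 q \<Colon> Eq (wk 1 X) (App (wk 1 f) (wk 1 b)) (wk 1 y)"
    using weaken[OF q e] by (simp add: sub_eval)
  ultimately show "Eq X (App f a) y # \<Gamma> \<turnstile> Eq (fib (wk 1 A) (wk 1 X) (wk 1 f) (wk 1 y))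
      (Pr (wk 1 a) (Var 0)) (Pr (wk 1 b) (wk 1 q)) \<Colon> \<U>"
    by (intro Eq ty_fib[OF mp1] ty_fib_Pr[OF mp1] y1 a1 b1)
qed

text \<open>Since \<open>p\<close> also ends at \<open>y\<close>, it is generalized by a
  \<open>Pi\<close> in the motive before the path induction on \<open>q\<close> replaces
  \<open>y\<close> by \<open>f b\<close>.\<close>

lemma fib_eq_Pr_if_inl_equiv:
  assumes f_map: "is_map \<Gamma> A X f"
    and eqv: "inhabited \<Gamma> (is_equiv A (join A A X f f) (pushout_inl A))"
    and y: "\<Gamma> \<turnstile> y \<Colon> X" and a: "\<Gamma> \<turnstile> a \<Colon> A" and p: "\<Gamma> \<turnstile> p \<Colon> Eq X (App f a) y"
    and b: "\<Gamma> \<turnstile> b \<Colon> A" and q: "\<Gamma> \<turnstile> q \<Colon> Eq X (App f b) y"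
  shows "inhabited \<Gamma> (Eq (fib A X f y) (Pr a p) (Pr b q))"
proof -
  note X = ty_X[OF f_map] and fb = ty_fa[OF f_map b]
  let ?\<Delta> = "Eq (wk 1 X) (wk 1 (App f b)) (Var 0) # X # \<Gamma>"
  note e = path_ext[OF X X fb] and v = path_vars[OF X X fb]
  note mp2 = is_map_wk[OF f_map e]
  have v0: "?\<Delta> \<turnstile> Var 0 \<Colon> Eq (wk 2 X) (App (wk 2 f) (wk 2 b)) (Var 1)" using v(2)
    by (simp add: sub_eval)
  note m = ty_fib_pair_path[OF mp2 v(1) weaken[OF a e] weaken[OF b e] v0]
  have base: "inhabited \<Gamma> (Pi (Eq X (App f a) (App f b))
    (Eq (fib (wk 1 A) (wk 1 X) (wk 1 f) (wk 1 (App f b)))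
      (Pr (wk 1 a) (Var 0)) (Pr (wk 1 b) (wk 1 (Refl (App f b))))))"
  proof (rule inhabited_Pi)
    show P: "\<Gamma> \<turnstile> Eq X (App f a) (App f b) \<Colon> \<U>" by (rule Eq[OF ty_X[OF f_map] ty_fa[OF f_map a] fb])
    note W = wf_Cons_Univ[OF P]
    note e = ext1[OF W]
    have "Eq X (App f a) (App f b) # \<Gamma> \<turnstile> Var 0 \<Colon>
      Eq (wk 1 X) (App (wk 1 f) (wk 1 a)) (App (wk 1 f) (wk 1 b))"
      by (rule ty_Var[OF W]) (simp_all add: sub_eval)
    from fib_eq_Refl_if_inl_equiv[OF is_map_wk[OF f_map e] _ weaken[OF a e] weaken[OF b e] this]
    show "inhabited (Eq X (App f a) (App f b) # \<Gamma>)
      (Eq (fib (wk 1 A) (wk 1 X) (wk 1 f) (wk 1 (App f b)))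
      (Pr (wk 1 a) (Var 0)) (Pr (wk 1 b) (wk 1 (Refl (App f b)))))"
      using inhabited_wk[OF eqv e] by (simp add: sub_eval_defs)
  qed
  have "inhabited \<Gamma> (Pi (Eq X (App f a) y) (Eq (fib (wk 1 A) (wk 1 X) (wk 1 f) (wk 1 y))
      (Pr (wk 1 a) (Var 0)) (Pr (wk 1 b) (wk 1 q))))"
    by (rule inhabited_EqInd[OF Pi[OF m] fb base y q]) (simp_all add: sub_eval_defs)
  from inhabited_App[OF this p] show ?thesis by (simp add: sub_eval_defs)
qed

text \<open>For lack of a judgemental eta rule the two points are split by separate pair
  eliminations.\<close>

lemma fib_eq_if_inl_equiv:
  assumes f_map: "is_map \<Gamma> A X f"
    and eqv: "inhabited \<Gamma> (is_equiv A (join A A X f f) (pushout_inl A))"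
    and y: "\<Gamma> \<turnstile> y \<Colon> X" and u: "\<Gamma> \<turnstile> u \<Colon> fib A X f y" and v: "\<Gamma> \<turnstile> v \<Colon> fib A X f y"
  shows "inhabited \<Gamma> (Eq (fib A X f y) u v)"
proof -
  \<comment> \<open>This splits the second point. It is stated for every context because it is
    applied after the first point has become a pair of variables.\<close>
  have right: "inhabited \<Gamma> (Eq (fib A X f y) (Pr a p) v)"
    if f_map: "is_map \<Gamma> A X f" and eqv: "inhabited \<Gamma> (is_equiv A (join A A X f f) (pushout_inl A))"
    and y: "\<Gamma> \<turnstile> y \<Colon> X" and a: "\<Gamma> \<turnstile> a \<Colon> A" and p: "\<Gamma> \<turnstile> p \<Colon> Eq X (App f a) y"
    and v: "\<Gamma> \<turnstile> v \<Colon> fib A X f y" for \<Gamma> A X f y a p v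
  proof -
    note F = ty_fib[OF f_map y]
    note W = wf_Cons_Univ[OF F]
    note e = ext1[OF W]
    have "fib A X f y # \<Gamma> \<turnstile> Eq (wk 1 (fib A X f y)) (wk 1 (Pr a p)) (Var 0) \<Colon> \<U>"
      by (rule Eq[OF weaken_Univ[OF F e] weaken[OF ty_fib_Pr[OF f_map y a p] e] ty_Var[OF W]])
        simp_all
    note C = this[unfolded fib_def[of A X f y]]
    note e2 = ext2[OF wf_fib_ctx[OF f_map y]] and vs = fib_ctx_vars[OF f_map y]
    have 1: "inhabited (Eq (wk 1 X) (App (wk 1 f) (Var 0)) (wk 1 y) # A # \<Gamma>)
        (Eq (wk 2 (fib A X f y)) (wk 2 (Pr a p)) (Pr (Var 1) (Var 0)))"
      using fib_eq_Pr_if_inl_equiv[OF is_map_wk[OF f_map e2] _ weaken[OF y e2] weaken[OF a e2] _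
        vs, of "wk 2 p"]
        weaken[OF p e2] inhabited_wk[OF eqv e2] by (simp add: sub_eval_defs)
    show ?thesis
      by (rule inhabited_SigInd[OF C 1 v[unfolded fib_def]]) (simp_all add: sub_eval fib_def)
  qed
  note F = ty_fib[OF f_map y]
  note W = wf_Cons_Univ[OF F]
  note e = ext1[OF W]
  have "fib A X f y # \<Gamma> \<turnstile> Eq (wk 1 (fib A X f y)) (Var 0) (wk 1 v) \<Colon> \<U>"
    by (rule Eq[OF weaken_Univ[OF F e] ty_Var[OF W] weaken[OF v e]]) simp_all
  note C = this[unfolded fib_def[of A X f y]]
  note e2 = ext2[OF wf_fib_ctx[OF f_map y]] and vs = fib_ctx_vars[OF f_map y]
  have 1: "inhabited (Eq (wk 1 X) (App (wk 1 f) (Var 0)) (wk 1 y) # A # \<Gamma>)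
      (Eq (wk 2 (fib A X f y)) (Pr (Var 1) (Var 0)) (wk 2 v))"
    using right[OF is_map_wk[OF f_map e2] _ weaken[OF y e2] vs, of "wk 2 v"]
      weaken[OF v e2] inhabited_wk[OF eqv e2] by (simp add: sub_eval_defs)
  show ?thesis
    by (rule inhabited_SigInd[OF C 1 u[unfolded fib_def]]) (simp_all add: sub_eval fib_def)
qed

lemma is_emb_if_inl_equiv:
  assumes f_map: "is_map \<Gamma> A X f"
    and eqv: "inhabited \<Gamma> (is_equiv A (join A A X f f) (pushout_inl A))"
  shows "inhabited \<Gamma> (is_emb A X f)"
  unfolding is_emb_def
proof (rule inhabited_Pi[OF ty_X[OF f_map]])
  have P: "inhabited \<Gamma> (is_prop (fib A X f y))"
    if f_map: "is_map \<Gamma> A X f" and eqv: "inhabited \<Gamma> (is_equiv A (join A A X f f) (pushout_inl A))"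
    and y: "\<Gamma> \<turnstile> y \<Colon> X" for \<Gamma> A X f y
  proof -
    let ?P = "fib A X f y"
    note F = ty_fib[OF f_map y]
    note W = ty_is_prop(3)[OF F]
    note e = ext2[OF W]
    have vs: "wk 1 ?P # ?P # \<Gamma> \<turnstile> Var 1 \<Colon> fib (wk 2 A) (wk 2 X) (wk 2 f) (wk 2 y)"
      "wk 1 ?P # ?P # \<Gamma> \<turnstile> Var 0 \<Colon> fib (wk 2 A) (wk 2 X) (wk 2 f) (wk 2 y)"
      by (rule ty_Var[OF W]; simp add: sub_eval_defs)+
    have "inhabited (wk 1 ?P # ?P # \<Gamma>) (Eq (wk 2 ?P) (Var 1) (Var 0))"
      using fib_eq_if_inl_equiv[OF is_map_wk[OF f_map e] _ weaken[OF y e] vs] inhabited_wk[OF eqv e]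
      by (simp add: sub_eval_defs)
    then show ?thesis
      unfolding is_prop_def
      by (intro inhabited_Pi[OF F] inhabited_Pi[OF weaken_Univ[OF F ext1[OF wf_Cons_Univ[OF F]]]])
  qed
  note W = wf_Cons_Univ[OF ty_X[OF f_map]]
  note e = ext1[OF W]
  show "inhabited (X # \<Gamma>) (is_prop (fib (wk 1 A) (wk 1 X) (wk 1 f) (Var 0)))"
    by (rule P[OF is_map_wk[OF f_map e]], use inhabited_wk[OF eqv e] in \<open>simp add: sub_eval_defs\<close>,
      rule ty_Var[OF W]) simp_all
qed

section \<open>Transport in a dependent family\<close>

context
  fixes \<Gamma> A a C l l'
  assumes A: "\<Gamma> \<turnstile> A \<Colon> Univ l" and C: "A # \<Gamma> \<turnstile> C \<Colon> Univ l'" and a: "\<Gamma> \<turnstile> a \<Colon> A"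
begin

lemma transp_motive: "Eq (wk 1 A) (wk 1 a) (Var 0) # A # \<Gamma> \<turnstile> wk 1 C \<Colon> Univ l'"
  using C by (rule weaken_Univ) (rule ext1[OF wf_path_ctx[OF A a]])

lemma ty_transp: "\<Gamma> \<turnstile> b \<Colon> A \<Longrightarrow> \<Gamma> \<turnstile> q \<Colon> Eq A a b \<Longrightarrow> \<Gamma> \<turnstile> u \<Colon> Ta \<Longrightarrow> Ta = sub1 C a \<Longrightarrow> sub1 C b = Tb \<Longrightarrow>
    \<Gamma> \<turnstile> transp C a b q u \<Colon> Tb"
  unfolding transp_def by (rule ty_EqInd[OF transp_motive a]) (simp_all add: sub_eval)

lemma eq_transp: "\<Gamma> \<turnstile> u \<Colon> Ta \<Longrightarrow> Ta = sub1 C a \<Longrightarrow> \<Gamma> \<turnstile> transp C a a (Refl a) u \<doteq> u \<Colon> Ta"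
  unfolding transp_def by (rule eq_EqInd[OF transp_motive a]) (simp_all add: sub_eval)

lemma transp_cong: "\<Gamma> \<turnstile> a \<doteq> a' \<Colon> A \<Longrightarrow> \<Gamma> \<turnstile> b \<doteq> b' \<Colon> A \<Longrightarrow> \<Gamma> \<turnstile> q \<Colon> Eq A a b \<Longrightarrow> \<Gamma> \<turnstile> u \<doteq> u' \<Colon> Ta \<Longrightarrow>
    Ta = sub1 C a \<Longrightarrow> sub1 C b = Tb \<Longrightarrow> \<Gamma> \<turnstile> transp C a b q u \<doteq> transp C a' b' q u' \<Colon> Tb"
  unfolding transp_def
  using EqInd_cong[OF refl[OF to_Type[OF transp_motive]], of a' u u' b b' q q]
    by (simp add: sub_eval refl)

end

abbreviation inl_fib :: "tm \<Rightarrow> tm \<Rightarrow> tm \<Rightarrow> tm \<Rightarrow> tm" where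
  "inl_fib A X f w \<equiv> fib A (join A A X f f) (pushout_inl A) w"

abbreviation inl_fib_family :: "tm \<Rightarrow> tm \<Rightarrow> tm \<Rightarrow> tm" where
  "inl_fib_family A X f \<equiv> inl_fib (wk 1 A) (wk 1 X) (wk 1 f) (Var 0)"

section \<open>If the map is an embedding, then inl is an equivalence\<close>

definition center_pt :: "tm \<Rightarrow> tm \<Rightarrow> tm \<Rightarrow> tm \<Rightarrow> tm" where
  "center_pt A X f v = SumInd (inl_fib (wk 1 A) (wk 1 X) (wk 1 f) (Pt (Var 0)))
     (Pr (Var 0) (Refl (inl (Var 0))))
     (Pr (Var 0) (Glue (triple (Var 0) (Var 0) (Refl (App (wk 1 f) (Var 0)))))) v"

lemma sub_center_pt: "sub \<sigma> (center_pt A X f v) = center_pt (sub \<sigma> A) (sub \<sigma> X) (sub \<sigma> f) (sub \<sigma> v)"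
  by (simp add: center_pt_def sub_eval_join)

text \<open>The datum over \<open>Glue e\<close> still missing in order to extend
  \<open>center_pt\<close> from points to the whole join.\<close>

definition center_path :: "tm \<Rightarrow> tm \<Rightarrow> tm \<Rightarrow> tm \<Rightarrow> tm" where
  "center_path A X f e = coeq_path (inl_fib_family A X f)
    (center_pt (wk 1 A) (wk 1 X) (wk 1 f) (Var 0)) (join_src A X f) (join_tgt A X f) e"

lemma center_path_eq: "center_path A X f e = Eq (inl_fib A X f (Pt (App (join_tgt A X f) e)))
    (transp (inl_fib_family A X f) (Pt (App (join_src A X f) e)) (Pt (App (join_tgt A X f) e))
      (Glue e) (center_pt A X f (App (join_src A X f) e)))
    (center_pt A X f (App (join_tgt A X f) e))"
  by (simp add: center_path_def coeq_path_def sub_center_pt sub_eval_defs)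

text \<open>The embedding hypothesis is used here, for the fiber over \<open>f b\<close>. The
  resulting path is pushed along \<open>(a, r) \<mapsto> (a, b, r)\<close>; it starts at the
  diagonal because \<open>center_path\<close> is first inhabited there and then transported.\<close>

lemma is_emb_triple_eq:
  assumes f_map: "is_map \<Gamma> A X f" and emb: "inhabited \<Gamma> (is_emb A X f)"
    and abp: "\<Gamma> \<turnstile> a \<Colon> A" "\<Gamma> \<turnstile> b \<Colon> A" "\<Gamma> \<turnstile> p \<Colon> Eq X (App f a) (App f b)"
  shows "inhabited \<Gamma> (Eq (pullback A A X f f) (triple b b (Refl (App f b))) (triple a b p))"
proof -
  note fb = ty_fa[OF f_map abp(2)]
  note r = Refl[OF fb]
  let ?P = "fib A X f (App f b)" and ?S = "pullback A A X f f"
  note P = ty_fib[OF f_map fb] and S = ty_pb[OF f_map]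
  note u = ty_fib_Pr[OF f_map fb abp(2) r] and v = ty_fib_Pr[OF f_map fb abp(1,3)]
  have "inhabited \<Gamma> (is_prop ?P)"
    by (rule inhabited_App[OF emb[unfolded is_emb_def] fb]) (simp add: sub_eval_defs)
  from inhabited_App[OF this[unfolded is_prop_def] u]
  have "inhabited \<Gamma> (Pi ?P (Eq (wk 1 ?P) (wk 1 (Pr b (Refl (App f b)))) (Var 0)))"
    by (simp add: sub_eval)
  from inhabited_App[OF this v] have eq: "inhabited \<Gamma> (Eq ?P (Pr b (Refl (App f b))) (Pr a p))"
    by (simp add: sub_eval)
  let ?phi = "\<lambda>A X f b z. SigInd (wk 1 (pullback A A X f f)) (triple (Var 1) (wk 2 b) (Var 0)) z"
  have prem: "Sig A (Eq (wk 1 X) (App (wk 1 f) (Var 0)) (wk 1 (App f b))) # \<Gamma> \<turnstile> wk 1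
    (pullback A A X f f) \<Colon> Type"
    "Eq (wk 1 X) (App (wk 1 f) (Var 0)) (wk 1 (App f b)) # A # \<Gamma> \<turnstile> triple (Var 1) (wk 2 b) (Var 0) \<Colon>
      subn 2 (wk 1 (pullback A A X f f)) (Pr (Var 1) (Var 0))"
    if f_map: "is_map \<Gamma> A X f" and b: "\<Gamma> \<turnstile> b \<Colon> A" for \<Gamma> A X f b
  proof -
    note fb = ty_fa[OF f_map b]
    show "Sig A (Eq (wk 1 X) (App (wk 1 f) (Var 0)) (wk 1 (App f b))) # \<Gamma> \<turnstile> wk 1
      (pullback A A X f f) \<Colon> Type"
      using weaken_Univ[OF to_Type[OF ty_pb[OF f_map]]
        ext1[OF wf_Cons_Univ[OF ty_fib[OF f_map fb]]]] by (simp add: fib_def)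
    note e = ext2[OF wf_fib_ctx[OF f_map fb]] and vs = fib_ctx_vars[OF f_map fb]
    show "Eq (wk 1 X) (App (wk 1 f) (Var 0)) (wk 1 (App f b)) # A # \<Gamma> \<turnstile> triple (Var 1) (wk 2 b)
      (Var 0) \<Colon>
      subn 2 (wk 1 (pullback A A X f f)) (Pr (Var 1) (Var 0))"
      using ty_triple(2)[OF is_map_wk[OF f_map e] vs(1) weaken[OF b e]] vs(2)
        by (simp add: sub_eval_defs)
  qed
  have ty: "\<Gamma> \<turnstile> ?phi A X f b z \<Colon> pullback A A X f f"
    if "is_map \<Gamma> A X f" and "\<Gamma> \<turnstile> b \<Colon> A" and "\<Gamma> \<turnstile> z \<Colon> fib A X f (App f b)" for \<Gamma> A X f b z
    using SigInd[OF prem[OF that(1,2)] that(3)[unfolded fib_def]] by (simp add: sub_eval)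
  have beta: "\<Gamma> \<turnstile> ?phi A X f b (Pr a p) \<doteq> triple a b p \<Colon> ?S"
    if "\<Gamma> \<turnstile> a \<Colon> A" and "\<Gamma> \<turnstile> p \<Colon> Eq X (App f a) (App f b)" for a p
    using Sig_beta[OF prem[OF f_map abp(2)] that(1), of p] that(2) by (simp add: sub_eval)
  note W = wf_Cons_Univ[OF P]
  note e = ext1[OF W]
  have phi: "?P # \<Gamma> \<turnstile> ?phi (wk 1 A) (wk 1 X) (wk 1 f) (wk 1 b) (Var 0) \<Colon> wk 1 ?S"
    using ty[OF is_map_wk[OF f_map e] weaken[OF abp(2) e] ty_Var[OF W, of 0]]
      by (simp add: sub_eval_defs)
  have "inhabited \<Gamma> (Eq ?S (?phi A X f b (Pr b (Refl (App f b)))) (?phi A X f b (Pr a p)))"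
    by (rule inhabited_ap[OF P S phi u v eq ty[OF f_map abp(2) u]]) (simp_all add: sub_eval_defs)
  then show ?thesis
    by (rule inhabited_conv) (rule Eq_cong[OF refl[OF S] beta[OF abp(2) r] beta[OF abp(1,3)]])
qed

context
  fixes \<Gamma> A X f
  assumes f_map: "is_map \<Gamma> A X f"
begin

lemma ty_inl_fib: "\<Gamma> \<turnstile> w \<Colon> join A A X f f \<Longrightarrow> \<Gamma> \<turnstile> inl_fib A X f w \<Colon> \<U>"
  by (rule ty_fib[OF is_map_inl[OF f_map]])

lemma ty_inl_fib_family: "join A A X f f # \<Gamma> \<turnstile> inl_fib_family A X f \<Colon> \<U>"
  using is_map_fib_var[OF is_map_inl[OF f_map]] by (simp add: sub_eval_defs)

lemma ty_inl_fib_Pr: "\<Gamma> \<turnstile> w \<Colon> join A A X f f \<Longrightarrow> \<Gamma> \<turnstile> a \<Colon> A \<Longrightarrow> \<Gamma> \<turnstile> r \<Colon> Eq (join A A X f f) (inl a) w \<Longrightarrow>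
    \<Gamma> \<turnstile> Pr a r \<Colon> inl_fib A X f w"
  by (rule ty_fib_Pr[OF is_map_inl[OF f_map] _ _ conv_sym_Univ[OF _ eq_inl_path[OF f_map]]])

lemma ty_Glue_diag: "\<Gamma> \<turnstile> b \<Colon> A \<Longrightarrow>
    \<Gamma> \<turnstile> Glue (triple b b (Refl (App f b))) \<Colon> Eq (join A A X f f) (inl b) (inr b)"
  by (rule ty_glue[OF f_map _ _ Refl[OF ty_fa[OF f_map]]])

end

context
  fixes \<Gamma> A X f
  assumes f_map: "is_map \<Gamma> A X f"
begin

lemma center_pt_premises:
  "Sum A A # \<Gamma> \<turnstile> inl_fib (wk 1 A) (wk 1 X) (wk 1 f) (Pt (Var 0)) \<Colon> Type"
  "A # \<Gamma> \<turnstile> Pr (Var 0) (Refl (inl (Var 0))) \<Colon>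
    subn 1 (inl_fib (wk 1 A) (wk 1 X) (wk 1 f) (Pt (Var 0))) (InL (Var 0))"
  "A # \<Gamma> \<turnstile> Pr (Var 0) (Glue (triple (Var 0) (Var 0) (Refl (App (wk 1 f) (Var 0))))) \<Colon>
    subn 1 (inl_fib (wk 1 A) (wk 1 X) (wk 1 f) (Pt (Var 0))) (InR (Var 0))"
proof -
  note S = ty_Sum[OF f_map]
  note W = wf_Cons_Univ[OF S]
  note mp1 = is_map_wk[OF f_map ext1[OF W]]
  have "Sum A A # \<Gamma> \<turnstile> Var 0 \<Colon> Sum (wk 1 A) (wk 1 A)"
    by (rule ty_Var[OF W]) (simp_all add: sub_eval)
  from to_Type[OF ty_inl_fib[OF mp1 ty_Pt[OF mp1 this]]]
  show "Sum A A # \<Gamma> \<turnstile> inl_fib (wk 1 A) (wk 1 X) (wk 1 f) (Pt (Var 0)) \<Colon> Type" .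
  note W = wf_Cons_Univ[OF ty_A[OF f_map]]
  note mp1 = is_map_wk[OF f_map ext1[OF W]]
  have v: "A # \<Gamma> \<turnstile> Var 0 \<Colon> wk 1 A" by (rule ty_Var[OF W]) simp_all
  show "A # \<Gamma> \<turnstile> Pr (Var 0) (Refl (inl (Var 0))) \<Colon>
      subn 1 (inl_fib (wk 1 A) (wk 1 X) (wk 1 f) (Pt (Var 0))) (InL (Var 0))"
    using ty_inl_fib_Pr[OF mp1 ty_inl[OF mp1 v] v Refl[OF ty_inl[OF mp1 v]]]
      by (simp add: sub_eval_defs)
  show "A # \<Gamma> \<turnstile> Pr (Var 0) (Glue (triple (Var 0) (Var 0) (Refl (App (wk 1 f) (Var 0))))) \<Colon>
      subn 1 (inl_fib (wk 1 A) (wk 1 X) (wk 1 f) (Pt (Var 0))) (InR (Var 0))"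
    using ty_inl_fib_Pr[OF mp1 ty_inr[OF mp1 v] v ty_Glue_diag[OF mp1 v]]
      by (simp add: sub_eval_defs)
qed

lemma ty_center_pt: "\<Gamma> \<turnstile> v \<Colon> Sum A A \<Longrightarrow> \<Gamma> \<turnstile> center_pt A X f v \<Colon> inl_fib A X f (Pt v)"
  unfolding center_pt_def using SumInd[OF center_pt_premises] by (simp add: sub_eval_defs)

lemma center_pt_cong: "\<Gamma> \<turnstile> v \<doteq> v' \<Colon> Sum A A \<Longrightarrow> \<Gamma> \<turnstile> center_pt A X f v \<doteq> center_pt A X f v' \<Colon>
  inl_fib A X f (Pt v)"
  unfolding center_pt_def using SumInd_cong[OF center_pt_premises[THEN refl]]
    by (simp add: sub_eval_defs)

lemma eq_center_pt_InL: "\<Gamma> \<turnstile> a \<Colon> A \<Longrightarrow> \<Gamma> \<turnstile> center_pt A X f (InL a) \<doteq> Pr a (Refl (inl a)) \<Colon>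
  inl_fib A X f (inl a)"
  unfolding center_pt_def using Sum_beta_l[OF center_pt_premises] by (simp add: sub_eval_defs)

lemma eq_center_pt_InR: "\<Gamma> \<turnstile> a \<Colon> A \<Longrightarrow>
    \<Gamma> \<turnstile> center_pt A X f (InR a) \<doteq> Pr a (Glue (triple a a (Refl (App f a)))) \<Colon> inl_fib A X f (inr a)"
  unfolding center_pt_def using Sum_beta_r[OF center_pt_premises] by (simp add: sub_eval_defs)

text \<open>Path induction on \<open>q\<close>: over reflexivity the transport computes and
  reflexivity is a proof.\<close>

lemma inhabited_transp_Pr:
  assumes b: "\<Gamma> \<turnstile> b \<Colon> A" and w: "\<Gamma> \<turnstile> w \<Colon> join A A X f f"
    and q: "\<Gamma> \<turnstile> q \<Colon> Eq (join A A X f f) (inl b) w"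
  shows "inhabited \<Gamma> (Eq (inl_fib A X f w)
    (transp (inl_fib_family A X f) (inl b) w q (Pr b (Refl (inl b)))) (Pr b q))"
proof -
  note J = ty_join[OF f_map] and X = ty_X[OF f_map] and ib = ty_inl[OF f_map b]
  have N: "\<Gamma> \<turnstile> Eq (inl_fib A X f w)
    (transp (inl_fib_family A X f) (inl b) w q (Pr b (Refl (inl b)))) (Pr b q) \<Colon> \<U>"
    if f_map: "is_map \<Gamma> A X f" and b: "\<Gamma> \<turnstile> b \<Colon> A" and w: "\<Gamma> \<turnstile> w \<Colon> join A A X f f"
    and q: "\<Gamma> \<turnstile> q \<Colon> Eq (join A A X f f) (inl b) w" for \<Gamma> A X f b w q
  proof (intro Eq ty_inl_fib ty_inl_fib_Pr f_map b w q)
    note ib = ty_inl[OF f_map b]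
    show "\<Gamma> \<turnstile> transp (inl_fib_family A X f) (inl b) w q (Pr b (Refl (inl b))) \<Colon> inl_fib A X f w"
      by (rule ty_transp[OF ty_join[OF f_map] ty_inl_fib_family[OF f_map] ib w q
        ty_inl_fib_Pr[OF f_map ib b Refl[OF ib]]])
        (simp_all add: sub_eval_defs)
  qed
  note e = join_path_ext[OF f_map ib]
  have base: "inhabited \<Gamma> (Eq (inl_fib A X f (inl b))
    (transp (inl_fib_family A X f) (inl b) (inl b) (Refl (inl b)) (Pr b (Refl (inl b))))
      (Pr b (Refl (inl b))))"
  proof (rule inhabited_conv[OF inhabitedI[OF Refl]])
    note c = ty_inl_fib_Pr[OF f_map ib b Refl[OF ib]]
    show "\<Gamma> \<turnstile> Pr b (Refl (inl b)) \<Colon> inl_fib A X f (inl b)" by (rule c)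
    show "\<Gamma> \<turnstile> Eq (inl_fib A X f (inl b)) (Pr b (Refl (inl b))) (Pr b (Refl (inl b))) \<doteq>
      Eq (inl_fib A X f (inl b)) (transp (inl_fib_family A X f) (inl b) (inl b) (Refl (inl b))
        (Pr b (Refl (inl b))))
      (Pr b (Refl (inl b))) \<Colon> \<U>"
      by (rule Eq_cong[OF refl[OF ty_inl_fib[OF f_map ib]] sym refl[OF c]],
          rule eq_transp[OF J ty_inl_fib_family[OF f_map] ib c]) (simp add: sub_eval_defs)
  qed
  have q2: "Eq (wk 1 (join A A X f f)) (wk 1 (inl b)) (Var 0) # join A A X f f # \<Gamma> \<turnstile> Var 0 \<Colon>
      Eq (join (wk 2 A) (wk 2 A) (wk 2 X) (wk 2 f) (wk 2 f)) (inl (wk 2 b)) (Var 1)"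
    using join_path_vars(2)[OF f_map ib] by (simp add: sub_eval)
  show ?thesis
    by (rule inhabited_EqInd[OF N[OF join_path_map[OF f_map ib] weaken[OF b e]
      join_path_vars(1)[OF f_map ib] q2] ib base w q])
      (simp_all add: sub_eval_defs)
qed

end

lemma sub_center_path: "sub \<sigma> (center_path A X f e) = center_path (sub \<sigma> A) (sub \<sigma> X) (sub \<sigma> f)
  (sub \<sigma> e)"
  by (simp add: center_path_def sub_eval_join sub_center_pt)

context
  fixes \<Gamma> A X f
  assumes f_map: "is_map \<Gamma> A X f"
begin

lemma ty_center_path:
  assumes e: "\<Gamma> \<turnstile> e \<Colon> pullback A A X f f"
  shows "\<Gamma> \<turnstile> center_path A X f e \<Colon> \<U>"
  unfolding center_path_eq
proof (intro Eq ty_inl_fib[OF f_map] ty_center_pt[OF f_map] ty_App_join_tgt[OF f_map]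
  ty_Glue_ends[OF f_map] e)
  show "\<Gamma> \<turnstile> transp (inl_fib_family A X f) (Pt (App (join_src A X f) e))
    (Pt (App (join_tgt A X f) e)) (Glue e)
      (center_pt A X f (App (join_src A X f) e)) \<Colon> inl_fib A X f (Pt (App (join_tgt A X f) e))"
    by (rule ty_transp[OF ty_join[OF f_map] ty_inl_fib_family[OF f_map] ty_Glue_ends[OF f_map e]
      ty_Glue[OF f_map e]
          ty_center_pt[OF f_map ty_App_join_src[OF f_map e]]]) (simp_all add: sub_eval_defs)
qed

text \<open>The edge maps reduce to \<open>InL b\<close> and \<open>InR b\<close>, and
  \<open>center_pt\<close> computes on both. The type is then judgementally
  \<open>inhabited_transp_Pr\<close> for the diagonal glue path.\<close>

lemma center_path_diag:
  assumes b: "\<Gamma> \<turnstile> b \<Colon> A"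
  shows "inhabited \<Gamma> (center_path A X f (triple b b (Refl (App f b))))"
  unfolding center_path_eq
proof (rule inhabited_conv[OF inhabited_transp_Pr[OF f_map b ty_inr[OF f_map b]
  ty_Glue_diag[OF f_map b]] sym[OF Eq_cong]])
  note r = Refl[OF ty_fa[OF f_map b]]
  let ?e = "triple b b (Refl (App f b))"
  note e = ty_triple(2)[OF f_map b b r]
  note s = eq_join_src[OF f_map b b r] and t = eq_join_tgt[OF f_map b b r]
  note Ps = eq_Pt[OF f_map s] and Pt = eq_Pt[OF f_map t]
  show F: "\<Gamma> \<turnstile> inl_fib A X f (Pt (App (join_tgt A X f) ?e)) \<doteq> inl_fib A X f (inr b) \<Colon> \<U>"
    by (rule fib_cong[OF is_map_inl[OF f_map] Pt])
  have Fs: "\<Gamma> \<turnstile> inl_fib A X f (Pt (App (join_src A X f) ?e)) \<doteq> inl_fib A X f (inl b) \<Colon> \<U>"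
    by (rule fib_cong[OF is_map_inl[OF f_map] Ps])
  show "\<Gamma> \<turnstile> center_pt A X f (App (join_tgt A X f) ?e) \<doteq> Pr b (Glue ?e) \<Colon>
    inl_fib A X f (Pt (App (join_tgt A X f) ?e))"
    by (rule trans[OF center_pt_cong[OF f_map t]
      eq_conv_Univ[OF eq_center_pt_InR[OF f_map b] sym[OF F]]])
  have c: "\<Gamma> \<turnstile> center_pt A X f (App (join_src A X f) ?e) \<doteq> Pr b (Refl (inl b)) \<Colon>
    inl_fib A X f (Pt (App (join_src A X f) ?e))"
    by (rule trans[OF center_pt_cong[OF f_map s]
      eq_conv_Univ[OF eq_center_pt_InL[OF f_map b] sym[OF Fs]]])
  show "\<Gamma> \<turnstile> transp (inl_fib_family A X f) (Pt (App (join_src A X f) ?e))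
    (Pt (App (join_tgt A X f) ?e)) (Glue ?e)
      (center_pt A X f (App (join_src A X f) ?e)) \<doteq> transp (inl_fib_family A X f) (inl b) (inr b)
        (Glue ?e) (Pr b (Refl (inl b))) \<Colon>
      inl_fib A X f (Pt (App (join_tgt A X f) ?e))"
    by (rule transp_cong[OF ty_join[OF f_map] ty_inl_fib_family[OF f_map]
      ty_Glue_ends(1)[OF f_map e] Ps Pt ty_Glue[OF f_map e] c])
      (simp_all add: sub_eval_defs)
qed

end

lemma ty_center_path_var: "is_map \<Gamma> A X f \<Longrightarrow>
    pullback A A X f f # \<Gamma> \<turnstile> center_path (wk 1 A) (wk 1 X) (wk 1 f) (Var 0) \<Colon> \<U>"
  using ty_center_path[OF is_map_pb ty_pb_var] by blast

lemma inhabited_center_path: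
  assumes f_map: "is_map \<Gamma> A X f" and emb: "inhabited \<Gamma> (is_emb A X f)"
    and e: "\<Gamma> \<turnstile> e \<Colon> pullback A A X f f"
  shows "inhabited \<Gamma> (center_path A X f e)"
proof -
  \<comment> \<open>Transport from the diagonal along \<open>is_emb_triple_eq\<close>. The general
    context is needed since the claim is next applied to three variables, as the step of a
    \<open>triple_ind\<close>.\<close>
  have triple: "inhabited \<Gamma> (center_path A X f (triple a b p))"
    if f_map: "is_map \<Gamma> A X f" and emb: "inhabited \<Gamma> (is_emb A X f)"
      and abp: "\<Gamma> \<turnstile> a \<Colon> A" "\<Gamma> \<turnstile> b \<Colon> A" "\<Gamma> \<turnstile> p \<Colon> Eq X (App f a) (App f b)" for \<Gamma> A X f a b p
    by (rule inhabited_transport[OF ty_pb[OF f_map] ty_center_path_var[OF f_map]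
          ty_triple(2)[OF f_map abp(2,2) Refl[OF ty_fa[OF f_map abp(2)]]] ty_triple(2)[OF f_map abp]
          is_emb_triple_eq[OF f_map emb abp] center_path_diag[OF f_map abp(2)]])
      (simp_all add: sub_eval_defs sub_center_path)
  let ?\<Delta> = "fpath X f # wk 1 A # A # \<Gamma>"
  have "inhabited ?\<Delta> (is_emb (wk 3 A) (wk 3 X) (wk 3 f))"
    using inhabited_wk[OF emb ext3[OF wf_fpath[OF f_map]]] by (simp add: sub_eval_defs)
  from triple[OF fpath_map[OF f_map] this fpath_vars[OF f_map]]
  obtain g where "?\<Delta> \<turnstile> g \<Colon> center_path (wk 3 A) (wk 3 X) (wk 3 f) (triple (Var 2) (Var 1) (Var 0))"
    by (rule inhabitedE)
  then have g: "?\<Delta> \<turnstile> g \<Colon> sub (scons (triple (Var 2) (Var 1) (Var 0)) (\<lambda>i. Var (i + 3)))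
      (center_path (wk 1 A) (wk 1 X) (wk 1 f) (Var 0))"
    by (simp add: sub_center_path sub_eval)
  show ?thesis
    by (rule inhabitedI[OF ty_triple_ind[OF ty_center_path_var[OF f_map, unfolded pb_eq] g
      e[unfolded pb_eq]]])
      (simp add: sub_center_path sub_eval)
qed

text \<open>Here mere inhabitation is not enough: the same datum \<open>d\<close> must occur in
  \<open>center\<close> and in its computation rule, also after weakening.\<close>

definition glue_data :: "tm list \<Rightarrow> tm \<Rightarrow> tm \<Rightarrow> tm \<Rightarrow> tm \<Rightarrow> bool" where
  "glue_data \<Gamma> A X f d \<longleftrightarrow> pullback A A X f f # \<Gamma> \<turnstile> d \<Colon>
    center_path (wk 1 A) (wk 1 X) (wk 1 f) (Var 0)"

text \<open>\<open>d\<close> has a free pullback variable, so the renaming acts underneath one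
  binder. This accounts for \<open>wkb\<close> and for the second clause of
  \<open>sub_judgementD\<close>.\<close>

lemma glue_data_wk:
  assumes d: "glue_data \<Gamma> A X f d" and e: "ext n \<Gamma> \<Delta>"
  shows "glue_data \<Delta> (wk n A) (wk n X) (wk n f) (wkb n d)"
proof -
  have "renaming.sub_typing (pullback A A X f f # \<Gamma>) d
    (center_path (wk 1 A) (wk 1 X) (wk 1 f) (Var 0))"
    using d unfolding glue_data_def by (rule renaming.preserves_judgements(2))
  from renaming.sub_judgementD(2)[OF this ext_is_ren[OF e]] show ?thesis
    unfolding glue_data_def by (simp add: sub_eval_defs sub_center_path)
qed

definition center :: "tm \<Rightarrow> tm \<Rightarrow> tm \<Rightarrow> tm \<Rightarrow> tm \<Rightarrow> tm" where
  "center A X f d w = CoeqInd (inl_fib_family A X f)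
    (center_pt (wk 1 A) (wk 1 X) (wk 1 f) (Var 0)) d w"

lemma sub_center: "sub \<sigma> (center A X f d w) = center (sub \<sigma> A) (sub \<sigma> X) (sub \<sigma> f) (sub (ups \<sigma>) d)
  (sub \<sigma> w)"
  by (simp add: center_def sub_eval_defs sub_center_pt)

context
  fixes \<Gamma> A X f d
  assumes f_map: "is_map \<Gamma> A X f" and d: "glue_data \<Gamma> A X f d"
begin

lemma center_premises:
  "Coeq (pullback A A X f f) (Sum A A) (join_src A X f) (join_tgt A X f) # \<Gamma> \<turnstile> inl_fib_family A X
    f \<Colon> Type"
  "Sum A A # \<Gamma> \<turnstile> center_pt (wk 1 A) (wk 1 X) (wk 1 f) (Var 0) \<Colon>
    subn 1 (inl_fib_family A X f) (Pt (Var 0))"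
  "pullback A A X f f # \<Gamma> \<turnstile> d \<Colon> coeq_path (wkb 1 (inl_fib_family A X f))
     (wkb 1 (center_pt (wk 1 A) (wk 1 X) (wk 1 f) (Var 0))) (wk 1 (join_src A X f))
       (wk 1 (join_tgt A X f)) (Var 0)"
proof -
  show "Coeq (pullback A A X f f) (Sum A A) (join_src A X f) (join_tgt A X f) # \<Gamma> \<turnstile> inl_fib_family
    A X f \<Colon> Type"
    using to_Type[OF ty_inl_fib_family[OF f_map]] unfolding join_eq[symmetric] .
  note W = wf_Cons_Univ[OF ty_Sum[OF f_map]]
  show "Sum A A # \<Gamma> \<turnstile> center_pt (wk 1 A) (wk 1 X) (wk 1 f) (Var 0) \<Colon>
    subn 1 (inl_fib_family A X f) (Pt (Var 0))"
    using ty_center_pt[OF is_map_wk[OF f_map ext1[OF W]] ty_Var[OF W, of 0]]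
      by (simp add: sub_eval_defs)
  show "pullback A A X f f # \<Gamma> \<turnstile> d \<Colon> coeq_path (wkb 1 (inl_fib_family A X f))
     (wkb 1 (center_pt (wk 1 A) (wk 1 X) (wk 1 f) (Var 0))) (wk 1 (join_src A X f))
       (wk 1 (join_tgt A X f)) (Var 0)"
    using d unfolding glue_data_def center_path_def by (simp add: sub_eval_join sub_center_pt)
qed

lemma ty_center: "\<Gamma> \<turnstile> w \<Colon> join A A X f f \<Longrightarrow> \<Gamma> \<turnstile> center A X f d w \<Colon> inl_fib A X f w"
  using CoeqInd[OF center_premises, of w] unfolding center_def join_eq[symmetric]
    by (simp add: sub_eval_defs)

lemma eq_center:
  assumes a: "\<Gamma> \<turnstile> a \<Colon> A"
  shows "\<Gamma> \<turnstile> center A X f d (inl a) \<doteq> Pr a (Refl (inl a)) \<Colon> inl_fib A X f (inl a)"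
proof (rule trans)
  show "\<Gamma> \<turnstile> center A X f d (inl a) \<doteq> center_pt A X f (InL a) \<Colon> inl_fib A X f (inl a)"
    using Coeq_beta[OF center_premises InL[OF to_Type[OF ty_Sum[OF f_map]] a]]
    unfolding center_def join_eq[symmetric] by (simp add: sub_eval_defs sub_center_pt)
  show "\<Gamma> \<turnstile> center_pt A X f (InL a) \<doteq> Pr a (Refl (inl a)) \<Colon> inl_fib A X f (inl a)"
    by (rule eq_center_pt_InL[OF f_map a])
qed

end

text \<open>In the base case the two sides agree judgementally by \<open>eq_center\<close>, since
  the section was chosen to be \<open>(a, refl)\<close> on left points.\<close>

lemma center_eq_Pr:
  assumes f_map: "is_map \<Gamma> A X f" and d: "glue_data \<Gamma> A X f d"
    and a: "\<Gamma> \<turnstile> a \<Colon> A" and w: "\<Gamma> \<turnstile> w \<Colon> join A A X f f"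
      and r: "\<Gamma> \<turnstile> r \<Colon> Eq (join A A X f f) (inl a) w"
  shows "inhabited \<Gamma> (Eq (inl_fib A X f w) (center A X f d w) (Pr a r))"
proof -
  note ia = ty_inl[OF f_map a]
  note e = join_path_ext[OF f_map ia] and mp2 = join_path_map[OF f_map ia]
  let ?\<Delta> = "Eq (wk 1 (join A A X f f)) (wk 1 (inl a)) (Var 0) # join A A X f f # \<Gamma>"
  have r2: "?\<Delta> \<turnstile> Var 0 \<Colon> Eq (join (wk 2 A) (wk 2 A) (wk 2 X) (wk 2 f) (wk 2 f)) (inl (wk 2 a))
    (Var 1)"
    using join_path_vars(2)[OF f_map ia] by (simp add: sub_eval)
  have M: "?\<Delta> \<turnstile> Eq (inl_fib (wk 2 A) (wk 2 X) (wk 2 f) (Var 1))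
      (center (wk 2 A) (wk 2 X) (wk 2 f) (wkb 2 d) (Var 1)) (Pr (wk 2 a) (Var 0)) \<Colon> \<U>"
    by (intro Eq ty_inl_fib[OF mp2] ty_center[OF mp2 glue_data_wk[OF d e]] ty_inl_fib_Pr[OF mp2]
      join_path_vars(1)[OF f_map ia]
        weaken[OF a e] r2)
  have base: "inhabited \<Gamma> (Eq (inl_fib A X f (inl a)) (center A X f d (inl a))
    (Pr a (Refl (inl a))))"
  proof (rule inhabited_conv[OF inhabitedI[OF Refl]])
    show c: "\<Gamma> \<turnstile> center A X f d (inl a) \<Colon> inl_fib A X f (inl a)" by (rule ty_center[OF f_map d ia])
    show "\<Gamma> \<turnstile> Eq (inl_fib A X f (inl a)) (center A X f d (inl a)) (center A X f d (inl a)) \<doteq>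
        Eq (inl_fib A X f (inl a)) (center A X f d (inl a)) (Pr a (Refl (inl a))) \<Colon> \<U>"
      by (rule Eq_cong[OF refl[OF ty_inl_fib[OF f_map ia]] refl[OF c] eq_center[OF f_map d a]])
  qed
  show ?thesis
    by (rule inhabited_EqInd[OF M ia base w r]) (simp_all add: sub_eval_defs sub_center)
qed

lemma center_eq:
  assumes f_map: "is_map \<Gamma> A X f" and d: "glue_data \<Gamma> A X f d"
    and w: "\<Gamma> \<turnstile> w \<Colon> join A A X f f" and z: "\<Gamma> \<turnstile> z \<Colon> inl_fib A X f w"
  shows "inhabited \<Gamma> (Eq (inl_fib A X f w) (center A X f d w) z)"
proof -
  note F = ty_inl_fib[OF f_map w] and c = ty_center[OF f_map d w] and m = is_map_inl[OF f_map]
  note W = wf_Cons_Univ[OF F]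
  note e = ext1[OF W]
  have "inl_fib A X f w # \<Gamma> \<turnstile> Eq (wk 1 (inl_fib A X f w)) (wk 1 (center A X f d w)) (Var 0) \<Colon> \<U>"
    by (rule Eq[OF weaken_Univ[OF F e] weaken[OF c e] ty_Var[OF W]]) simp_all
  note C = this[unfolded fib_def[of A "join A A X f f"]]
  let ?\<Delta> = "Eq (wk 1 (join A A X f f)) (App (wk 1 (pushout_inl A)) (Var 0)) (wk 1 w) # A # \<Gamma>"
  note e2 = ext2[OF wf_fib_ctx[OF m w]] and vs = fib_ctx_vars[OF m w]
  note mp2 = is_map_wk[OF f_map e2]
  have w2: "?\<Delta> \<turnstile> wk 2 w \<Colon> join (wk 2 A) (wk 2 A) (wk 2 X) (wk 2 f) (wk 2 f)"
    using weaken[OF w e2] by (simp add: sub_eval_defs)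
  have r2: "?\<Delta> \<turnstile> Var 0 \<Colon> Eq (join (wk 2 A) (wk 2 A) (wk 2 X) (wk 2 f) (wk 2 f)) (inl (Var 1))
    (wk 2 w)"
    using conv_Univ[OF _ eq_inl_path[OF mp2 vs(1) w2]] vs(2) by (simp add: sub_eval_defs)
  have 1: "inhabited ?\<Delta> (Eq (wk 2 (inl_fib A X f w)) (wk 2 (center A X f d w))
    (Pr (Var 1) (Var 0)))"
    using center_eq_Pr[OF mp2 glue_data_wk[OF d e2] vs(1) w2 r2]
      by (simp add: sub_eval_defs sub_center)
  show ?thesis
    by (rule inhabited_SigInd[OF C 1 z[unfolded fib_def]]) (simp_all add: sub_eval fib_def)
qed

lemma inl_equiv_if_is_emb:
  assumes f_map: "is_map \<Gamma> A X f" and emb: "inhabited \<Gamma> (is_emb A X f)"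
  shows "inhabited \<Gamma> (is_equiv A (join A A X f f) (pushout_inl A))"
proof -
  note e = ext1[OF wf_pb[OF f_map]]
  have "inhabited (pullback A A X f f # \<Gamma>) (is_emb (wk 1 A) (wk 1 X) (wk 1 f))"
    using inhabited_wk[OF emb e] by (simp add: sub_eval_defs)
  \<comment> \<open>The datum is taken at the generic element \<open>Var 0\<close> of the pullback,
    which is the form in which \<open>CoeqInd\<close> consumes it.\<close>
  from inhabited_center_path[OF is_map_pb[OF f_map] this ty_pb_var[OF f_map]]
  obtain d where d: "glue_data \<Gamma> A X f d"
    unfolding glue_data_def by (rule inhabitedE)
  have P: "inhabited \<Gamma> (is_contr (inl_fib A X f w))"
    if f_map: "is_map \<Gamma> A X f" and d: "glue_data \<Gamma> A X f d" and w: "\<Gamma> \<turnstile> w \<Colon> join A A X f f"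
    for \<Gamma> A X f d w
  proof -
    note F = ty_inl_fib[OF f_map w] and c = ty_center[OF f_map d w]
    note W = wf_Cons_Univ[OF F]
    note e = ext1[OF W]
    have v: "inl_fib A X f w # \<Gamma> \<turnstile> Var 0 \<Colon> inl_fib (wk 1 A) (wk 1 X) (wk 1 f) (wk 1 w)"
      by (rule ty_Var[OF W]) (simp_all add: sub_eval_defs)
    have w1: "inl_fib A X f w # \<Gamma> \<turnstile> wk 1 w \<Colon> join (wk 1 A) (wk 1 A) (wk 1 X) (wk 1 f) (wk 1 f)"
      using weaken[OF w e] by (simp add: sub_eval_defs)
    have "inhabited \<Gamma> (Pi (inl_fib A X f w)
      (Eq (wk 1 (inl_fib A X f w)) (wk 1 (center A X f d w)) (Var 0)))"
      by (rule inhabited_Pi[OF F])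
        (use center_eq[OF is_map_wk[OF f_map e] glue_data_wk[OF d e] w1 v] in \<open>simp
          add: sub_eval_defs sub_center\<close>)
    then obtain h where "\<Gamma> \<turnstile> h \<Colon> Pi (inl_fib A X f w)
      (Eq (wk 1 (inl_fib A X f w)) (wk 1 (center A X f d w)) (Var 0))"
      by (rule inhabitedE)
    then have "\<Gamma> \<turnstile> h \<Colon> sub1 (Pi (wk 1 (inl_fib A X f w))
      (Eq (wk 2 (inl_fib A X f w)) (Var 1) (Var 0))) (center A X f d w)"
      by (simp add: sub_eval)
    from inhabitedI[OF Pr[OF to_Type[OF ty_is_prop(2)[OF F]] c this]] show ?thesis
      unfolding is_contr_def .
  qed
  note J = ty_join[OF f_map]
  note W = wf_Cons_Univ[OF J]
  note e = ext1[OF W]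
  have v: "join A A X f f # \<Gamma> \<turnstile> Var 0 \<Colon> join (wk 1 A) (wk 1 A) (wk 1 X) (wk 1 f) (wk 1 f)"
    by (rule ty_Var[OF W]) (simp_all add: sub_eval_defs)
  show ?thesis
    unfolding is_equiv_def
    by (rule inhabited_Pi[OF J]) (use P[OF is_map_wk[OF f_map e] glue_data_wk[OF d e] v] in \<open>simp
      add: sub_eval_defs\<close>)
qed

section \<open>Combining the two implications\<close>

lemma inhabited_iff:
  assumes P: "\<Gamma> \<turnstile> P \<Colon> \<U>" and Q: "\<Gamma> \<turnstile> Q \<Colon> \<U>"
    and PQ: "inhabited (P # \<Gamma>) (wk 1 Q)" and QP: "inhabited (Q # \<Gamma>) (wk 1 P)"
  shows "inhabited \<Gamma> (iff P Q)"
proof -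
  obtain h k where h: "\<Gamma> \<turnstile> h \<Colon> arr P Q" and k: "\<Gamma> \<turnstile> k \<Colon> arr Q P"
    using inhabited_arr[OF P PQ] inhabited_arr[OF Q QP] by (auto simp: inhabited_def)
  note a = ty_arr[OF P Q] and b = ty_arr[OF Q P]
  have "\<Gamma> \<turnstile> Pr h k \<Colon> iff P Q"
    unfolding iff_def prd_def
    by (rule Pr[OF to_Type[OF weaken_Univ[OF b ext1[OF wf_Cons_Univ[OF a]]]] h])
      (use k in \<open>simp add: sub_eval\<close>)
  then show ?thesis by (rule inhabitedI)
qed

lemma emb_iff_inl_equiv:
  assumes f_map: "is_map \<Gamma> A X f"
  shows "inhabited \<Gamma> (iff (is_emb A X f) (is_equiv A (join A A X f f) (pushout_inl A)))"
proof -
  note P = ty_is_emb[OF f_map] and Q = ty_is_equiv[OF is_map_inl[OF f_map]]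
  note WP = wf_Cons_Univ[OF P] and WQ = wf_Cons_Univ[OF Q]
  \<comment> \<open>The antecedent is declared as a variable, and the implication proved above is
    applied to the map weakened past it. The converse is treated in the same way.\<close>
  have "inhabited (is_emb A X f # \<Gamma>) (is_emb (wk 1 A) (wk 1 X) (wk 1 f))"
    by (rule inhabitedI[OF ty_Var[OF WP, of 0]]) (simp_all add: sub_eval_defs)
  from inl_equiv_if_is_emb[OF is_map_wk[OF f_map ext1[OF WP]] this]
  have PQ: "inhabited (is_emb A X f # \<Gamma>) (wk 1 (is_equiv A (join A A X f f) (pushout_inl A)))"
    by (simp add: sub_eval_defs)
  have "inhabited (is_equiv A (join A A X f f) (pushout_inl A) # \<Gamma>)
      (is_equiv (wk 1 A) (join (wk 1 A) (wk 1 A) (wk 1 X) (wk 1 f) (wk 1 f))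
        (pushout_inl (wk 1 A)))"
    by (rule inhabitedI[OF ty_Var[OF WQ, of 0]]) (simp_all add: sub_eval_defs)
  from is_emb_if_inl_equiv[OF is_map_wk[OF f_map ext1[OF WQ]] this]
  have QP: "inhabited (is_equiv A (join A A X f f) (pushout_inl A) # \<Gamma>) (wk 1 (is_emb A X f))"
    by (simp add: sub_eval_defs)
  show ?thesis by (rule inhabited_iff[OF P Q PQ QP])
qed

theorem theorem3p6:
  shows "\<exists>t. [] \<turnstile> t \<Colon>
    Pi \<U> (Pi \<U> (Pi (arr (Var 1) (Var 0))
      (let A = Var 2; X = Var 1; f = Var 0 in
        iff (is_emb A X f)
            (is_equiv A (join A A X f f) (pushout_inl A)))))"
proof -
  have U1: "[] \<turnstile> \<U> \<Colon> Type" by (rule Univ[OF wf_Nil])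
  note W1 = wf_Cons_Univ[OF U1]
  have U2: "[\<U>] \<turnstile> \<U> \<Colon> Type" by (rule Univ[OF W1])
  note W2 = wf_Cons_Univ[OF U2]
  have F: "[\<U>, \<U>] \<turnstile> arr (Var 1) (Var 0) \<Colon> \<U>"
    by (rule ty_arr; rule ty_Var[OF W2]; simp add: sub_eval)
  note W3 = wf_Cons_Univ[OF F]
  have "is_map [arr (Var 1) (Var 0), \<U>, \<U>] (Var 2) (Var 1) (Var 0)"
    unfolding is_map_def by (intro conjI; rule ty_Var[OF W3]; simp add: sub_eval_defs)
  \<comment> \<open>The general statement for the three variables is abstracted with
    \<open>inhabited_Pi\<close>, which accepts the large domain \<open>\<U>\<close> as well as the
    small function type.\<close>
  from emb_iff_inl_equiv[OF this] inhabited_Pi[OF U1 inhabited_Pi[OF U2 inhabited_Pi[OF F]]]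
  show ?thesis by (simp add: Let_def inhabited_def)
qed

end
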